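(* Let $A\in\mathrm{GL}_2(\mathbb{Z})$ with $\det(A)=-1$ and let $G_A=\mathbb{Z}^2\rtimes_A\mathbb{Z}$. If $\mathrm{tr}(A)^2-4\det(A)$ is square-free, then $\#\mathfrak{g}(\mathcal{PF},G_A)=h(\mathbb{Z}[\lambda])$, where $\lambda$ is an eigenvalue of $A$.
   Context: For $A\in\mathrm{GL}_2(\mathbb{Z})$, $G_A=\mathbb{Z}^2\rtimes_A\mathbb{Z}$ is the semidirect product in which the generator $1\in\mathbb{Z}$ acts on $\mathbb{Z}^2$ via $A$. $\widehat{G}$ denotes the profinite completion of $G$. $\mathcal{PF}$ is the class of polycyclic-by-finite groups; for $G\in\mathcal{PF}$, $\mathfrak{g}(\mathcal{PF},G)$ is the set of isomorphism classes of groups $H\in\mathcal{PF}$ with $\widehat{H}\cong\widehat{G}$, and $\#$ denotes cardinality. $h(\mathcal{O})$ is the order of the ideal class group (Picard group) of the order $\mathcal{O}$, i.e. invertible fractional ideals modulo principal fractional ideals. *)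

theory Defs
  imports
    "HOL-Analysis.Analysis"
    "HOL-Algebra.Product_Groups"
    "HOL-Algebra.Elementary_Groups"
    "HOL-Algebra.Bij"
    "HOL-Computational_Algebra.Squarefree"
begin

section \<open>Semidirect products and the groups $G_A$\<close>

definition semidirect_product ::
  "('a, 'm) monoid_scheme \<Rightarrow> ('b, 'n) monoid_scheme \<Rightarrow> ('b \<Rightarrow> 'a \<Rightarrow> 'a) \<Rightarrow> ('a \<times> 'b) monoid"
  where "semidirect_product H K \<phi> =
    \<lparr>carrier = carrier H \<times> carrier K,
     monoid.mult = (\<lambda>(h, k) (h', k'). (h \<otimes>\<^bsub>H\<^esub> \<phi> k h', k \<otimes>\<^bsub>K\<^esub> k')),
     one = (\<one>\<^bsub>H\<^esub>, \<one>\<^bsub>K\<^esub>)\<rparr>"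

lemma group_semidirect_product:
  assumes "group H" "group K" and hom: "\<phi> \<in> hom K (AutoGroup H)"
  shows "group (semidirect_product H K \<phi>)"
proof -
  interpret H: group H by fact
  interpret K: group K by fact
  have auto: "\<phi> k \<in> auto H" if "k \<in> carrier K" for k
    using hom that by (auto simp: hom_def AutoGroup_def)
  have cl: "\<phi> k h \<in> carrier H" if "k \<in> carrier K" "h \<in> carrier H" for k h
    using auto[OF that(1)] that(2) by (auto simp: auto_def hom_def)
  have mult: "\<phi> k (h \<otimes>\<^bsub>H\<^esub> h') = \<phi> k h \<otimes>\<^bsub>H\<^esub> \<phi> k h'"
    if "k \<in> carrier K" "h \<in> carrier H" "h' \<in> carrier H" for k h h'
    using auto[OF that(1)] that(2,3) by (auto simp: auto_def hom_def)
  have comp: "\<phi> (k \<otimes>\<^bsub>K\<^esub> k') h = \<phi> k (\<phi> k' h)"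
    if "k \<in> carrier K" "k' \<in> carrier K" "h \<in> carrier H" for k k' h
  proof -
    have "\<phi> (k \<otimes>\<^bsub>K\<^esub> k') = compose (carrier H) (\<phi> k) (\<phi> k')"
      using hom that auto by (auto simp: hom_def AutoGroup_def BijGroup_def auto_def)
    then show ?thesis using that by (simp add: compose_def)
  qed
  have id: "\<phi> \<one>\<^bsub>K\<^esub> h = h" if h: "h \<in> carrier H" for h
  proof -
    have "\<phi> \<one>\<^bsub>K\<^esub> (\<phi> \<one>\<^bsub>K\<^esub> h) = \<phi> \<one>\<^bsub>K\<^esub> h"
      using comp[of "\<one>\<^bsub>K\<^esub>" "\<one>\<^bsub>K\<^esub>" h] h by simp
    moreover have "inj_on (\<phi> \<one>\<^bsub>K\<^esub>) (carrier H)"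
      using auto[of "\<one>\<^bsub>K\<^esub>"] by (auto simp: auto_def Bij_def bij_betw_def)
    ultimately show ?thesis using h cl[of "\<one>\<^bsub>K\<^esub>" h] by (auto dest: inj_onD)
  qed
  show ?thesis
  proof (rule groupI)
    show "\<exists>y \<in> carrier (semidirect_product H K \<phi>).
        y \<otimes>\<^bsub>semidirect_product H K \<phi>\<^esub> x = \<one>\<^bsub>semidirect_product H K \<phi>\<^esub>"
      if x: "x \<in> carrier (semidirect_product H K \<phi>)" for x
    proof (cases x)
      case (Pair h k)
      then have hk: "h \<in> carrier H" "k \<in> carrier K"
        using x by (auto simp: semidirect_product_def)
      let ?k = "inv\<^bsub>K\<^esub> k"
      have "inv\<^bsub>H\<^esub> (\<phi> ?k h) \<otimes>\<^bsub>H\<^esub> \<phi> ?k h = \<one>\<^bsub>H\<^esub>"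
        using hk cl by (intro H.l_inv) auto
      then show ?thesis using hk cl Pair
        by (intro bexI[of _ "(inv\<^bsub>H\<^esub> (\<phi> ?k h), ?k)"]) (auto simp: semidirect_product_def)
    qed
  qed (auto simp: semidirect_product_def cl mult comp id H.m_assoc K.m_assoc)
qed

definition Z2_group :: "(int ^ 2) monoid"
  where "Z2_group = \<lparr>carrier = UNIV, monoid.mult = (+), one = 0\<rparr>"

lemma group_Z2_group: "group Z2_group"
  by (rule groupI) (auto simp: Z2_group_def intro: exI[of _ "- x" for x])

text \<open>
  The generator \<open>1\<close> of the infinite cyclic group acts through \<open>A\<close>, hence \<open>n\<close> acts through the
  \<open>n\<close>-th power of \<open>A\<close>, formed in the automorphism group.  The definition is meaningful for
  invertible \<open>A\<close> only.
\<close>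
definition mapping_torus_group :: "int ^ 2 ^ 2 \<Rightarrow> ((int ^ 2) \<times> int) monoid"
  where "mapping_torus_group A =
    semidirect_product Z2_group integer_group
      (\<lambda>n::int. (\<lambda>v. A *v v) [^]\<^bsub>AutoGroup Z2_group\<^esub> n)"

lemma mult_vec_in_AutoGroup:
  assumes "invertible A"
  shows "(\<lambda>v. A *v v) \<in> carrier (AutoGroup Z2_group)"
proof -
  obtain B where B: "A ** B = mat 1" "B ** A = mat 1"
    using assms by (auto simp: invertible_def)
  have "bij (\<lambda>v. A *v v)"
    by (rule bij_betw_byWitness[where f' = "\<lambda>v. B *v v"])
       (auto simp: matrix_vector_mul_assoc B)
  then show ?thesis
    by (auto simp: AutoGroup_def auto_def hom_def Bij_def Z2_group_def
        matrix_vector_right_distrib)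
qed

lemma group_mapping_torus_group:
  assumes "invertible A"
  shows "group (mapping_torus_group A)"
  unfolding mapping_torus_group_def
  by (intro group_semidirect_product group_Z2_group group_integer_group
      group.hom_integer_group_pow group.AutoGroup mult_vec_in_AutoGroup assms)

section \<open>Profinite completions\<close>

definition finite_index_normal :: "('a, 'm) monoid_scheme \<Rightarrow> 'a set set"
  where "finite_index_normal G = {N. N \<lhd> G \<and> finite (rcosets\<^bsub>G\<^esub> N)}"

text \<open>
  The inverse limit of the finite quotients of \<open>G\<close>.  For \<open>N \<subseteq> M\<close> the canonical map
  from \<open>G Mod N\<close> to \<open>G Mod M\<close> sends a coset of \<open>N\<close> to the coset of \<open>M\<close> containing it.
\<close>
definition profinite_completion ::
  "('a, 'm) monoid_scheme \<Rightarrow> ('a set \<Rightarrow> 'a set) monoid"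
  where "profinite_completion G =
    (product_group (finite_index_normal G) (\<lambda>N. G Mod N))
      \<lparr>carrier := {x \<in> (\<Pi>\<^sub>E N\<in>finite_index_normal G. rcosets\<^bsub>G\<^esub> N).
         \<forall>N\<in>finite_index_normal G. \<forall>M\<in>finite_index_normal G. N \<subseteq> M \<longrightarrow> x N \<subseteq> x M}\<rparr>"

definition profinite_topology :: "('a, 'm) monoid_scheme \<Rightarrow> ('a set \<Rightarrow> 'a set) topology"
  where "profinite_topology G =
    subtopology
      (product_topology (\<lambda>N. discrete_topology (rcosets\<^bsub>G\<^esub> N)) (finite_index_normal G))
      (carrier (profinite_completion G))"

text \<open>Isomorphism of profinite groups means isomorphism of topological groups.\<close>
definition isomorphic_completions ::
  "('a, 'm) monoid_scheme \<Rightarrow> ('b, 'n) monoid_scheme \<Rightarrow> bool"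
  where "isomorphic_completions G H \<longleftrightarrow>
    (\<exists>f \<in> iso (profinite_completion G) (profinite_completion H).
       homeomorphic_map (profinite_topology G) (profinite_topology H) f)"

section \<open>Polycyclic-by-finite groups and the profinite genus\<close>

definition polycyclic :: "('a, 'm) monoid_scheme \<Rightarrow> bool"
  where "polycyclic G \<longleftrightarrow> group G \<and>
    (\<exists>(n::nat) H. H 0 = {\<one>\<^bsub>G\<^esub>} \<and> H n = carrier G \<and>
       (\<forall>i<n. subgroup (H (Suc i)) G \<and>
              H i \<lhd> G\<lparr>carrier := H (Suc i)\<rparr> \<and>
              cyclic_group (G\<lparr>carrier := H (Suc i)\<rparr> Mod H i)))"

definition polycyclic_by_finite :: "('a, 'm) monoid_scheme \<Rightarrow> bool"
  where "polycyclic_by_finite G \<longleftrightarrow> group G \<and>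
    (\<exists>N \<in> finite_index_normal G. polycyclic (G\<lparr>carrier := N\<rparr>))"

text \<open>
  Polycyclic-by-finite groups are countable, so each is isomorphic to one whose carrier is
  a set of natural numbers (\<open>polycyclic_by_finite_nat_representative\<close> below).  The
  isomorphism classes of such groups with completion isomorphic to that of \<open>G\<close> are therefore
  represented without loss by the isomorphism classes of groups on sets of natural numbers.
\<close>
definition genus_groups :: "('a, 'm) monoid_scheme \<Rightarrow> nat monoid set"
  where "genus_groups G = {H. polycyclic_by_finite H \<and> isomorphic_completions H G}"

definition profinite_genus :: "('a, 'm) monoid_scheme \<Rightarrow> nat monoid set set"
  where "profinite_genus G =
    genus_groups G // {(H, K). H \<in> genus_groups G \<and> K \<in> genus_groups G \<and> H \<cong> K}"

lemma equiv_genus_groups: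
  "equiv (genus_groups G) {(H, K). H \<in> genus_groups G \<and> K \<in> genus_groups G \<and> H \<cong> K}"
proof (rule equivI)
  have grp: "group H" if "H \<in> genus_groups G" for H
    using that by (auto simp: genus_groups_def polycyclic_by_finite_def)
  show "refl_on (genus_groups G) {(H, K). H \<in> genus_groups G \<and> K \<in> genus_groups G \<and> H \<cong> K}"
    by (auto simp: refl_on_def iso_refl)
  show "sym {(H, K). H \<in> genus_groups G \<and> K \<in> genus_groups G \<and> H \<cong> K}"
    by (auto simp: sym_def grp group.iso_sym)
  show "trans {(H, K). H \<in> genus_groups G \<and> K \<in> genus_groups G \<and> H \<cong> K}"
    by (auto simp: trans_def intro: iso_trans)
qed auto

lemma (in group) countable_if_countable_quotient:
  assumes N: "N \<lhd> G" and "countable N" "countable (rcosets N)"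
  shows "countable (carrier G)"
proof -
  interpret normal N G by fact
  have "carrier G = \<Union> (rcosets N)"
    using rcosets_part_G[OF subgroup_axioms] by simp
  moreover have "countable C" if "C \<in> rcosets N" for C
    using that \<open>countable N\<close> by (auto simp: RCOSETS_def r_coset_def)
  ultimately show ?thesis using countable_UN[OF assms(3), of "\<lambda>C. C"] by simp
qed

lemma countable_cyclic_group:
  assumes "cyclic_group G" "group G"
  shows "countable (carrier G)"
  using assms by (auto simp: group.cyclic_group)

lemma countable_polycyclic:
  assumes "polycyclic G"
  shows "countable (carrier G)"
proof -
  interpret group G using assms by (simp add: polycyclic_def)
  obtain n :: nat and H where H: "H 0 = {\<one>\<^bsub>G\<^esub>}" "H n = carrier G"
    "\<And>i. i < n \<Longrightarrow> subgroup (H (Suc i)) G \<and> H i \<lhd> G\<lparr>carrier := H (Suc i)\<rparr> \<and>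
       cyclic_group (G\<lparr>carrier := H (Suc i)\<rparr> Mod H i)"
    using assms by (auto simp: polycyclic_def)
  have "countable (H i)" if "i \<le> n" for i
    using that
  proof (induction i)
    case 0
    then show ?case using H by simp
  next
    case (Suc i)
    let ?S = "G\<lparr>carrier := H (Suc i)\<rparr>"
    have S: "group ?S" using H(3)[of i] Suc.prems by (auto intro: subgroup_imp_group)
    have N: "H i \<lhd> ?S" using H(3)[of i] Suc.prems by auto
    have "countable (carrier (?S Mod H i))"
      using H(3)[of i] Suc.prems N by (intro countable_cyclic_group normal.factorgroup_is_group) auto
    then show ?case
      using group.countable_if_countable_quotient[OF S N] Suc by (simp add: FactGroup_def)
  qed
  then show ?thesis using H(2) by force
qed

lemma polycyclic_by_finite_nat_representative:
  assumes "polycyclic_by_finite G"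
  shows "\<exists>K :: nat monoid. group K \<and> G \<cong> K"
proof -
  interpret group G using assms by (simp add: polycyclic_by_finite_def)
  obtain N where N: "N \<lhd> G" "finite (rcosets\<^bsub>G\<^esub> N)" "polycyclic (G\<lparr>carrier := N\<rparr>)"
    using assms by (auto simp: polycyclic_by_finite_def finite_index_normal_def)
  have "countable (carrier G)"
    using countable_if_countable_quotient[OF N(1)] countable_polycyclic[OF N(3)] N(2)
    by (simp add: countable_finite)
  then obtain f :: "'a \<Rightarrow> nat" where f: "inj_on f (carrier G)" by (auto simp: countable_def)
  define g where "g = the_inv_into (carrier G) f"
  have g: "g (f x) = x" if "x \<in> carrier G" for x
    using f that by (simp add: g_def the_inv_into_f_f)
  define K where "K = \<lparr>carrier = f ` carrier G,
    monoid.mult = (\<lambda>a b. f (g a \<otimes>\<^bsub>G\<^esub> g b)), one = f \<one>\<^bsub>G\<^esub>\<rparr>"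
  have "f \<in> iso G K"
    using f g by (auto simp: iso_def hom_def K_def bij_betw_def)
  moreover have "group K"
  proof (rule groupI)
    show "\<exists>y\<in>carrier K. y \<otimes>\<^bsub>K\<^esub> x = \<one>\<^bsub>K\<^esub>" if "x \<in> carrier K" for x
    proof -
      obtain a where a: "a \<in> carrier G" "x = f a" using \<open>x \<in> carrier K\<close> by (auto simp: K_def)
      then show ?thesis by (intro bexI[of _ "f (inv\<^bsub>G\<^esub> a)"]) (auto simp: K_def g)
    qed
  qed (auto simp: K_def g m_assoc)
  ultimately show ?thesis by (auto simp: is_iso_def)
qed

section \<open>Orders and their Picard groups\<close>

definition int_adjoin :: "'a::field \<Rightarrow> 'a set"
  where "int_adjoin x = {poly (map_poly of_int p) x | p :: int poly. True}"

definition fraction_field :: "'a::field set \<Rightarrow> 'a set"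
  where "fraction_field R = {x / y | x y. x \<in> R \<and> y \<in> R \<and> y \<noteq> 0}"

text \<open>Nonzero \<open>R\<close>-submodules of the fraction field having a common denominator in \<open>R\<close>.\<close>
definition fractional_ideal :: "'a::field set \<Rightarrow> 'a set \<Rightarrow> bool"
  where "fractional_ideal R I \<longleftrightarrow>
    I \<subseteq> fraction_field R \<and> 0 \<in> I \<and> I \<noteq> {0} \<and>
    (\<forall>x\<in>I. \<forall>y\<in>I. x + y \<in> I) \<and> (\<forall>r\<in>R. \<forall>x\<in>I. r * x \<in> I) \<and>
    (\<exists>d\<in>R. d \<noteq> 0 \<and> (\<forall>x\<in>I. d * x \<in> R))"

definition ideal_mult :: "'a::field set \<Rightarrow> 'a set \<Rightarrow> 'a set"
  where "ideal_mult I J =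
    {(\<Sum>k<n. f k * g k) | (n::nat) f g. \<forall>k<n. f k \<in> I \<and> g k \<in> J}"

definition invertible_ideals :: "'a::field set \<Rightarrow> 'a set monoid"
  where "invertible_ideals R =
    \<lparr>carrier = {I. fractional_ideal R I \<and> (\<exists>J. fractional_ideal R J \<and> ideal_mult I J = R)},
     monoid.mult = ideal_mult, one = R\<rparr>"

definition principal_ideals :: "'a::field set \<Rightarrow> 'a set set"
  where "principal_ideals R = {(\<lambda>r. a * r) ` R | a. a \<in> fraction_field R \<and> a \<noteq> 0}"

definition picard_group :: "'a::field set \<Rightarrow> 'a set set monoid"
  where "picard_group R = invertible_ideals R Mod principal_ideals R"

definition class_number :: "'a::field set \<Rightarrow> nat"
  where "class_number R = Coset.order (picard_group R)"

section \<open>Eigenvalues of integer matrices\<close>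

definition eigenvalue_of :: "int ^ 'n ^ 'n \<Rightarrow> complex \<Rightarrow> bool"
  where "eigenvalue_of A lam \<longleftrightarrow>
    (\<exists>v :: complex ^ 'n. v \<noteq> 0 \<and> map_matrix of_int A *v v = lam *s v)"

end

theory Submission
  imports Defs "HOL-Algebra.FiniteProduct" "HOL-Number_Theory.Cong"
begin

text \<open>
  Write \<open>t\<close> for the trace of \<open>A\<close> and \<open>D = t\<^sup>2 + 4\<close>.

  A polycyclic-by-finite group \<open>H\<close> is residually finite, so it can be studied through the finite
  quotients of its completion.  If the completion is that of \<open>G\<^sub>A\<close>, let \<open>M\<close> consist of the elements
  of \<open>H\<close> that lie in the closure of \<open>\<int>\<^sup>2\<close>.  Since every \<open>t v\<close> with \<open>v \<in> \<int>\<^sup>2\<close> is a commutator, \<open>M\<close> is dense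
  in that closure, it is free abelian of rank two, and \<open>H/M\<close> is infinite cyclic; hence \<open>H\<close> is some
  \<open>G\<^sub>B\<close>.  Modulo every \<open>n\<close>, the matrix \<open>B\<close> is conjugate to an odd power of \<open>A\<close> and vice versa.  Odd
  powers of a matrix of determinant \<open>-1\<close> have determinant \<open>-1\<close> and trace divisible by the original
  trace, so \<open>det B = -1\<close> and \<open>tr B = \<plusminus>t\<close>; passing to the inverse changes the sign.

  Conversely, let \<open>B\<close> have determinant \<open>-1\<close> and trace \<open>t\<close>.  The matrices \<open>(v, B v)\<close> intertwine \<open>B\<close> with
  the companion matrix, and their determinant is a quadratic form in \<open>v\<close> of discriminant \<open>D\<close>.  As \<open>D\<close>
  is square-free, this form is primitive, so one can choose \<open>v\<close> congruence by congruence with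
  determinants prime to every \<open>k!\<close>, and in the limit the completions become isomorphic.

  As \<open>G\<^sub>B\<close> determines \<open>B\<close> up to conjugation once the trace is fixed, the genus is the set of conjugacy
  classes of such matrices.  By Latimer and MacDuffee, \<open>B\<close> with first column \<open>(a, c)\<close> corresponds to the
  ideal \<open>\<int>c + \<int>(\<lambda> - a)\<close>, and all ideals of \<open>\<int>[\<lambda>]\<close> are invertible, again because \<open>D\<close> is square-free.
\<close>

section \<open>Polycyclic-by-finite groups\<close>

text \<open>An isomorphism of completions relates no individual elements of H and G. It is therefore
  replaced by a family of relations between the two groups, one for each finite quotient of G, and
  statements about closures become statements about all finite quotients. The delicate point is the
  density of M: an approximation in H of a vector may carry a power of a generator of H/M, and this
  error is controlled only because the t-th power of the approximation is close to a commutator.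
  That H/M has rank one is visible modulo 2, and the same parity makes the exponents relating the
  two monodromies odd. Here t is nonzero, because 4 is not square-free. For the converse, the
  matrices (v, A v) are in general not invertible over the integers, so no single one gives an
  isomorphism. With determinants prime to k!, the adjugate times an inverse of the determinant
  modulo k! is an integral intertwiner in the opposite direction. Both sequences consist of
  homomorphisms of the discrete groups, and only their limits are isomorphisms. The count is
  meaningful only for finite sets, so finiteness of the set of ideal classes is proved by reduction
  of forms.\<close>

context group begin

lemma inv_cancel_left [simp]:
  assumes "x \<in> carrier G" "y \<in> carrier G"
  shows "inv x \<otimes> (x \<otimes> y) = y" "x \<otimes> (inv x \<otimes> y) = y"
  using assms by (simp_all flip: m_assoc)

lemma conj_int_pow:
  assumes "g \<in> carrier G" "x \<in> carrier G"
  shows "g \<otimes> x [^] (i::int) \<otimes> inv g = (g \<otimes> x \<otimes> inv g) [^] i"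
proof -
  have n: "(g \<otimes> x \<otimes> inv g) [^] (n::nat) = g \<otimes> x [^] n \<otimes> inv g" for n
    using assms by (induction n) (auto simp: m_assoc)
  show ?thesis
  proof (cases i rule: int_cases2)
    case (nonneg m)
    then show ?thesis using n[of m] by (simp add: int_pow_int)
  next
    case (nonpos m)
    have "g \<otimes> inv (x [^] m) \<otimes> inv g = inv (g \<otimes> x [^] m \<otimes> inv g)"
      using assms by (simp add: inv_mult_group m_assoc)
    then show ?thesis using nonpos assms n[of m] by (simp add: int_pow_neg int_pow_int)
  qed
qed

text \<open>
  \<open>S\<close> has finite index in \<open>N\<close>, witnessed by a colouring of \<open>N\<close> with finitely many colours that
  separates the cosets of \<open>S\<close>; such colourings combine and refine more easily than sets of cosets.
\<close>
definition fin_index :: "'a set \<Rightarrow> 'a set \<Rightarrow> bool"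
  where "fin_index S N \<longleftrightarrow>
    (\<exists>c :: 'a \<Rightarrow> nat. finite (c ` N) \<and> (\<forall>g\<in>N. \<forall>h\<in>N. c g = c h \<longrightarrow> g \<otimes> inv h \<in> S))"

lemma fin_indexI:
  assumes "finite (c ` N)" "\<And>g h. g \<in> N \<Longrightarrow> h \<in> N \<Longrightarrow> c g = c h \<Longrightarrow> g \<otimes> inv h \<in> S"
  shows "fin_index S N"
proof -
  obtain e :: "_ \<Rightarrow> nat" where e: "inj_on e (c ` N)"
    using finite_imp_inj_to_nat_seg[OF assms(1)] by blast
  show ?thesis unfolding fin_index_def
  proof (intro exI[of _ "\<lambda>g. e (c g)"] conjI ballI impI)
    show "finite ((\<lambda>g. e (c g)) ` N)" using finite_imageI[OF assms(1), of e] by (simp add: image_comp)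
    fix g h assume gh: "g \<in> N" "h \<in> N" "e (c g) = e (c h)"
    then have "c g = c h" using e by (simp add: inj_on_def)
    then show "g \<otimes> inv h \<in> S" using assms(2) gh by blast
  qed
qed

lemma fin_index_mono: "fin_index S N \<Longrightarrow> S \<subseteq> T \<Longrightarrow> fin_index T N"
  unfolding fin_index_def by blast

lemma fin_index_Int:
  assumes "fin_index S N" "fin_index T N"
  shows "fin_index (S \<inter> T) N"
proof -
  obtain c :: "'a \<Rightarrow> nat" where c: "finite (c ` N)" "\<And>g h. g \<in> N \<Longrightarrow> h \<in> N \<Longrightarrow> c g = c h \<Longrightarrow> g \<otimes> inv h \<in> S"
    using assms(1) unfolding fin_index_def by blast
  obtain d :: "'a \<Rightarrow> nat" where d: "finite (d ` N)" "\<And>g h. g \<in> N \<Longrightarrow> h \<in> N \<Longrightarrow> d g = d h \<Longrightarrow> g \<otimes> inv h \<in> T"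
    using assms(2) unfolding fin_index_def by blast
  show ?thesis
  proof (rule fin_indexI[of "\<lambda>x. (c x, d x)"])
    show "finite ((\<lambda>x. (c x, d x)) ` N)"
      by (rule finite_subset[of _ "c ` N \<times> d ` N"]) (use c d in auto)
  qed (use c d in auto)
qed

text \<open>A fixed choice \<open>r g\<close> of a point of \<open>M\<close> with the same
  \<open>d\<close>-colour as \<open>g\<close> moves \<open>g\<close> into \<open>N\<close> as
  \<open>g \<otimes> inv (r g)\<close>. The pair of both colours then separates the cosets of
  \<open>S\<close>, because \<open>r\<close> is constant on \<open>d\<close>-colours.\<close>

lemma fin_index_trans:
  assumes S: "fin_index S N" and N: "fin_index N M" "N \<subseteq> carrier G" "M \<subseteq> carrier G"
  shows "fin_index S M"
proof -
  obtain c :: "'a \<Rightarrow> nat" where c: "finite (c ` N)" "\<And>g h. g \<in> N \<Longrightarrow> h \<in> N \<Longrightarrow> c g = c h \<Longrightarrow> g \<otimes> inv h \<in> S"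
    using S unfolding fin_index_def by blast
  obtain d :: "'a \<Rightarrow> nat" where d: "finite (d ` M)" "\<And>g h. g \<in> M \<Longrightarrow> h \<in> M \<Longrightarrow> d g = d h \<Longrightarrow> g \<otimes> inv h \<in> N"
    using N(1) unfolding fin_index_def by blast
  define r where "r g = (SOME x. x \<in> M \<and> d x = d g)" for g
  have r: "r g \<in> M" "d (r g) = d g" if "g \<in> M" for g
    using someI[of "\<lambda>x. x \<in> M \<and> d x = d g" g] that unfolding r_def by auto
  have rN: "g \<otimes> inv (r g) \<in> N" if "g \<in> M" for g using d(2)[OF that r(1)[OF that]] r(2)[OF that] by simp
  show ?thesis
  proof (rule fin_indexI[of "\<lambda>g. (d g, c (g \<otimes> inv (r g)))"])
    show "finite ((\<lambda>g. (d g, c (g \<otimes> inv (r g)))) ` M)"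
      by (rule finite_subset[of _ "d ` M \<times> c ` N"]) (use c d rN in auto)
  next
    fix g h assume gh: "g \<in> M" "h \<in> M" "(d g, c (g \<otimes> inv (r g))) = (d h, c (h \<otimes> inv (r h)))"
    have "r g = r h" using gh unfolding r_def by simp
    moreover have "(g \<otimes> inv (r g)) \<otimes> inv (h \<otimes> inv (r h)) \<in> S" using gh rN c by auto
    moreover have "g \<in> carrier G" "h \<in> carrier G" "r h \<in> carrier G" using gh N r by auto
    ultimately show "g \<otimes> inv h \<in> S" by (simp add: m_assoc inv_mult_group)
  qed
qed

text \<open>Conjugations that preserve \<open>N\<close> also preserve this subgroup, so normality
  comes for free. In the groups considered below it has finite index for m > 0, and every subgroup
  of finite index contains one of this kind.\<close>

definition power_sub :: "nat \<Rightarrow> 'a set \<Rightarrow> 'a set"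
  where "power_sub m N = generate G ((\<lambda>x. x [^] m) ` N)"

lemma subgroup_power_sub: "N \<subseteq> carrier G \<Longrightarrow> subgroup (power_sub m N) G"
  unfolding power_sub_def by (rule generate_is_subgroup) auto

lemma power_sub_subset: "(\<And>x. x \<in> N \<Longrightarrow> x [^] m \<in> S) \<Longrightarrow> subgroup S G \<Longrightarrow> power_sub m N \<subseteq> S"
  unfolding power_sub_def by (rule generate_subgroup_incl) auto

lemma subgroup_nat_pow_closed: "subgroup S G \<Longrightarrow> x \<in> S \<Longrightarrow> x [^] (n::nat) \<in> S"
  using subgroup_int_pow_closed[of S x "int n"] by (simp add: int_pow_int)

lemma power_sub_self: "subgroup N G \<Longrightarrow> power_sub m N \<subseteq> N"
  by (rule power_sub_subset) (auto intro: subgroup_nat_pow_closed)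

lemma power_sub_pow: "x \<in> N \<Longrightarrow> x [^] m \<in> power_sub m N"
  unfolding power_sub_def by (auto intro: generate.incl)

lemma power_sub_mono: "N \<subseteq> M \<Longrightarrow> power_sub m N \<subseteq> power_sub m M"
  unfolding power_sub_def by (intro mono_generate) auto

lemma conj_pow:
  assumes "g \<in> carrier G" "x \<in> carrier G"
  shows "g \<otimes> x [^] (n::nat) \<otimes> inv g = (g \<otimes> x \<otimes> inv g) [^] n"
  using conj_int_pow[OF assms, of "int n"] by (simp add: int_pow_int)

lemma power_sub_conj:
  assumes N: "N \<subseteq> carrier G" and g: "g \<in> carrier G" and conj: "\<And>n. n \<in> N \<Longrightarrow> g \<otimes> n \<otimes> inv g \<in> N"
    and x: "x \<in> power_sub m N"
  shows "g \<otimes> x \<otimes> inv g \<in> power_sub m N"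
  using x unfolding power_sub_def
proof (induction rule: generate.induct)
  case one
  show ?case using g by (simp add: generate.one)
next
  case (incl h)
  then obtain n where "n \<in> N" "h = n [^] m" by auto
  then have "g \<otimes> h \<otimes> inv g = (g \<otimes> n \<otimes> inv g) [^] m" using N g conj_pow by auto
  then show ?case using conj[OF \<open>n \<in> N\<close>] by (auto intro!: generate.incl)
next
  case (inv h)
  then obtain n where "n \<in> N" "h = n [^] m" by auto
  then have "g \<otimes> inv h \<otimes> inv g = inv ((g \<otimes> n \<otimes> inv g) [^] m)" 
    using N g by (subst conj_pow [symmetric]) (auto simp: inv_mult_group m_assoc)
  then show ?case using conj[OF \<open>n \<in> N\<close>] by (auto intro!: generate.inv)
next
  case (eng h1 h2)
  have "h1 \<in> carrier G" "h2 \<in> carrier G"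
    using eng.hyps generate_in_carrier[of "(\<lambda>x. x [^] m) ` N"] N by auto
  then have "g \<otimes> (h1 \<otimes> h2) \<otimes> inv g = (g \<otimes> h1 \<otimes> inv g) \<otimes> (g \<otimes> h2 \<otimes> inv g)"
    using g by (simp add: m_assoc)
  then show ?case using eng generate.eng by metis
qed

text \<open>By the pigeonhole principle two of the powers of x with exponents 0, ..., J have the
  same colour, where J is the number of colours. So some positive power with exponent at most J lies
  in \<open>S\<close>, and the exponent J! serves all x at once.\<close>

lemma fin_index_power_sub_subset:
  assumes "subgroup S G" "fin_index S N" "subgroup N G"
  obtains j where "j > 0" "power_sub j N \<subseteq> S"
proof -
  obtain c :: "'a \<Rightarrow> nat" where c: "finite (c ` N)" "\<And>g h. g \<in> N \<Longrightarrow> h \<in> N \<Longrightarrow> c g = c h \<Longrightarrow> g \<otimes> inv h \<in> S"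
    using assms unfolding fin_index_def by blast
  define J where "J = card (c ` N)"
  have "x [^] (fact J :: nat) \<in> S" if x: "x \<in> N" for x
  proof -
    have xc: "x \<in> carrier G" using x assms(3) subgroup.subset by blast
    have xp: "x [^] (i::nat) \<in> N" for i using subgroup_nat_pow_closed assms x by auto
    have "\<not> inj_on (\<lambda>i. c (x [^] i)) {0..J}"
    proof
      assume "inj_on (\<lambda>i. c (x [^] i)) {0..J}"
      then have "card {0..J} \<le> card (c ` N)"
        using card_inj_on_le[of "\<lambda>i. c (x [^] i)" "{0..J}" "c ` N"] c(1) xp by auto
      then show False by (simp add: J_def)
    qed
    then obtain i k where ik: "i < k" "k \<le> J" "c (x [^] i) = c (x [^] k)"
      unfolding inj_on_def by (metis atLeastAtMost_iff linorder_neqE_nat)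
    have "x [^] k \<otimes> inv (x [^] i) \<in> S" using ik xp c by auto
    also have "x [^] k \<otimes> inv (x [^] i) = x [^] (k - i)"
    proof -
      have "x [^] k = x [^] (k - i) \<otimes> x [^] i" using ik xc by (simp add: nat_pow_mult)
      then show ?thesis using xc by (simp add: m_assoc)
    qed
    finally have S: "x [^] (k - i) \<in> S" .
    have "(k - i) dvd fact J" using ik by (intro dvd_fact) auto
    then obtain l where "fact J = (k - i) * l" by (auto elim: dvdE)
    then show ?thesis using subgroup_nat_pow_closed[OF assms(1) S, of l] xc by (simp add: nat_pow_pow)
  qed
  then have "power_sub (fact J) N \<subseteq> S" using assms by (intro power_sub_subset)
  then show ?thesis using that by (meson fact_gt_zero)
qed

section \<open>Extensions by an infinite cyclic group\<close>

definition normalizes :: "'a set \<Rightarrow> 'a set \<Rightarrow> bool"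
  where "normalizes M N \<longleftrightarrow> (\<forall>g\<in>M. \<forall>n\<in>N. g \<otimes> n \<otimes> inv g \<in> N)"

lemma normalizes_power_sub:
  "normalizes M N \<Longrightarrow> M \<subseteq> carrier G \<Longrightarrow> N \<subseteq> carrier G \<Longrightarrow> normalizes M (power_sub m N)"
  unfolding normalizes_def by (auto intro!: power_sub_conj)

text \<open>This is the internal semidirect product of \<open>N\<close> and the infinite cyclic
  group generated by \<open>x\<close>; the last clause makes the decomposition
  \<open>n \<otimes> x [^] i\<close> unique.\<close>

definition inf_cyclic_ext :: "'a set \<Rightarrow> 'a \<Rightarrow> 'a set \<Rightarrow> bool"
  where "inf_cyclic_ext N x M \<longleftrightarrow> subgroup N G \<and> subgroup M G \<and> N \<subseteq> M \<and> normalizes M N \<and> x \<in> M \<and>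
    (\<forall>g\<in>M. \<exists>n\<in>N. \<exists>i::int. g = n \<otimes> x [^] i) \<and> (\<forall>i::int. x [^] i \<in> N \<longrightarrow> i = 0)"

lemma inf_cyclic_extD:
  assumes "inf_cyclic_ext N x M"
  shows "subgroup N G" "subgroup M G" "N \<subseteq> M" "normalizes M N" "x \<in> M" "N \<subseteq> carrier G" "M \<subseteq> carrier G"
    "x \<in> carrier G" "\<And>i::int. x [^] i \<in> M"
proof -
  show s: "subgroup N G" "subgroup M G" "N \<subseteq> M" "normalizes M N" "x \<in> M"
    using assms by (simp_all add: inf_cyclic_ext_def)
  show "N \<subseteq> carrier G" "M \<subseteq> carrier G" using subgroup.subset[OF s(1)] subgroup.subset[OF s(2)] .
  then show "x \<in> carrier G" using s(5) by blast
  show "x [^] i \<in> M" for i :: int by (rule subgroup_int_pow_closed[OF s(2,5)])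
qed

lemma inf_cyclic_ext_decomp:
  assumes "inf_cyclic_ext N x M" "g \<in> M"
  obtains n i where "n \<in> N" "g = n \<otimes> x [^] (i::int)"
proof -
  have "\<exists>n\<in>N. \<exists>i::int. g = n \<otimes> x [^] i" using assms by (simp add: inf_cyclic_ext_def)
  then show ?thesis using that by blast
qed

text \<open>When \<open>K\<close> is normalized by \<open>x\<close>, this is the subgroup generated
  by \<open>K\<close> and \<open>x [^] d\<close>. Such subgroups control the
  \<open>N\<close>-component and the exponent of \<open>x\<close> independently.\<close>

definition ext_sub :: "'a set \<Rightarrow> 'a \<Rightarrow> int \<Rightarrow> 'a set"
  where "ext_sub K x d = {k \<otimes> x [^] (d * i) | k i. k \<in> K}"

lemma subgroup_ext_sub:
  assumes K: "subgroup K G" and x: "x \<in> carrier G" and norm: "\<And>k i. k \<in> K \<Longrightarrow> x [^] (i::int) \<otimes> k \<otimes> inv (x [^] i) \<in> K"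
  shows "subgroup (ext_sub K x d) G"
proof (rule subgroupI)
  note Kc = subgroup.mem_carrier[OF K]
  show "ext_sub K x d \<subseteq> carrier G" using Kc x by (auto simp: ext_sub_def)
  show "ext_sub K x d \<noteq> {}" using subgroup.one_closed[OF K] by (auto simp: ext_sub_def)
  fix a assume "a \<in> ext_sub K x d"
  then obtain k i where a: "k \<in> K" "a = k \<otimes> x [^] (d * i)" by (auto simp: ext_sub_def)
  have "inv a = x [^] (- (d * i)) \<otimes> inv k \<otimes> inv (x [^] (- (d * i))) \<otimes> x [^] (d * (- i))"
    using a x Kc by (simp add: inv_mult_group m_assoc int_pow_neg)
  then show "inv a \<in> ext_sub K x d"
    unfolding ext_sub_def using a norm subgroup.m_inv_closed[OF K] by blast
  fix b assume "b \<in> ext_sub K x d"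
  then obtain l j where b: "l \<in> K" "b = l \<otimes> x [^] (d * j)" by (auto simp: ext_sub_def)
  have "a \<otimes> b = (k \<otimes> (x [^] (d * i) \<otimes> l \<otimes> inv (x [^] (d * i)))) \<otimes> x [^] (d * (i + j))"
    using a b x Kc by (simp add: m_assoc int_pow_mult distrib_left)
  then show "a \<otimes> b \<in> ext_sub K x d"
    unfolding ext_sub_def using a b norm subgroup.m_closed[OF K] by blast
qed

lemma inf_cyclic_ext_unique:
  assumes "inf_cyclic_ext N x M" "n \<in> N" "m \<in> N" "n \<otimes> x [^] (i::int) = m \<otimes> x [^] j"
  shows "n = m \<and> i = j"
proof -
  have c: "n \<in> carrier G" "m \<in> carrier G" "x \<in> carrier G"
    using inf_cyclic_extD[OF assms(1)] assms(2,3) by auto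
  have "inv m \<otimes> n = inv m \<otimes> (n \<otimes> x [^] i) \<otimes> x [^] (- i)" using c by (simp add: m_assoc int_pow_neg)
  also have "\<dots> = x [^] (j - i)" using assms(4) c by (simp add: m_assoc int_pow_neg int_pow_diff)
  finally have "x [^] (j - i) \<in> N" 
    using subgroup.m_closed[OF inf_cyclic_extD(1)[OF assms(1)] subgroup.m_inv_closed[OF inf_cyclic_extD(1)[OF assms(1)] assms(3)] assms(2)] by simp
  then have "j = i" using assms by (auto simp: inf_cyclic_ext_def)
  then show ?thesis using assms(4) c by simp
qed

lemma mem_ext_sub_iff:
  assumes "inf_cyclic_ext N x M" "n \<in> N" "K \<subseteq> N"
  shows "n \<otimes> x [^] (i::int) \<in> ext_sub K x d \<longleftrightarrow> n \<in> K \<and> d dvd i"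
proof
  assume "n \<otimes> x [^] i \<in> ext_sub K x d"
  then obtain k j where k: "k \<in> K" "n \<otimes> x [^] i = k \<otimes> x [^] (d * j)" by (auto simp: ext_sub_def)
  then show "n \<in> K \<and> d dvd i" using inf_cyclic_ext_unique[OF assms(1,2) _ k(2)] assms(3) by auto
qed (auto simp: ext_sub_def dvd_def)

text \<open>The finite-index test involves \<open>g \<otimes> inv h\<close>; with the power of
  \<open>x\<close> on the left, the two \<open>N\<close>-components meet in the middle of this
  product.\<close>

lemma inf_cyclic_ext_flip:
  assumes "inf_cyclic_ext N x M" "g \<in> M"
  shows "\<exists>n\<in>N. \<exists>i::int. g = x [^] i \<otimes> n"
proof -
  have s: "subgroup N G" "subgroup M G" "x \<in> M" using assms by (auto simp: inf_cyclic_ext_def)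
  have "inv g \<in> M" using subgroup.m_inv_closed[OF s(2) assms(2)] .
  then obtain n i where n: "n \<in> N" "inv g = n \<otimes> x [^] (i::int)" using inf_cyclic_ext_decomp[OF assms(1)] by blast
  have c: "n \<in> carrier G" "x \<in> carrier G" "g \<in> carrier G" using subgroup.mem_carrier[OF s(1)] subgroup.mem_carrier[OF s(2)] n s(3) assms(2) by simp_all
  then have "inv (inv g) = x [^] (- i) \<otimes> inv n" unfolding n(2) by (simp add: inv_mult_group int_pow_neg)
  then have "g = x [^] (- i) \<otimes> inv n" using c by simp
  then show ?thesis using subgroup.m_inv_closed[OF s(1) n(1)] by blast
qed

lemma fin_index_ext_sub:
  assumes ext: "inf_cyclic_ext N x M" and K: "subgroup K G" "K \<subseteq> N" "fin_index K N" "normalizes M K" and d: "d > 0"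
  shows "subgroup (ext_sub K x d) G" "fin_index (ext_sub K x d) M"
proof -
  have s: "subgroup N G" "subgroup M G" "x \<in> M" "N \<subseteq> M" using ext by (auto simp: inf_cyclic_ext_def)
  have xp: "x [^] (i::int) \<in> M" for i by (rule subgroup_int_pow_closed[OF s(2,3)])
  have xc: "x \<in> carrier G" using inf_cyclic_extD(8)[OF ext] .
  have norm: "x [^] i \<otimes> k \<otimes> inv (x [^] i) \<in> K" if "k \<in> K" for k and i :: int
    using K that xp by (auto simp: normalizes_def)
  show "subgroup (ext_sub K x d) G" using K xc norm by (intro subgroup_ext_sub) auto
  obtain c :: "'a \<Rightarrow> nat" where c: "finite (c ` N)" "\<And>g h. g \<in> N \<Longrightarrow> h \<in> N \<Longrightarrow> c g = c h \<Longrightarrow> g \<otimes> inv h \<in> K"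
    using K unfolding fin_index_def by blast
  have "\<forall>g\<in>M. \<exists>p. fst p \<in> N \<and> g = x [^] (snd p :: int) \<otimes> fst p"
    using inf_cyclic_ext_flip[OF ext] by (metis fst_conv snd_conv)
  then obtain p where p: "\<And>g. g \<in> M \<Longrightarrow> fst (p g) \<in> N \<and> g = x [^] (snd (p g) :: int) \<otimes> fst (p g)"
    by metis
  show "fin_index (ext_sub K x d) M"
  proof (rule fin_indexI[of "\<lambda>g. (c (fst (p g)), snd (p g) mod d)"])
    show "finite ((\<lambda>g. (c (fst (p g)), snd (p g) mod d)) ` M)"
      by (rule finite_subset[of _ "c ` N \<times> {0..<d}"]) (use c p d in auto)
  next
    fix g h assume gh: "g \<in> M" "h \<in> M" "(c (fst (p g)), snd (p g) mod d) = (c (fst (p h)), snd (p h) mod d)"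
    obtain n i where n: "n \<in> N" "g = x [^] i \<otimes> n" "p g = (n, i)" using p[OF gh(1)] by (cases "p g") auto
    obtain m j where m: "m \<in> N" "h = x [^] j \<otimes> m" "p h = (m, j)" using p[OF gh(2)] by (cases "p h") auto
    have nm: "n \<otimes> inv m \<in> K" using c n m gh by auto
    have "d dvd i - j" using gh n m by (simp add: mod_eq_dvd_iff)
    then obtain q where q: "i - j = d * q" by (auto elim: dvdE)
    have cc: "n \<in> carrier G" "m \<in> carrier G" using n m inf_cyclic_extD(6)[OF ext] by auto
    have "g \<otimes> inv h = (x [^] i \<otimes> (n \<otimes> inv m) \<otimes> inv (x [^] i)) \<otimes> x [^] (i - j)"
      using n m cc xc by (simp add: m_assoc inv_mult_group int_pow_diff)
    then show "g \<otimes> inv h \<in> ext_sub K x d" unfolding q ext_sub_def using norm[OF nm] by blast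
  qed
qed

lemma fin_index_self: "subgroup N G \<Longrightarrow> fin_index N N"
  by (rule fin_indexI[of "\<lambda>_. ()"]) (simp_all add: subgroup.m_closed subgroup.m_inv_closed)

lemma ext_sub_power_sub:
  assumes ext: "inf_cyclic_ext N x M" and "fin_index (power_sub m N) N" "d > 0"
  shows "subgroup (ext_sub (power_sub m N) x d) G" "fin_index (ext_sub (power_sub m N) x d) M"
  using fin_index_ext_sub[OF ext _ _ assms(2) _ assms(3)] inf_cyclic_extD[OF ext]
  by (simp_all add: subgroup_power_sub power_sub_self normalizes_power_sub)

text \<open>Finite and infinite cyclic layers may alternate in any order. This suits induction, and
  a polycyclic series with some finite factors fits without rearrangement.\<close>

inductive poly_cyc_fin :: "'a set \<Rightarrow> bool" where
  base: "poly_cyc_fin {\<one>}"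
| fin: "poly_cyc_fin N \<Longrightarrow> subgroup M G \<Longrightarrow> N \<subseteq> M \<Longrightarrow> normalizes M N \<Longrightarrow> fin_index N M \<Longrightarrow> poly_cyc_fin M"
| cyc: "poly_cyc_fin N \<Longrightarrow> inf_cyclic_ext N x M \<Longrightarrow> poly_cyc_fin M"

lemma poly_cyc_fin_subgroup: "poly_cyc_fin N \<Longrightarrow> subgroup N G"
  by (induction rule: poly_cyc_fin.induct) (auto simp: triv_subgroup inf_cyclic_ext_def)

text \<open>In the cyclic step, the m-th powers of \<open>N\<close> together with
  \<open>x [^] m\<close> generate a subgroup that has finite index in \<open>M\<close> and consists
  of products of m-th powers.\<close>

lemma poly_cyc_fin_fin_index_power_sub:
  assumes "poly_cyc_fin N" "m > 0"
  shows "fin_index (power_sub m N) N"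
  using assms(1)
proof (induction rule: poly_cyc_fin.induct)
  case base
  show ?case unfolding fin_index_def by (intro exI[of _ "\<lambda>_. 0"]) (auto simp: power_sub_def generate.one)
next
  case (fin N M)
  have "fin_index (power_sub m M) N" by (rule fin_index_mono[OF fin.IH power_sub_mono[OF fin.hyps(3)]])
  then show ?case
    by (rule fin_index_trans[OF _ fin.hyps(5) subgroup.subset[OF poly_cyc_fin_subgroup[OF fin.hyps(1)]] subgroup.subset[OF fin.hyps(2)]])
next
  case (cyc N x M)
  have s: "subgroup N G" "subgroup M G" "x \<in> M" "N \<subseteq> M" "normalizes M N"
    using inf_cyclic_extD[OF cyc.hyps(2)] by simp_all
  have sub: "N \<subseteq> carrier G" "M \<subseteq> carrier G" using inf_cyclic_extD(6,7)[OF cyc.hyps(2)] by auto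
  have "ext_sub (power_sub m N) x (int m) \<subseteq> power_sub m M"
  proof
    fix g assume "g \<in> ext_sub (power_sub m N) x (int m)"
    then obtain k i where g: "k \<in> power_sub m N" "g = k \<otimes> x [^] (int m * i)" by (auto simp: ext_sub_def)
    have "x [^] (int m * i) = (x [^] i) [^] m" 
      using inf_cyclic_extD(8)[OF cyc.hyps(2)] by (simp add: int_pow_pow mult.commute flip: int_pow_int)
    also have "\<dots> \<in> power_sub m M" by (rule power_sub_pow[OF inf_cyclic_extD(9)[OF cyc.hyps(2)]])
    finally show "g \<in> power_sub m M" using g(1) power_sub_mono[OF s(4)] unfolding g(2) by (intro subgroup.m_closed[OF subgroup_power_sub[OF sub(2)]]) auto
  qed
  moreover have "fin_index (ext_sub (power_sub m N) x (int m)) M"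
    using ext_sub_power_sub(2)[OF cyc.hyps(2) cyc.IH] assms(2) by simp
  ultimately show ?case by (rule fin_index_mono[rotated])
qed

text \<open>A subgroup of finite index contains a power subgroup, so it is enough to avoid
  \<open>g\<close> by some subgroup of finite index. An element outside \<open>N\<close> is avoided
  by \<open>N\<close> itself in a finite layer, and by a condition on the exponent of
  \<open>x\<close> in a cyclic one; for elements of \<open>N\<close> the induction hypothesis is
  extended to \<open>M\<close>.\<close>

lemma poly_cyc_fin_residually_finite:
  assumes "poly_cyc_fin N" "g \<in> N" "g \<noteq> \<one>"
  shows "\<exists>m>0. g \<notin> power_sub m N"
  using assms
proof (induction arbitrary: g rule: poly_cyc_fin.induct)
  case base
  then show ?case by auto
next
  case (fin N M)
  have s: "subgroup N G" using poly_cyc_fin_subgroup[OF fin.hyps(1)] .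
  show ?case
  proof (cases "g \<in> N")
    case False
    then show ?thesis using fin_index_power_sub_subset[OF s fin.hyps(5,2)] by blast
  next
    case True
    then obtain m where m: "m > 0" "g \<notin> power_sub m N" using fin.IH fin.prems by blast
    have "fin_index (power_sub m N) M" 
      by (rule fin_index_trans[OF poly_cyc_fin_fin_index_power_sub[OF fin.hyps(1) m(1)] fin.hyps(5) subgroup.subset[OF s] subgroup.subset[OF fin.hyps(2)]])
    then obtain j where "j > 0" "power_sub j M \<subseteq> power_sub m N"
      by (rule fin_index_power_sub_subset[OF subgroup_power_sub[OF subgroup.subset[OF s]] _ fin.hyps(2)])
    then show ?thesis using m(2) by blast
  qed
next
  case (cyc N x M)
  have s: "subgroup N G" "subgroup M G" "x \<in> M" "N \<subseteq> M" "normalizes M N"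
    using inf_cyclic_extD[OF cyc.hyps(2)] by simp_all
  have sub: "N \<subseteq> carrier G" "M \<subseteq> carrier G" using inf_cyclic_extD(6,7)[OF cyc.hyps(2)] by auto
  have key: "\<exists>m>0. g \<notin> power_sub m M"
    if "subgroup (ext_sub K x d) G" "fin_index (ext_sub K x d) M" "g \<notin> ext_sub K x d" for K d
    using fin_index_power_sub_subset[OF that(1,2) s(2)] that(3) by (metis subsetD)
  obtain n i where n: "n \<in> N" "g = n \<otimes> x [^] (i::int)" using inf_cyclic_ext_decomp[OF cyc.hyps(2) cyc.prems(1)] .
  show ?case
  proof (cases "i = 0")
    case False
    \<comment> \<open>The modulus only has to exceed the absolute value of the nonzero
      exponent.\<close>
    have "\<not> \<bar>i\<bar> + 1 dvd i" using False zdvd_imp_le[of "\<bar>i\<bar> + 1" "\<bar>i\<bar>"] by auto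
    then have "g \<notin> ext_sub N x (\<bar>i\<bar> + 1)" using n mem_ext_sub_iff[OF cyc.hyps(2) n(1) order_refl] by simp
    moreover have "subgroup (ext_sub N x (\<bar>i\<bar> + 1)) G" "fin_index (ext_sub N x (\<bar>i\<bar> + 1)) M"
      using fin_index_ext_sub[OF cyc.hyps(2) s(1) order_refl fin_index_self[OF s(1)] s(5), of "\<bar>i\<bar> + 1"] by simp_all
    ultimately show ?thesis by (rule key[rotated 2])
  next
    case True
    then have "g = n" using n sub by auto
    then obtain m where m: "m > 0" "n \<notin> power_sub m N" using cyc.IH[OF n(1)] cyc.prems by blast
    then have "g \<notin> ext_sub (power_sub m N) x 1"
      using n mem_ext_sub_iff[OF cyc.hyps(2) n(1) power_sub_self[OF s(1)]] by simp
    then show ?thesis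
      using ext_sub_power_sub[OF cyc.hyps(2) poly_cyc_fin_fin_index_power_sub[OF cyc.hyps(1) m(1)], of 1] by (intro key[of "power_sub m N" 1]) simp_all
  qed
qed

lemma generate_insert_ext:
  assumes "subgroup S G" "T \<subseteq> S" "T = generate G F" "F \<subseteq> S" "y \<in> S"
    and "\<And>g. g \<in> S \<Longrightarrow> \<exists>t\<in>T. \<exists>i::int. g = t \<otimes> y [^] i"
  shows "S = generate G (insert y F)"
proof
  have sub: "insert y F \<subseteq> carrier G" using assms subgroup.subset by blast
  show "generate G (insert y F) \<subseteq> S" using assms by (intro generate_subgroup_incl) auto
  show "S \<subseteq> generate G (insert y F)"
  proof
    fix g assume "g \<in> S"
    then obtain t i where g: "t \<in> T" "g = t \<otimes> y [^] (i::int)" using assms by blast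
    have "T \<subseteq> generate G (insert y F)" unfolding assms(3) by (intro mono_generate) auto
    moreover have "y [^] i \<in> generate G (insert y F)"
      using generate_is_subgroup[OF sub] by (intro subgroup_int_pow_closed) (auto intro: generate.incl)
    ultimately show "g \<in> generate G (insert y F)" using g by (auto intro: generate.eng)
  qed
qed

end

text \<open>The generator is the least positive element, or 0 if there is none. It is applied to the
  exponents that occur in a subgroup and to the coefficients that occur in an ideal.\<close>

lemma int_ideal_principal:
  fixes I :: "int set"
  assumes I0: "0 \<in> I" and diff: "\<And>i j. i \<in> I \<Longrightarrow> j \<in> I \<Longrightarrow> i - j \<in> I"
  obtains d where "d \<in> I" "d \<ge> 0" "\<And>i. i \<in> I \<Longrightarrow> d dvd i"
proof (cases "\<exists>i\<in>I. i > 0")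
  case False
  have "i = 0" if "i \<in> I" for i
  proof -
    have "- i \<in> I" using diff[OF I0 that] by simp
    then have "\<not> - i > 0" "\<not> i > 0" using False that by blast+
    then show ?thesis by linarith
  qed
  then show ?thesis using I0 that[of 0] by auto
next
  case True
  define d where "d = (LEAST n::nat. n > 0 \<and> int n \<in> I)"
  obtain i where i: "i \<in> I" "i > 0" using True by blast
  then have "nat i > 0 \<and> int (nat i) \<in> I" by simp
  then have d: "d > 0" "int d \<in> I" unfolding d_def by (metis (mono_tags, lifting) LeastI)+
  have Imul: "int d * k \<in> I" for k
  proof (induction k rule: int_induct[of _ 0])
    case base then show ?case using I0 by simp
  next
    case (step1 i)
    have "int d * i - (0 - int d) \<in> I" using diff I0 d step1 by blast
    then show ?case by (simp add: algebra_simps)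
  next
    case (step2 i)
    have "int d * i - int d \<in> I" using diff d step2 by blast
    then show ?case by (simp add: algebra_simps)
  qed
  have "int d dvd i" if "i \<in> I" for i
  proof (rule ccontr)
    assume nd: "\<not> int d dvd i"
    have "i - int d * (i div int d) \<in> I" using diff that Imul by blast
    then have I: "i mod int d \<in> I" by (simp add: minus_mult_div_eq_mod)
    have "i mod int d \<noteq> 0" using nd by (simp add: dvd_eq_mod_eq_0)
    moreover have "i mod int d \<ge> 0" "i mod int d < int d" using d by auto
    ultimately have p: "i mod int d > 0" "i mod int d < int d" by linarith+
    then have "d \<le> nat (i mod int d)" 
      using Least_le[of "\<lambda>n. n > 0 \<and> int n \<in> I" "nat (i mod int d)", folded d_def] I by simp
    then show False using p by linarith
  qed
  then show ?thesis using d that[of "int d"] by simp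
qed

context group begin

lemma inf_cyclic_ext_conj:
  "inf_cyclic_ext N x M \<Longrightarrow> n \<in> N \<Longrightarrow> x [^] (i::int) \<otimes> n \<otimes> inv (x [^] i) \<in> N"
  using inf_cyclic_extD(4,9)[of N x M] by (simp add: normalizes_def)

text \<open>Powers of \<open>x\<close> move to the right past elements of \<open>N\<close> at the
  cost of conjugating the latter, so only the total exponent has to be tracked.\<close>

lemma inf_cyclic_ext_pow:
  assumes ext: "inf_cyclic_ext N x M" and n: "n \<in> N"
  shows "\<exists>l\<in>N. (n \<otimes> x [^] d) [^] (i::int) = l \<otimes> x [^] (d * i :: int)"
proof -
  define y where "y = n \<otimes> x [^] d"
  note N = inf_cyclic_extD(1)[OF ext]
  have xc: "x \<in> carrier G" using inf_cyclic_extD(8)[OF ext] .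
  have Nc: "g \<in> carrier G" if "g \<in> N" for g using subgroup.mem_carrier[OF N that] .
  have yc: "y \<in> carrier G" using Nc[OF n] xc by (simp add: y_def)
  have "\<exists>l\<in>N. y [^] i = l \<otimes> x [^] (d * i)"
  proof (induction i rule: int_induct[of _ 0])
    case base then show ?case using subgroup.one_closed[OF N] by (auto intro!: bexI[of _ \<one>])
  next
    case (step1 i)
    then obtain l where l: "l \<in> N" "y [^] i = l \<otimes> x [^] (d * i)" by blast
    have "y [^] (i + 1) = (l \<otimes> x [^] (d * i)) \<otimes> (n \<otimes> x [^] d)" using l yc by (simp add: int_pow_mult y_def)
    also have "\<dots> = l \<otimes> (x [^] (d * i) \<otimes> n \<otimes> inv (x [^] (d * i))) \<otimes> x [^] (d * (i + 1))"
      using l(1) n Nc xc by (simp add: m_assoc int_pow_mult distrib_left)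
    finally show ?case
      using subgroup.m_closed[OF N l(1) inf_cyclic_ext_conj[OF ext n, of "d * i"]] by blast
  next
    case (step2 i)
    then obtain l where l: "l \<in> N" "y [^] i = l \<otimes> x [^] (d * i)" by blast
    have "y [^] (i - 1) = (l \<otimes> x [^] (d * i)) \<otimes> inv (n \<otimes> x [^] d)" using l yc by (simp add: int_pow_diff y_def)
    also have "\<dots> = l \<otimes> (x [^] (d * (i - 1)) \<otimes> inv n \<otimes> inv (x [^] (d * (i - 1)))) \<otimes> x [^] (d * (i - 1))"
      using l(1) n Nc xc by (simp add: m_assoc int_pow_diff right_diff_distrib inv_mult_group)
    finally show ?case
      using subgroup.m_closed[OF N l(1) inf_cyclic_ext_conj[OF ext subgroup.m_inv_closed[OF N n], of "d * (i - 1)"]]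
      by blast
  qed
  then show ?thesis by (simp add: y_def)
qed

text \<open>The intersection with \<open>N\<close> is covered by induction. It remains to generate
  the image of \<open>S\<close> in the layer: by one representative per colour in a finite layer,
  and by one element whose exponent generates the group of all exponents in a cyclic layer.\<close>

lemma poly_cyc_fin_subgroup_fg:
  assumes "poly_cyc_fin N" "subgroup S G" "S \<subseteq> N"
  shows "\<exists>F. finite F \<and> F \<subseteq> S \<and> S = generate G F"
  using assms
proof (induction arbitrary: S rule: poly_cyc_fin.induct)
  case base
  then have "S = {\<one>}" using subgroup.one_closed[OF base.prems(1)] by auto
  then show ?case by (intro exI[of _ "{}"]) (auto simp: generate_empty)
next
  case (fin N M)
  have s: "subgroup N G" by (rule poly_cyc_fin_subgroup[OF fin.hyps(1)])
  have SN: "subgroup (S \<inter> N) G" by (rule subgroups_Inter_pair[OF fin.prems(1) s])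
  obtain F where F: "finite F" "F \<subseteq> S \<inter> N" "S \<inter> N = generate G F" using fin.IH[OF SN] by auto
  obtain c :: "'a \<Rightarrow> nat" where c: "finite (c ` M)" "\<And>g h. g \<in> M \<Longrightarrow> h \<in> M \<Longrightarrow> c g = c h \<Longrightarrow> g \<otimes> inv h \<in> N"
    using fin.hyps(5) unfolding fin_index_def by blast
  define r where "r = inv_into S c"
  have r: "r (c g) \<in> S" "c (r (c g)) = c g" if "g \<in> S" for g
    using inv_into_into[of "c g" c S] f_inv_into_f[of "c g" c S] that unfolding r_def by simp_all
  define F' where "F' = F \<union> r ` c ` S"
  have F'S: "F' \<subseteq> S" using F r by (auto simp: F'_def)
  have "finite (c ` S)" using c(1) fin.prems(2) by (meson finite_subset image_mono)
  then have "finite F'" using F by (auto simp: F'_def)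
  moreover have "S = generate G F'"
  proof
    show "generate G F' \<subseteq> S" by (rule generate_subgroup_incl[OF F'S fin.prems(1)])
    show "S \<subseteq> generate G F'"
    proof
      fix g assume g: "g \<in> S"
      have "g \<otimes> inv (r (c g)) \<in> N" using c(2)[of g "r (c g)"] g r[OF g] fin.prems(2) by auto
      moreover have "g \<otimes> inv (r (c g)) \<in> S"
        by (rule subgroup.m_closed[OF fin.prems(1) g subgroup.m_inv_closed[OF fin.prems(1) r(1)[OF g]]])
      ultimately have "g \<otimes> inv (r (c g)) \<in> generate G F'" 
        using F(3) mono_generate[of F F'] by (auto simp: F'_def)
      moreover have "r (c g) \<in> generate G F'" using g by (intro generate.incl) (auto simp: F'_def)
      ultimately have "g \<otimes> inv (r (c g)) \<otimes> r (c g) \<in> generate G F'" by (rule generate.eng)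
      moreover have "g \<in> carrier G" "r (c g) \<in> carrier G" using g r(1)[OF g] subgroup.mem_carrier[OF fin.prems(1)] by auto
      ultimately show "g \<in> generate G F'" by (simp add: m_assoc)
    qed
  qed
  ultimately show ?case using F'S by blast
next
  case (cyc N x M)
  note s = inf_cyclic_extD[OF cyc.hyps(2)]
  note xc = s(8)
  have SN: "subgroup (S \<inter> N) G" by (rule subgroups_Inter_pair[OF cyc.prems(1) s(1)])
  obtain F where F: "finite F" "F \<subseteq> S \<inter> N" "S \<inter> N = generate G F" using cyc.IH[OF SN] by auto
  define I where "I = {i::int. \<exists>n\<in>N. n \<otimes> x [^] i \<in> S}"
  have Sc: "g \<in> carrier G" if "g \<in> S" for g using subgroup.mem_carrier[OF cyc.prems(1) that] .
  have Nc: "g \<in> carrier G" if "g \<in> N" for g using subgroup.mem_carrier[OF s(1) that] .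
  have Idiff: "i - j \<in> I" if "i \<in> I" "j \<in> I" for i j
  proof -
    obtain n where n: "n \<in> N" "n \<otimes> x [^] i \<in> S" using \<open>i \<in> I\<close> unfolding I_def by blast
    obtain m where m: "m \<in> N" "m \<otimes> x [^] j \<in> S" using \<open>j \<in> I\<close> unfolding I_def by blast
    have "(n \<otimes> x [^] i) \<otimes> inv (m \<otimes> x [^] j) \<in> S" using n m cyc.prems(1) by (simp add: subgroup.m_closed subgroup.m_inv_closed)
    moreover have "(n \<otimes> x [^] i) \<otimes> inv (m \<otimes> x [^] j) = 
        (n \<otimes> (x [^] (i - j) \<otimes> inv m \<otimes> inv (x [^] (i - j)))) \<otimes> x [^] (i - j)"
      using n(1) m(1) Nc xc by (simp add: inv_mult_group m_assoc int_pow_diff)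
    moreover have "n \<otimes> (x [^] (i - j) \<otimes> inv m \<otimes> inv (x [^] (i - j))) \<in> N"
      using subgroup.m_closed[OF s(1) n(1) inf_cyclic_ext_conj[OF cyc.hyps(2) subgroup.m_inv_closed[OF s(1) m(1)]]] .
    ultimately show ?thesis unfolding I_def by auto
  qed
  have I0: "0 \<in> I" using subgroup.one_closed[OF s(1)] subgroup.one_closed[OF cyc.prems(1)] unfolding I_def by (auto intro!: bexI[of _ \<one>])
  obtain d where d: "d \<in> I" "\<And>i. i \<in> I \<Longrightarrow> d dvd i" using int_ideal_principal[OF I0 Idiff] by metis
  then obtain n where n: "n \<in> N" "n \<otimes> x [^] d \<in> S" unfolding I_def by blast
  define y where "y = n \<otimes> x [^] d"
  have yS: "y \<in> S" using n by (simp add: y_def)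
  have "S = generate G (insert y F)"
  proof (rule generate_insert_ext[OF cyc.prems(1) _ F(3) _ yS])
    fix g assume g: "g \<in> S"
    then obtain m i where m: "m \<in> N" "g = m \<otimes> x [^] (i::int)" using inf_cyclic_ext_decomp[OF cyc.hyps(2), of g] cyc.prems(2) by blast
    then have "i \<in> I" using g unfolding I_def by blast
    then obtain q where q: "i = d * q" using d by (auto elim: dvdE)
    obtain l where l: "l \<in> N" "y [^] q = l \<otimes> x [^] (d * q)" 
      using inf_cyclic_ext_pow[OF cyc.hyps(2) n(1), of d q] unfolding y_def by blast
    have "g \<otimes> inv (y [^] q) = m \<otimes> inv l"
      using m l q Nc xc by (simp add: m_assoc inv_mult_group)
    then have "g \<otimes> inv (y [^] q) \<in> S \<inter> N" 
      using subgroup.m_closed[OF s(1) m(1) subgroup.m_inv_closed[OF s(1) l(1)]]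
        subgroup.m_closed[OF cyc.prems(1) g subgroup.m_inv_closed[OF cyc.prems(1) subgroup_int_pow_closed[OF cyc.prems(1) yS, of q]]] by simp
    moreover have "g = g \<otimes> inv (y [^] q) \<otimes> y [^] q" using Sc[OF g] Sc[OF yS] by (simp add: m_assoc)
    ultimately show "\<exists>t\<in>S \<inter> N. \<exists>i::int. g = t \<otimes> y [^] i" by blast
  qed (use F in auto)
  then show ?case using F(1,2) yS by (intro exI[of _ "insert y F"]) auto
qed

section \<open>Colourings versus finite sets of cosets\<close>

lemma finite_rcosets_if_fin_index:
  assumes "subgroup S G" "fin_index S (carrier G)"
  shows "finite (rcosets S)"
proof -
  obtain c :: "'a \<Rightarrow> nat" where c: "finite (c ` carrier G)"
      "\<And>g h. g \<in> carrier G \<Longrightarrow> h \<in> carrier G \<Longrightarrow> c g = c h \<Longrightarrow> g \<otimes> inv h \<in> S"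
    using assms(2) unfolding fin_index_def by blast
  define r where "r = inv_into (carrier G) c"
  have "rcosets S \<subseteq> (\<lambda>n. S #> r n) ` c ` carrier G"
  proof
    fix C assume "C \<in> rcosets S"
    then obtain g where g: "g \<in> carrier G" "C = S #> g" by (auto simp: RCOSETS_def)
    have r: "r (c g) \<in> carrier G" "c (r (c g)) = c g"
      using inv_into_into[of "c g" c "carrier G"] f_inv_into_f[of "c g" c "carrier G"] g unfolding r_def by simp_all
    have "g \<otimes> inv (r (c g)) \<in> S" using c(2)[OF g(1) r(1)] r(2) by simp
    then have "g \<in> S #> r (c g)"
      using g r unfolding r_coset_def by (auto intro!: bexI[of _ "g \<otimes> inv (r (c g))"] simp: m_assoc)
    then have "S #> g = S #> r (c g)" using repr_independence[OF _ r(1) assms(1)] by simp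
    then show "C \<in> (\<lambda>n. S #> r n) ` c ` carrier G" using g by blast
  qed
  then show ?thesis using c(1) finite_subset by blast
qed

lemma fin_index_if_finite_rcosets:
  assumes "subgroup S G" "finite (rcosets S)"
  shows "fin_index S (carrier G)"
proof -
  obtain e :: "'a set \<Rightarrow> nat" where e: "inj_on e (rcosets S)"
    using finite_imp_inj_to_nat_seg[OF assms(2)] by blast
  show ?thesis
  proof (rule fin_indexI[of "\<lambda>g. e (S #> g)"])
    show "finite ((\<lambda>g. e (S #> g)) ` carrier G)"
      by (rule finite_subset[OF _ finite_imageI[OF assms(2), of e]]) (auto simp: RCOSETS_def)
    fix g h assume gh: "g \<in> carrier G" "h \<in> carrier G" "e (S #> g) = e (S #> h)"
    then have "S #> g = S #> h" using e by (auto simp: inj_on_def RCOSETS_def)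
    then have "g \<in> S #> h" using rcos_self[OF gh(1) assms(1)] by simp
    then show "g \<otimes> inv h \<in> S"
      using gh subgroup.mem_carrier[OF assms(1)] by (auto simp: r_coset_def m_assoc)
  qed
qed

lemma finite_index_normal_iff:
  "N \<in> finite_index_normal G \<longleftrightarrow> subgroup N G \<and> normalizes (carrier G) N \<and> fin_index N (carrier G)"
  unfolding finite_index_normal_def normal_inv_iff normalizes_def
  using finite_rcosets_if_fin_index fin_index_if_finite_rcosets by auto

lemma finite_index_normal_Int:
  assumes "N \<in> finite_index_normal G" "M \<in> finite_index_normal G"
  shows "N \<inter> M \<in> finite_index_normal G"
  using assms unfolding finite_index_normal_iff normalizes_def
  by (simp add: subgroups_Inter_pair fin_index_Int)

lemma poly_cyc_fin_finite_index_normal_power_sub: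
  assumes "poly_cyc_fin (carrier G)" "m > 0"
  shows "power_sub m (carrier G) \<in> finite_index_normal G"
  unfolding finite_index_normal_iff using poly_cyc_fin_fin_index_power_sub[OF assms] subgroup_power_sub[OF order_refl, of m]
    normalizes_power_sub[of "carrier G" "carrier G" m] by (simp add: normalizes_def)

text \<open>A cyclic factor is either infinite, giving a layer of kind \<open>cyc\<close>, or some
  nonzero power of its generator falls into the previous term, and then the layer is finite.\<close>

lemma polycyclic_by_finite_poly_cyc_fin:
  assumes "polycyclic_by_finite G"
  shows "poly_cyc_fin (carrier G)"
proof -
  obtain N where N: "N \<in> finite_index_normal G" "polycyclic (G\<lparr>carrier := N\<rparr>)"
    using assms by (auto simp: polycyclic_by_finite_def)
  then have N': "subgroup N G" "normalizes (carrier G) N" "fin_index N (carrier G)" by (simp_all add: finite_index_normal_iff)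
  obtain n :: nat and H where H: "H 0 = {\<one>}" "H n = N"
    "\<And>i. i < n \<Longrightarrow> subgroup (H (Suc i)) (G\<lparr>carrier := N\<rparr>) \<and> H i \<lhd> G\<lparr>carrier := H (Suc i)\<rparr> \<and>
       cyclic_group (G\<lparr>carrier := H (Suc i)\<rparr> Mod H i)"
    using N(2) by (auto simp: polycyclic_def)
  have "poly_cyc_fin (H i)" if "i \<le> n" for i
    using that
  proof (induction i)
    case 0
    then show ?case using H(1) poly_cyc_fin.base by simp
  next
    case (Suc i)
    let ?S = "G\<lparr>carrier := H (Suc i)\<rparr>"
    have Hi: "subgroup (H (Suc i)) (G\<lparr>carrier := N\<rparr>)" "H i \<lhd> ?S" "cyclic_group (?S Mod H i)"
      using H(3)[of i] Suc.prems by auto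
    have S: "subgroup (H (Suc i)) G" by (rule incl_subgroup[OF N'(1) Hi(1)])
    interpret S: group ?S by (rule subgroup_imp_group[OF S])
    interpret HS: normal "H i" ?S by (rule Hi(2))
    have sub: "H i \<subseteq> H (Suc i)" using HS.subset by simp
    have pc: "poly_cyc_fin (H i)" using Suc by simp
    have s: "subgroup (H i) G" by (rule poly_cyc_fin_subgroup[OF pc])
    have invS: "inv\<^bsub>?S\<^esub> g = inv g" if "g \<in> H (Suc i)" for g
      using m_inv_consistent[OF S that] .
    have norm: "normalizes (H (Suc i)) (H i)"
      unfolding normalizes_def using HS.inv_op_closed2 invS by fastforce
    obtain X where X: "X \<in> carrier (?S Mod H i)" "carrier (?S Mod H i) = range (\<lambda>n::int. X [^]\<^bsub>?S Mod H i\<^esub> n)"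
      using Hi(3) group.cyclic_group[OF HS.factorgroup_is_group] by blast
    obtain x where x: "x \<in> H (Suc i)" "X = H i #>\<^bsub>?S\<^esub> x" using X(1) by (auto simp: carrier_FactGroup)
    have xc: "x \<in> carrier G" using subgroup.mem_carrier[OF S x(1)] .
    have dec: "\<exists>n\<in>H i. \<exists>k::int. g = n \<otimes> x [^] k" if g: "g \<in> H (Suc i)" for g
    proof -
      have "H i #>\<^bsub>?S\<^esub> g \<in> carrier (?S Mod H i)" using g by (auto simp: carrier_FactGroup)
      then obtain k :: int where "H i #>\<^bsub>?S\<^esub> g = X [^]\<^bsub>?S Mod H i\<^esub> k" using X(2) by blast
      also have "\<dots> = H i #>\<^bsub>?S\<^esub> (x [^]\<^bsub>?S\<^esub> k)" using HS.FactGroup_int_pow[of x k] x by simp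
      finally have e: "H i #>\<^bsub>?S\<^esub> g = H i #>\<^bsub>?S\<^esub> (x [^]\<^bsub>?S\<^esub> k)" .
      have "g \<in> H i #>\<^bsub>?S\<^esub> g" using S.rcos_self[OF _ HS.subgroup_axioms, of g] g by simp
      then have "g \<in> H i #>\<^bsub>?S\<^esub> (x [^]\<^bsub>?S\<^esub> k)" using e by simp
      moreover have "x [^]\<^bsub>?S\<^esub> k = x [^] k" using int_pow_consistent[OF S x(1)] by simp
      ultimately show ?thesis by (auto simp: r_coset_def)
    qed
    show ?case
    proof (cases "\<forall>k::int. x [^] k \<in> H i \<longrightarrow> k = 0")
      case True
      then have "inf_cyclic_ext (H i) x (H (Suc i))"
        unfolding inf_cyclic_ext_def using s S sub norm x(1) dec by simp
      then show ?thesis by (rule poly_cyc_fin.cyc[OF pc])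
    next
      case False
      then obtain k :: int where k: "x [^] k \<in> H i" "k \<noteq> 0" by blast
      define d where "d = \<bar>k\<bar>"
      have d: "x [^] (d * q) \<in> H i" for q
        using subgroup_int_pow_closed[OF s k(1), of "sgn k * q"] xc
        by (simp add: int_pow_pow d_def abs_sgn mult.assoc)
      \<comment> \<open>The decomposition is not unique in the finite case, so one exponent is
        selected for each \<open>g\<close> and then used modulo \<open>d\<close> as its
        colour.\<close>
      have "\<forall>g\<in>H (Suc i). \<exists>p. fst p \<in> H i \<and> g = fst p \<otimes> x [^] (snd p :: int)"
        using dec by (metis fst_conv snd_conv)
      then obtain p where p: "\<And>g. g \<in> H (Suc i) \<Longrightarrow> fst (p g) \<in> H i \<and> g = fst (p g) \<otimes> x [^] (snd (p g) :: int)"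
        by metis
      have "fin_index (H i) (H (Suc i))"
      proof (rule fin_indexI[of "\<lambda>g. snd (p g) mod d"])
        show "finite ((\<lambda>g. snd (p g) mod d) ` H (Suc i))"
          by (rule finite_subset[of _ "{0..<d}"]) (use k in \<open>auto simp: d_def\<close>)
        fix g h assume gh: "g \<in> H (Suc i)" "h \<in> H (Suc i)" "snd (p g) mod d = snd (p h) mod d"
        obtain n j where n: "n \<in> H i" "g = n \<otimes> x [^] j" "p g = (n, j)" using p[OF gh(1)] by (cases "p g") auto
        obtain m l where m: "m \<in> H i" "h = m \<otimes> x [^] l" "p h = (m, l)" using p[OF gh(2)] by (cases "p h") auto
        have "d dvd j - l" using gh n m by (simp add: mod_eq_dvd_iff)
        then have q: "x [^] (j - l) \<in> H i" using d by (auto elim!: dvdE)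
        have cc: "n \<in> carrier G" "m \<in> carrier G" using n(1) m(1) subgroup.mem_carrier[OF s] by auto
        have "g \<otimes> inv h = n \<otimes> x [^] (j - l) \<otimes> inv m"
          using n m cc xc by (simp add: m_assoc inv_mult_group int_pow_diff)
        then show "g \<otimes> inv h \<in> H i"
          using subgroup.m_closed[OF s subgroup.m_closed[OF s n(1) q] subgroup.m_inv_closed[OF s m(1)]] by simp
      qed
      then show ?thesis by (rule poly_cyc_fin.fin[OF pc S sub norm])
    qed
  qed
  then have "poly_cyc_fin N" using H(2) by auto
  then show ?thesis by (rule poly_cyc_fin.fin[OF _ subgroup_self subgroup.subset[OF N'(1)] N'(2,3)])
qed

end

section \<open>Profinite completions\<close>

context group begin

lemma finite_index_normalD:
  assumes "N \<in> finite_index_normal G"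
  shows "N \<lhd> G" "subgroup N G" "N \<subseteq> carrier G"
  using assms normal_imp_subgroup[of N G] subgroup.subset[of N G] by (auto simp: finite_index_normal_def)

lemma finite_index_normal_carrier: "carrier G \<in> finite_index_normal G"
  unfolding finite_index_normal_iff
  by (simp add: subgroup_self normalizes_def fin_index_self)

lemma finite_index_normal_INT:
  "finite F \<Longrightarrow> F \<subseteq> finite_index_normal G \<Longrightarrow> \<Inter> F \<inter> carrier G \<in> finite_index_normal G"
proof (induction F rule: finite_induct)
  case (insert N F)
  then have "N \<inter> (\<Inter> F \<inter> carrier G) \<in> finite_index_normal G"
    using finite_index_normal_Int[of N "\<Inter> F \<inter> carrier G"] by simp
  then show ?case by (simp add: Int_assoc)
qed (simp add: finite_index_normal_carrier)

lemma rcoset_eq_iff: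
  assumes "subgroup N G" "g \<in> carrier G" "h \<in> carrier G"
  shows "N #> g = N #> h \<longleftrightarrow> g \<otimes> inv h \<in> N"
proof
  assume "N #> g = N #> h"
  then have "g \<in> N #> h" using rcos_self[OF assms(2,1)] by simp
  then show "g \<otimes> inv h \<in> N"
    using assms(3) subgroup.mem_carrier[OF assms(1)] by (auto simp: r_coset_def m_assoc)
next
  assume N: "g \<otimes> inv h \<in> N"
  have "g = (g \<otimes> inv h) \<otimes> h" using assms by (simp add: m_assoc)
  then have "g \<in> N #> h" unfolding r_coset_def using N by blast
  then show "N #> g = N #> h" using repr_independence[OF _ assms(3,1)] by simp
qed

lemma rcoset_eqI: "subgroup N G \<Longrightarrow> C \<in> rcosets N \<Longrightarrow> g \<in> C \<Longrightarrow> C = N #> g \<and> g \<in> carrier G"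
  using repr_independence[of g N] unfolding RCOSETS_def
  by (auto dest!: subgroup.subset[THEN r_coset_subset_G])

text \<open>The canonical map into the completion. It is restricted to the index set because points
  of the completion are extensional functions.\<close>

definition iota :: "'a \<Rightarrow> 'a set \<Rightarrow> 'a set"
  where "iota g = (\<lambda>N\<in>finite_index_normal G. N #> g)"

lemma profinite_completionD:
  assumes "x \<in> carrier (profinite_completion G)" "N \<in> finite_index_normal G"
  shows "x N \<in> rcosets N"
    and "\<And>M. M \<in> finite_index_normal G \<Longrightarrow> N \<subseteq> M \<Longrightarrow> x N \<subseteq> x M"
    and "\<And>g. g \<in> x N \<Longrightarrow> x N = N #> g \<and> g \<in> carrier G"
    and "\<exists>g. g \<in> x N"
proof -
  show 1: "x N \<in> rcosets N" using assms by (auto simp: profinite_completion_def)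
  show "x N \<subseteq> x M" if "M \<in> finite_index_normal G" "N \<subseteq> M" for M
    using assms that by (auto simp: profinite_completion_def)
  show "x N = N #> g \<and> g \<in> carrier G" if "g \<in> x N" for g
    using rcoset_eqI[OF finite_index_normalD(2)[OF assms(2)] 1 that] .
  obtain g where "g \<in> carrier G" "x N = N #> g" using 1 by (auto simp: RCOSETS_def)
  then show "\<exists>g. g \<in> x N" using rcos_self[OF _ finite_index_normalD(2)[OF assms(2)]] by blast
qed

lemma profinite_completion_eqI:
  assumes "x \<in> carrier (profinite_completion G)" "y \<in> carrier (profinite_completion G)"
    and "\<And>N. N \<in> finite_index_normal G \<Longrightarrow> x N = y N"
  shows "x = y"
  using assms by (intro PiE_ext[of x _ "\<lambda>N. rcosets N" y]) (auto simp: profinite_completion_def)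

lemma iota_in_completion:
  assumes "g \<in> carrier G"
  shows "iota g \<in> carrier (profinite_completion G)"
proof -
  have "N #> g \<in> rcosets N" for N using assms by (auto simp: RCOSETS_def)
  moreover have "N #> g \<subseteq> M #> g" if "N \<subseteq> M" for N M using that by (auto simp: r_coset_def)
  ultimately show ?thesis by (auto simp: profinite_completion_def iota_def)
qed

lemma mult_completion_apply:
  "N \<in> finite_index_normal G \<Longrightarrow> (x \<otimes>\<^bsub>profinite_completion G\<^esub> y) N = x N <#> y N"
  by (simp add: profinite_completion_def)

lemma mult_completion_extensional:
  "x \<otimes>\<^bsub>profinite_completion G\<^esub> y \<in> extensional (finite_index_normal G)"
  by (simp add: profinite_completion_def product_group_def)

lemma rcosets_mult:
  assumes "N \<in> finite_index_normal G" "g \<in> carrier G" "h \<in> carrier G"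
  shows "(N #> g) <#> (N #> h) = N #> (g \<otimes> h)"
  using normal.rcos_sum[OF finite_index_normalD(1)[OF assms(1)] assms(2,3)] .

lemma completion_mult_closed:
  assumes "x \<in> carrier (profinite_completion G)" "y \<in> carrier (profinite_completion G)"
  shows "x \<otimes>\<^bsub>profinite_completion G\<^esub> y \<in> carrier (profinite_completion G)"
proof -
  have "x N <#> y N \<in> rcosets N" if N: "N \<in> finite_index_normal G" for N
  proof -
    obtain g h where "g \<in> x N" "h \<in> y N" using profinite_completionD(4) assms N by metis
    then show ?thesis
      using profinite_completionD(3)[OF assms(1) N] profinite_completionD(3)[OF assms(2) N] rcosets_mult[OF N]
      by (metis m_closed rcosetsI finite_index_normalD(3)[OF N])
  qed
  moreover have "x N <#> y N \<subseteq> x M <#> y M"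
    if "N \<in> finite_index_normal G" "M \<in> finite_index_normal G" "N \<subseteq> M" for N M
    using profinite_completionD(2)[OF assms(1) that(1,2,3)] profinite_completionD(2)[OF assms(2) that(1,2,3)]
    by (rule mono_set_mult)
  ultimately show ?thesis
    using mult_completion_extensional[of x y] mult_completion_apply[of _ x y]
    by (simp add: profinite_completion_def PiE_def Pi_def)
qed

lemma iota_mult:
  assumes "g \<in> carrier G" "h \<in> carrier G"
  shows "iota (g \<otimes> h) = iota g \<otimes>\<^bsub>profinite_completion G\<^esub> iota h"
proof (rule profinite_completion_eqI)
  show "iota g \<otimes>\<^bsub>profinite_completion G\<^esub> iota h \<in> carrier (profinite_completion G)"
    using assms by (intro completion_mult_closed iota_in_completion)
  show "iota (g \<otimes> h) \<in> carrier (profinite_completion G)" using assms by (intro iota_in_completion) simp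
qed (use assms in \<open>simp add: mult_completion_apply iota_def rcosets_mult\<close>)

lemma topspace_profinite_topology: "topspace (profinite_topology G) = carrier (profinite_completion G)"
  unfolding profinite_topology_def by (auto simp: profinite_completion_def)

lemma continuous_coordinate:
  assumes "N \<in> finite_index_normal G"
  shows "continuous_map (profinite_topology G) (discrete_topology (rcosets N)) (\<lambda>x. x N)"
  unfolding profinite_topology_def
  by (intro continuous_map_from_subtopology continuous_map_product_projection assms)

lemma openin_coordinate:
  assumes "N \<in> finite_index_normal G" "C \<in> rcosets N"
  shows "openin (profinite_topology G) {x \<in> carrier (profinite_completion G). x N = C}"
  using openin_continuous_map_preimage[OF continuous_coordinate[OF assms(1)], of "{C}"] assms(2)
  by (simp add: topspace_profinite_topology)

text \<open>A basic open set of the product constrains finitely many coordinates. The intersection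
  of the corresponding subgroups is again normal of finite index, and by compatibility the
  coordinate there determines all the constrained ones.\<close>

lemma profinite_basic_nbhd:
  assumes "openin (profinite_topology G) W" "x \<in> W"
  obtains N where "N \<in> finite_index_normal G"
    "\<And>y. y \<in> carrier (profinite_completion G) \<Longrightarrow> y N = x N \<Longrightarrow> y \<in> W"
proof -
  obtain T where T: "openin (product_topology (\<lambda>N. discrete_topology (rcosets N)) (finite_index_normal G)) T"
    "W = T \<inter> carrier (profinite_completion G)"
    using assms(1) by (auto simp: profinite_topology_def openin_subtopology)
  obtain V where V: "finite {i \<in> finite_index_normal G. V i \<noteq> rcosets i}"
    "x \<in> PiE (finite_index_normal G) V" "PiE (finite_index_normal G) V \<subseteq> T"
    using T assms(2) unfolding openin_product_topology_alt by fastforce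
  define F where "F = {i \<in> finite_index_normal G. V i \<noteq> rcosets i}"
  \<comment> \<open>The carrier keeps this correct when \<open>F\<close> is empty.\<close>
  define N where "N = \<Inter> F \<inter> carrier G"
  have N: "N \<in> finite_index_normal G"
    unfolding N_def using V(1) by (intro finite_index_normal_INT) (auto simp: F_def)
  have xP: "x \<in> carrier (profinite_completion G)" using T(2) assms(2) by blast
  show ?thesis
  proof (rule that[OF N])
    fix y assume y: "y \<in> carrier (profinite_completion G)" "y N = x N"
    have "y i \<in> V i" if i: "i \<in> finite_index_normal G" for i
    proof (cases "i \<in> F")
      case False
      then show ?thesis using profinite_completionD(1)[OF y(1) i] i by (auto simp: F_def)
    next
      case True
      have Ni: "N \<subseteq> i" using True by (auto simp: N_def)
      obtain g where g: "g \<in> x N" using profinite_completionD(4)[OF xP N] by blast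
      have "g \<in> x i" "g \<in> y i"
        using profinite_completionD(2)[OF xP N i Ni] profinite_completionD(2)[OF y(1) N i Ni] g y(2) by auto
      then have "y i = x i" using profinite_completionD(3)[OF xP i] profinite_completionD(3)[OF y(1) i] by metis
      then show ?thesis using V(2) i by auto
    qed
    then have "y \<in> PiE (finite_index_normal G) V" using y(1) by (auto simp: profinite_completion_def)
    then show "y \<in> W" using V(3) T(2) y(1) by blast
  qed
qed

lemma iota_dense:
  assumes "openin (profinite_topology G) W" "W \<noteq> {}"
  shows "\<exists>g\<in>carrier G. iota g \<in> W"
proof -
  obtain x where x: "x \<in> W" using assms by blast
  then have xP: "x \<in> carrier (profinite_completion G)"
    using openin_subset[OF assms(1)] by (auto simp: topspace_profinite_topology)
  obtain N where N: "N \<in> finite_index_normal G"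
    "\<And>y. y \<in> carrier (profinite_completion G) \<Longrightarrow> y N = x N \<Longrightarrow> y \<in> W"
    using profinite_basic_nbhd[OF assms(1) x] by metis
  obtain g where g: "g \<in> x N" using profinite_completionD(4)[OF xP N(1)] by blast
  then have "x N = N #> g" "g \<in> carrier G" using profinite_completionD(3)[OF xP N(1)] by auto
  then show ?thesis using N iota_in_completion[of g] by (intro bexI[of _ g] N(2)) (auto simp: iota_def)
qed

end

text \<open>
  \<open>rel U h g\<close> says that \<open>h\<close> and \<open>g\<close> have the same image in the finite quotient of the common
  completion that corresponds to \<open>G Mod U\<close>.
\<close>
locale completion_relation = H: group H + G: group G
  for H :: "('h, 'm) monoid_scheme" (structure) and G :: "('g, 'n) monoid_scheme" +
  fixes rel :: "'g set \<Rightarrow> 'h \<Rightarrow> 'g \<Rightarrow> bool"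
  assumes rel_left: "U \<in> finite_index_normal G \<Longrightarrow> h \<in> carrier H \<Longrightarrow> \<exists>g. rel U h g"
    and rel_right: "U \<in> finite_index_normal G \<Longrightarrow> g \<in> carrier G \<Longrightarrow> \<exists>h. rel U h g"
    and rel_carrier: "rel U h g \<Longrightarrow> h \<in> carrier H \<and> g \<in> carrier G \<and> U \<in> finite_index_normal G"
    and rel_mult: "rel U h g \<Longrightarrow> rel U h' g' \<Longrightarrow> rel U (h \<otimes>\<^bsub>H\<^esub> h') (g \<otimes>\<^bsub>G\<^esub> g')"
    and rel_mono: "rel U h g \<Longrightarrow> V \<in> finite_index_normal G \<Longrightarrow> U \<subseteq> V \<Longrightarrow> rel V h g"
    and rel_coset: "rel U h g \<Longrightarrow> rel U h g' \<Longrightarrow> g \<otimes>\<^bsub>G\<^esub> inv\<^bsub>G\<^esub> g' \<in> U"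
    and rel_one: "U \<in> finite_index_normal G \<Longrightarrow> u \<in> U \<Longrightarrow> rel U \<one>\<^bsub>H\<^esub> u"
    and rel_kernel: "N \<in> finite_index_normal H \<Longrightarrow>
          \<exists>U\<in>finite_index_normal G. \<forall>h. rel U h \<one>\<^bsub>G\<^esub> \<longrightarrow> h \<in> N"

text \<open>Sending \<open>h\<close> to the completion of \<open>H\<close> and through
  \<open>f\<close> gives a coset of each \<open>U\<close>, and \<open>h\<close> is related to the
  members of this coset. That every \<open>g\<close> is reached uses continuity of \<open>f\<close>
  and density of \<open>H\<close>; the kernel condition uses that \<open>f\<close> is open.\<close>

lemma isomorphic_completions_relation:
  assumes "group H" "group G" "isomorphic_completions H G"
  obtains rel where "completion_relation H G rel"
proof -
  interpret H: group H by fact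
  interpret G: group G by fact
  let ?PH = "profinite_completion H" and ?PG = "profinite_completion G"
  obtain f where f: "f \<in> iso ?PH ?PG" "homeomorphic_map (profinite_topology H) (profinite_topology G) f"
    using assms(3) by (auto simp: isomorphic_completions_def)
  have fc: "f x \<in> carrier ?PG" if "x \<in> carrier ?PH" for x
    using f(1) that by (auto simp: iso_def hom_def)
  have fm: "f (x \<otimes>\<^bsub>?PH\<^esub> y) = f x \<otimes>\<^bsub>?PG\<^esub> f y" if "x \<in> carrier ?PH" "y \<in> carrier ?PH" for x y
    using f(1) that by (auto simp: iso_def hom_def)
  have finj: "inj_on f (carrier ?PH)" and fsurj: "f ` carrier ?PH = carrier ?PG"
    using f(1) by (auto simp: iso_def bij_betw_def)
  define \<beta> where "\<beta> U h = f (H.iota h) U" for U h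
  define rel where "rel U h g \<longleftrightarrow> U \<in> finite_index_normal G \<and> h \<in> carrier H \<and> g \<in> \<beta> U h" for U h g
  have P: "f (H.iota h) \<in> carrier ?PG" if "h \<in> carrier H" for h using fc H.iota_in_completion that by blast
  have \<beta>D: "\<beta> U h = U #>\<^bsub>G\<^esub> g \<and> g \<in> carrier G" if "rel U h g" for U h g
    using that G.profinite_completionD(3)[OF P] unfolding rel_def \<beta>_def by blast
  have \<beta>m: "\<beta> U (h \<otimes>\<^bsub>H\<^esub> h') = \<beta> U h <#>\<^bsub>G\<^esub> \<beta> U h'"
    if "U \<in> finite_index_normal G" "h \<in> carrier H" "h' \<in> carrier H" for U h h'
    using that by (simp add: \<beta>_def H.iota_mult fm H.iota_in_completion G.mult_completion_apply)
  have mult: "rel U (h \<otimes>\<^bsub>H\<^esub> h') (g \<otimes>\<^bsub>G\<^esub> g')" if "rel U h g" "rel U h' g'" for U h h' g g'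
    using that unfolding rel_def by (auto simp: \<beta>m set_mult_def)
  have coset: "g \<otimes>\<^bsub>G\<^esub> inv\<^bsub>G\<^esub> g' \<in> U" if "rel U h g" "rel U h g'" for U h g g'
    using \<beta>D[OF that(1)] \<beta>D[OF that(2)] that G.finite_index_normalD(2)[of U] G.rcoset_eq_iff[of U g g']
    by (auto simp: rel_def)
  \<comment> \<open>If \<open>g\<close> is related to the identity, so is the square of
    \<open>g\<close>, and the coset condition puts \<open>g\<close> into \<open>U\<close>.\<close>
  have one: "\<beta> U \<one>\<^bsub>H\<^esub> = U" if U: "U \<in> finite_index_normal G" for U
  proof -
    obtain g where g: "rel U \<one>\<^bsub>H\<^esub> g"
      using G.profinite_completionD(4)[OF P[OF H.one_closed] U] U by (auto simp: rel_def \<beta>_def)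
    then have "rel U \<one>\<^bsub>H\<^esub> (g \<otimes>\<^bsub>G\<^esub> g)" using mult[OF g g] by simp
    then have "(g \<otimes>\<^bsub>G\<^esub> g) \<otimes>\<^bsub>G\<^esub> inv\<^bsub>G\<^esub> g \<in> U" using coset g by blast
    then have "g \<in> U" using \<beta>D[OF g] by (simp add: G.m_assoc)
    then show ?thesis using \<beta>D[OF g] G.finite_index_normalD[OF U] by (simp add: G.coset_join2)
  qed
  have "completion_relation H G rel"
  proof (unfold_locales)
    show "\<exists>g. rel U h g" if "U \<in> finite_index_normal G" "h \<in> carrier H" for U h
      using G.profinite_completionD(4)[OF P that(1)] that by (auto simp: rel_def \<beta>_def)
    show "\<exists>h. rel U h g" if U: "U \<in> finite_index_normal G" and g: "g \<in> carrier G" for U g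
    proof -
      define W where "W = {y \<in> carrier ?PG. y U = U #>\<^bsub>G\<^esub> g}"
      have W: "openin (profinite_topology G) W"
        unfolding W_def
        by (rule G.openin_coordinate[OF U G.rcosetsI[OF G.finite_index_normalD(3)[OF U] g]])
      have "G.iota g \<in> W" using G.iota_in_completion[OF g] U by (simp add: W_def G.iota_def)
      moreover have "G.iota g \<in> f ` carrier ?PH" using G.iota_in_completion[OF g] fsurj by simp
      ultimately obtain x where x: "x \<in> carrier ?PH" "f x \<in> W" by auto
      then have ne: "{x \<in> topspace (profinite_topology H). f x \<in> W} \<noteq> {}"
        by (auto simp: H.topspace_profinite_topology)
      have "openin (profinite_topology H) {x \<in> topspace (profinite_topology H). f x \<in> W}"
        by (rule openin_continuous_map_preimage[OF homeomorphic_imp_continuous_map[OF f(2)] W])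
      then obtain h where "h \<in> carrier H" "f (H.iota h) \<in> W"
        using H.iota_dense[OF _ ne] by auto
      then have "h \<in> carrier H" "\<beta> U h = U #>\<^bsub>G\<^esub> g" by (auto simp: W_def \<beta>_def)
      then have "rel U h g" using U G.rcos_self[OF g G.finite_index_normalD(2)[OF U]] by (simp add: rel_def)
      then show ?thesis by blast
    qed
    show "h \<in> carrier H \<and> g \<in> carrier G \<and> U \<in> finite_index_normal G" if "rel U h g" for U h g
      using that \<beta>D by (auto simp: rel_def)
    show "rel V h g" if "rel U h g" "V \<in> finite_index_normal G" "U \<subseteq> V" for U V h g
      using that G.profinite_completionD(2)[OF P, of h U V] by (auto simp: rel_def \<beta>_def)
    show "rel U \<one>\<^bsub>H\<^esub> u" if "U \<in> finite_index_normal G" "u \<in> U" for U u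
      using that one by (simp add: rel_def)
    show "\<exists>U\<in>finite_index_normal G. \<forall>h. rel U h \<one>\<^bsub>G\<^esub> \<longrightarrow> h \<in> N" if N: "N \<in> finite_index_normal H" for N
    proof -
      define W where "W = {x \<in> carrier ?PH. x N = N #>\<^bsub>H\<^esub> \<one>\<^bsub>H\<^esub>}"
      have W: "openin (profinite_topology H) W"
        unfolding W_def
        by (rule H.openin_coordinate[OF N H.rcosetsI[OF H.finite_index_normalD(3)[OF N] H.one_closed]])
      have e: "H.iota \<one>\<^bsub>H\<^esub> \<in> W" using H.iota_in_completion N by (simp add: W_def H.iota_def)
      have "openin (profinite_topology G) (f ` W)"
        using homeomorphic_imp_open_map[OF f(2)] W unfolding open_map_def by blast
      then obtain U where U: "U \<in> finite_index_normal G"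
        "\<And>y. y \<in> carrier ?PG \<Longrightarrow> y U = f (H.iota \<one>\<^bsub>H\<^esub>) U \<Longrightarrow> y \<in> f ` W"
        using e G.profinite_basic_nbhd[of "f ` W" "f (H.iota \<one>\<^bsub>H\<^esub>)"] by blast
      have "h \<in> N" if r: "rel U h \<one>\<^bsub>G\<^esub>" for h
      proof -
        have h: "h \<in> carrier H" using r by (simp add: rel_def)
        have "\<beta> U h = U" using \<beta>D[OF r] G.coset_mult_one G.finite_index_normalD(3)[OF U(1)] by simp
        then have "f (H.iota h) \<in> f ` W" using U(2)[OF P[OF h]] one[OF U(1)] by (simp add: \<beta>_def)
        then have "H.iota h \<in> W"
          using finj H.iota_in_completion[OF h] by (auto simp: W_def inj_on_def)
        then have "N #>\<^bsub>H\<^esub> h = N #>\<^bsub>H\<^esub> \<one>\<^bsub>H\<^esub>" using N by (simp add: W_def H.iota_def)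
        then show ?thesis using H.rcoset_eq_iff[OF H.finite_index_normalD(2)[OF N] h] h by simp
      qed
      then show ?thesis using U(1) by blast
    qed
  qed (use mult coset in blast)+
  then show ?thesis using that by blast
qed

text \<open>Modulo \<open>N\<close> all late \<open>F k\<close> coincide, and this stable map
  defines the \<open>N\<close>-coordinate of the limit. The limit itself need not come from a
  homomorphism of \<open>H\<close> to \<open>G\<close>. The last conclusion evaluates it through any
  late \<open>F k\<close> and any small \<open>L\<close>, which is the flexibility needed for
  composing two limits.\<close>

lemma limit_of_homs:
  assumes "group H" "group G" and hom: "\<And>k::nat. F k \<in> hom H G"
    and conv: "\<And>N. N \<in> finite_index_normal G \<Longrightarrow>
      \<exists>K. \<forall>k\<ge>K. \<forall>h\<in>carrier H. N #>\<^bsub>G\<^esub> F k h = N #>\<^bsub>G\<^esub> F K h"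
  obtains \<Phi> where "\<Phi> \<in> hom (profinite_completion H) (profinite_completion G)"
    "continuous_map (profinite_topology H) (profinite_topology G) \<Phi>"
    "\<And>N. N \<in> finite_index_normal G \<Longrightarrow> \<exists>M\<in>finite_index_normal H. \<exists>K. \<forall>k\<ge>K. \<forall>L\<in>finite_index_normal H.
       L \<subseteq> M \<longrightarrow> (\<forall>x\<in>carrier (profinite_completion H). \<forall>h\<in>x L. \<Phi> x N = N #>\<^bsub>G\<^esub> F k h)"
proof -
  interpret H: group H by fact
  interpret G: group G by fact
  let ?PH = "profinite_completion H" and ?PG = "profinite_completion G"
  obtain K where K: "\<And>N k h. N \<in> finite_index_normal G \<Longrightarrow> k \<ge> K N \<Longrightarrow> h \<in> carrier H \<Longrightarrow>
      N #>\<^bsub>G\<^esub> F k h = N #>\<^bsub>G\<^esub> F (K N) h"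
    using conv by metis
  have Fc: "F k h \<in> carrier G" if "h \<in> carrier H" for k h using hom that by (auto simp: hom_def)
  have Fm: "F k (h \<otimes>\<^bsub>H\<^esub> h') = F k h \<otimes>\<^bsub>G\<^esub> F k h'" if "h \<in> carrier H" "h' \<in> carrier H" for k h h'
    using hom that by (auto simp: hom_def)
  have gh: "group_hom H G (F k)" for k
    using hom by (simp add: group_hom_def group_hom_axioms_def assms)
  \<comment> \<open>The preimage of \<open>N\<close> under the stable map; the coordinate of a point
    at this subgroup suffices to compute the limit modulo \<open>N\<close>.\<close>
  define pre where "pre N = {h \<in> carrier H. F (K N) h \<in> N}" for N
  have pre: "pre N \<in> finite_index_normal H" if N: "N \<in> finite_index_normal G" for N
  proof -
    interpret F: group_hom H G "F (K N)" by (rule gh)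
    have N': "subgroup N G" "G.normalizes (carrier G) N" "G.fin_index N (carrier G)"
      using N by (simp_all add: G.finite_index_normal_iff)
    obtain c :: "_ \<Rightarrow> nat" where c: "finite (c ` carrier G)"
      "\<And>g h. g \<in> carrier G \<Longrightarrow> h \<in> carrier G \<Longrightarrow> c g = c h \<Longrightarrow> g \<otimes>\<^bsub>G\<^esub> inv\<^bsub>G\<^esub> h \<in> N"
      using N'(3) unfolding G.fin_index_def by blast
    have "subgroup (pre N) H"
      by (rule H.subgroupI)
        (auto simp: pre_def subgroup.m_closed[OF N'(1)] subgroup.m_inv_closed[OF N'(1)] 
          intro!: exI[of _ "\<one>\<^bsub>H\<^esub>"] subgroup.one_closed[OF N'(1)])
    moreover have "H.normalizes (carrier H) (pre N)"
      using N'(2) by (auto simp: H.normalizes_def G.normalizes_def pre_def)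
    moreover have "H.fin_index (pre N) (carrier H)"
    proof (rule H.fin_indexI[of "\<lambda>h. c (F (K N) h)"])
      show "finite ((\<lambda>h. c (F (K N) h)) ` carrier H)"
        by (rule finite_subset[OF _ c(1)]) auto
      fix g h assume "g \<in> carrier H" "h \<in> carrier H" "c (F (K N) g) = c (F (K N) h)"
      then show "g \<otimes>\<^bsub>H\<^esub> inv\<^bsub>H\<^esub> h \<in> pre N" using c(2)[of "F (K N) g" "F (K N) h"] by (simp add: pre_def)
    qed
    ultimately show ?thesis by (simp add: H.finite_index_normal_iff)
  qed
  have same: "N #>\<^bsub>G\<^esub> F (K N) h = N #>\<^bsub>G\<^esub> F (K N) h'"
    if N: "N \<in> finite_index_normal G" and h: "h \<in> C" "h' \<in> C" "C \<in> rcosets\<^bsub>H\<^esub> (pre N)" for N h h' C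
  proof -
    interpret F: group_hom H G "F (K N)" by (rule gh)
    have s: "subgroup (pre N) H" by (rule H.finite_index_normalD(2)[OF pre[OF N]])
    have "C = pre N #>\<^bsub>H\<^esub> h \<and> h \<in> carrier H" "C = pre N #>\<^bsub>H\<^esub> h' \<and> h' \<in> carrier H"
      using H.rcoset_eqI[OF s h(3)] h(1,2) by blast+
    then have "h \<otimes>\<^bsub>H\<^esub> inv\<^bsub>H\<^esub> h' \<in> pre N" "h \<in> carrier H" "h' \<in> carrier H"
      using H.rcoset_eq_iff[OF s, of h h'] by auto
    then show ?thesis
      using G.rcoset_eq_iff[OF G.finite_index_normalD(2)[OF N], of "F (K N) h" "F (K N) h'"] by (simp add: pre_def)
  qed
  define d where "d N C = N #>\<^bsub>G\<^esub> F (K N) (SOME h. h \<in> C)" for N C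
  have d: "d N C = N #>\<^bsub>G\<^esub> F (K N) h"
    if "N \<in> finite_index_normal G" "C \<in> rcosets\<^bsub>H\<^esub> (pre N)" "h \<in> C" for N C h
    unfolding d_def using same[OF that(1) _ that(3,2)] someI[of "\<lambda>h. h \<in> C" h] that(3) by blast
  define \<Phi> where "\<Phi> x = (\<lambda>N\<in>finite_index_normal G. d N (x (pre N)))" for x
  have key: "\<Phi> x N = N #>\<^bsub>G\<^esub> F k h \<and> h \<in> carrier H"
    if x: "x \<in> carrier ?PH" and N: "N \<in> finite_index_normal G" and L: "L \<in> finite_index_normal H" "L \<subseteq> pre N"
      and h: "h \<in> x L" and k: "k \<ge> K N" for x N L h k
  proof -
    have "h \<in> carrier H" using H.profinite_completionD(3)[OF x L(1) h] by blast
    moreover have "h \<in> x (pre N)" using H.profinite_completionD(2)[OF x L(1) pre[OF N] L(2)] h by blast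
    ultimately show ?thesis using d[OF N H.profinite_completionD(1)[OF x pre[OF N]]] K[OF N k] N by (simp add: \<Phi>_def)
  qed
  have \<Phi>c: "\<Phi> x \<in> carrier ?PG" if x: "x \<in> carrier ?PH" for x
  proof -
    have "\<Phi> x N \<in> rcosets\<^bsub>G\<^esub> N" if N: "N \<in> finite_index_normal G" for N
    proof -
      obtain h where h: "h \<in> x (pre N)" using H.profinite_completionD(4)[OF x pre[OF N]] by blast
      show ?thesis using key[OF x N pre[OF N] order_refl h order_refl] Fc
        by (auto intro!: G.rcosetsI G.finite_index_normalD(3)[OF N])
    qed
    moreover have "\<Phi> x N \<subseteq> \<Phi> x M" if N: "N \<in> finite_index_normal G" and M: "M \<in> finite_index_normal G" and "N \<subseteq> M" for N M
    proof -
      \<comment> \<open>The maps stabilise at different stages modulo \<open>N\<close> and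
        \<open>M\<close>; a common later stage and a common smaller subgroup compare the two
        coordinates.\<close>
      let ?L = "pre N \<inter> pre M"
      have L: "?L \<in> finite_index_normal H" using pre N M by (intro H.finite_index_normal_Int)
      obtain h where h: "h \<in> x ?L" using H.profinite_completionD(4)[OF x L] by blast
      show ?thesis
        using key[OF x N L _ h, of "max (K N) (K M)"] key[OF x M L _ h, of "max (K N) (K M)"] \<open>N \<subseteq> M\<close>
        by (auto simp: r_coset_def)
    qed
    ultimately show ?thesis by (auto simp: profinite_completion_def \<Phi>_def)
  qed
  have "\<Phi> (x \<otimes>\<^bsub>?PH\<^esub> y) = \<Phi> x \<otimes>\<^bsub>?PG\<^esub> \<Phi> y" if x: "x \<in> carrier ?PH" and y: "y \<in> carrier ?PH" for x y
  proof (rule G.profinite_completion_eqI)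
    show "\<Phi> (x \<otimes>\<^bsub>?PH\<^esub> y) \<in> carrier ?PG" using \<Phi>c H.completion_mult_closed x y by blast
    show "\<Phi> x \<otimes>\<^bsub>?PG\<^esub> \<Phi> y \<in> carrier ?PG" using \<Phi>c G.completion_mult_closed x y by blast
    fix N assume N: "N \<in> finite_index_normal G"
    obtain h where h: "h \<in> x (pre N)" using H.profinite_completionD(4)[OF x pre[OF N]] by blast
    obtain h' where h': "h' \<in> y (pre N)" using H.profinite_completionD(4)[OF y pre[OF N]] by blast
    have "h \<otimes>\<^bsub>H\<^esub> h' \<in> (x \<otimes>\<^bsub>?PH\<^esub> y) (pre N)"
      using h h' by (auto simp: H.mult_completion_apply[OF pre[OF N]] set_mult_def)
    then have "\<Phi> (x \<otimes>\<^bsub>?PH\<^esub> y) N = N #>\<^bsub>G\<^esub> F (K N) (h \<otimes>\<^bsub>H\<^esub> h')"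
      using key[OF H.completion_mult_closed[OF x y] N pre[OF N] order_refl _ order_refl] by blast
    also have "\<dots> = \<Phi> x N <#>\<^bsub>G\<^esub> \<Phi> y N"
      using key[OF x N pre[OF N] order_refl h order_refl] key[OF y N pre[OF N] order_refl h' order_refl]
      by (simp add: Fm Fc G.rcosets_mult[OF N])
    finally show "\<Phi> (x \<otimes>\<^bsub>?PH\<^esub> y) N = (\<Phi> x \<otimes>\<^bsub>?PG\<^esub> \<Phi> y) N" by (simp add: G.mult_completion_apply[OF N])
  qed
  then have "\<Phi> \<in> hom ?PH ?PG" using \<Phi>c by (auto simp: hom_def)
  moreover have "continuous_map (profinite_topology H) (profinite_topology G) \<Phi>"
    unfolding profinite_topology_def[of G] continuous_map_in_subtopology continuous_map_componentwise
  proof (intro conjI ballI)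
    show "\<Phi> ` topspace (profinite_topology H) \<subseteq> extensional (finite_index_normal G)" by (auto simp: \<Phi>_def)
    show "\<Phi> \<in> topspace (profinite_topology H) \<rightarrow> carrier (profinite_completion G)"
      using \<Phi>c by (auto simp: H.topspace_profinite_topology)
    fix N assume N: "N \<in> finite_index_normal G"
    have "continuous_map (profinite_topology H) (discrete_topology (rcosets\<^bsub>G\<^esub> N)) (d N \<circ> (\<lambda>x. x (pre N)))"
    proof (rule continuous_map_compose[OF H.continuous_coordinate[OF pre[OF N]]])
      have "d N C \<in> rcosets\<^bsub>G\<^esub> N" if C: "C \<in> rcosets\<^bsub>H\<^esub> (pre N)" for C
      proof -
        obtain h where h: "h \<in> carrier H" "C = pre N #>\<^bsub>H\<^esub> h" using C by (auto simp: RCOSETS_def)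
        then have "h \<in> C" using H.rcos_self[OF _ H.finite_index_normalD(2)[OF pre[OF N]]] by blast
        then show ?thesis using d[OF N C] h Fc G.rcosetsI[OF G.finite_index_normalD(3)[OF N]] by simp
      qed
      then show "continuous_map (discrete_topology (rcosets\<^bsub>H\<^esub> pre N)) (discrete_topology (rcosets\<^bsub>G\<^esub> N)) (d N)"
        by (auto simp: continuous_map_from_discrete_topology)
    qed
    then show "continuous_map (profinite_topology H) (discrete_topology (rcosets\<^bsub>G\<^esub> N)) (\<lambda>x. \<Phi> x N)"
      using N by (simp add: \<Phi>_def o_def)
  qed
  moreover have "\<exists>M\<in>finite_index_normal H. \<exists>K. \<forall>k\<ge>K. \<forall>L\<in>finite_index_normal H.
       L \<subseteq> M \<longrightarrow> (\<forall>x\<in>carrier (profinite_completion H). \<forall>h\<in>x L. \<Phi> x N = N #>\<^bsub>G\<^esub> F k h)"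
    if N: "N \<in> finite_index_normal G" for N
    using pre[OF N] key[OF _ N] by blast
  ultimately show ?thesis using that by blast
qed

text \<open>The maps \<open>F k\<close> need not be invertible: it suffices that \<open>E k\<close>
  inverts \<open>F k\<close> on both sides modulo each finite-index normal subgroup from some stage
  on.\<close>

lemma isomorphic_completions_limit:
  assumes grp: "group H" "group G" and hom: "\<And>k::nat. F k \<in> hom H G" "\<And>k. E k \<in> hom G H"
    and convF: "\<And>N. N \<in> finite_index_normal G \<Longrightarrow>
      \<exists>K. \<forall>k\<ge>K. \<forall>h\<in>carrier H. N #>\<^bsub>G\<^esub> F k h = N #>\<^bsub>G\<^esub> F K h"
    and convE: "\<And>N. N \<in> finite_index_normal H \<Longrightarrow>
      \<exists>K. \<forall>k\<ge>K. \<forall>g\<in>carrier G. N #>\<^bsub>H\<^esub> E k g = N #>\<^bsub>H\<^esub> E K g"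
    and FE: "\<And>N. N \<in> finite_index_normal G \<Longrightarrow>
      \<exists>K. \<forall>k\<ge>K. \<forall>g\<in>carrier G. N #>\<^bsub>G\<^esub> F k (E k g) = N #>\<^bsub>G\<^esub> g"
    and EF: "\<And>N. N \<in> finite_index_normal H \<Longrightarrow>
      \<exists>K. \<forall>k\<ge>K. \<forall>h\<in>carrier H. N #>\<^bsub>H\<^esub> E k (F k h) = N #>\<^bsub>H\<^esub> h"
  shows "isomorphic_completions H G"
proof -
  \<comment> \<open>Stated for arbitrary groups, because it is used once in each direction.\<close>
  have inverse: "\<Psi> (\<Phi> x) = x"
    if grp: "group H" "group G"
      and F: "\<Phi> \<in> hom (profinite_completion H) (profinite_completion G)"
       "\<And>N. N \<in> finite_index_normal G \<Longrightarrow> \<exists>M\<in>finite_index_normal H. \<exists>K. \<forall>k\<ge>K. \<forall>L\<in>finite_index_normal H.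
       L \<subseteq> M \<longrightarrow> (\<forall>x\<in>carrier (profinite_completion H). \<forall>h\<in>x L. \<Phi> x N = N #>\<^bsub>G\<^esub> F k h)"
      and hom: "\<And>k::nat. F k \<in> hom H G"
      and E: "\<Psi> \<in> hom (profinite_completion G) (profinite_completion H)"
        "\<And>N. N \<in> finite_index_normal H \<Longrightarrow> \<exists>M\<in>finite_index_normal G. \<exists>K. \<forall>k\<ge>K. \<forall>L\<in>finite_index_normal G.
       L \<subseteq> M \<longrightarrow> (\<forall>x\<in>carrier (profinite_completion G). \<forall>h\<in>x L. \<Psi> x N = N #>\<^bsub>H\<^esub> E k h)"
      and EF: "\<And>N. N \<in> finite_index_normal H \<Longrightarrow>
        \<exists>K. \<forall>k\<ge>K. \<forall>h\<in>carrier H. N #>\<^bsub>H\<^esub> E k (F k h) = N #>\<^bsub>H\<^esub> h"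
      and x: "x \<in> carrier (profinite_completion H)"
    for H :: "('x, 'p) monoid_scheme" and G :: "('y, 'q) monoid_scheme" and F E \<Phi> \<Psi> x
  proof -
    interpret H: group H by fact
    interpret G: group G by fact
    have y: "\<Phi> x \<in> carrier (profinite_completion G)" using F(1) x by (auto simp: hom_def)
    show ?thesis
    proof (rule H.profinite_completion_eqI)
      show "\<Psi> (\<Phi> x) \<in> carrier (profinite_completion H)" using E(1) y by (auto simp: hom_def)
      fix M assume M: "M \<in> finite_index_normal H"
      obtain N K1 where N: "N \<in> finite_index_normal G"
        "\<And>k g. k \<ge> K1 \<Longrightarrow> g \<in> \<Phi> x N \<Longrightarrow> \<Psi> (\<Phi> x) M = M #>\<^bsub>H\<^esub> E k g"
        using E(2)[OF M] y by (meson order_refl)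
      obtain M' K2 where M': "M' \<in> finite_index_normal H"
        "\<And>k h L. k \<ge> K2 \<Longrightarrow> L \<in> finite_index_normal H \<Longrightarrow> L \<subseteq> M' \<Longrightarrow> h \<in> x L \<Longrightarrow> \<Phi> x N = N #>\<^bsub>G\<^esub> F k h"
        using F(2)[OF N(1)] x by metis
      obtain K3 where K3: "\<And>k h. k \<ge> K3 \<Longrightarrow> h \<in> carrier H \<Longrightarrow> M #>\<^bsub>H\<^esub> E k (F k h) = M #>\<^bsub>H\<^esub> h"
        using EF[OF M] by blast
      define k where "k = max K1 (max K2 K3)"
      have L: "M \<inter> M' \<in> finite_index_normal H" by (rule H.finite_index_normal_Int[OF M M'(1)])
      obtain h where h: "h \<in> x (M \<inter> M')" using H.profinite_completionD(4)[OF x L] by blast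
      have hc: "h \<in> carrier H" using H.profinite_completionD(3)[OF x L h] by blast
      have "F k h \<in> carrier G" using hom hc by (auto simp: hom_def)
      moreover have "\<Phi> x N = N #>\<^bsub>G\<^esub> F k h" using M'(2)[OF _ L _ h, of k] by (simp add: k_def)
      ultimately have "F k h \<in> \<Phi> x N" using G.rcos_self[OF _ G.finite_index_normalD(2)[OF N(1)]] by simp
      then have "\<Psi> (\<Phi> x) M = M #>\<^bsub>H\<^esub> E k (F k h)" using N(2)[of k] by (simp add: k_def)
      also have "\<dots> = M #>\<^bsub>H\<^esub> h" using K3[OF _ hc, of k] by (simp add: k_def)
      also have "\<dots> = x M"
        using H.profinite_completionD(3)[OF x M, of h] H.profinite_completionD(2)[OF x L M] h by auto
      finally show "\<Psi> (\<Phi> x) M = x M" .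
    qed (rule x)
  qed
  obtain \<Phi> where \<Phi>: "\<Phi> \<in> hom (profinite_completion H) (profinite_completion G)"
    "continuous_map (profinite_topology H) (profinite_topology G) \<Phi>"
    "\<And>N. N \<in> finite_index_normal G \<Longrightarrow> \<exists>M\<in>finite_index_normal H. \<exists>K. \<forall>k\<ge>K. \<forall>L\<in>finite_index_normal H.
       L \<subseteq> M \<longrightarrow> (\<forall>x\<in>carrier (profinite_completion H). \<forall>h\<in>x L. \<Phi> x N = N #>\<^bsub>G\<^esub> F k h)"
    using limit_of_homs[OF grp hom(1) convF] by metis
  obtain \<Psi> where \<Psi>: "\<Psi> \<in> hom (profinite_completion G) (profinite_completion H)"
    "continuous_map (profinite_topology G) (profinite_topology H) \<Psi>"
    "\<And>N. N \<in> finite_index_normal H \<Longrightarrow> \<exists>M\<in>finite_index_normal G. \<exists>K. \<forall>k\<ge>K. \<forall>L\<in>finite_index_normal G.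
       L \<subseteq> M \<longrightarrow> (\<forall>x\<in>carrier (profinite_completion G). \<forall>h\<in>x L. \<Psi> x N = N #>\<^bsub>H\<^esub> E k h)"
    using limit_of_homs[OF grp(2,1) hom(2) convE] by metis
  have inv1: "\<Psi> (\<Phi> x) = x" if "x \<in> carrier (profinite_completion H)" for x
    by (rule inverse[OF grp \<Phi>(1,3) hom(1) \<Psi>(1,3) EF that])
  have inv2: "\<Phi> (\<Psi> y) = y" if "y \<in> carrier (profinite_completion G)" for y
    by (rule inverse[OF grp(2,1) \<Psi>(1,3) hom(2) \<Phi>(1,3) FE that])
  have \<Phi>c: "\<Phi> x \<in> carrier (profinite_completion G)" if "x \<in> carrier (profinite_completion H)" for x
    using \<Phi>(1) that by (auto simp: hom_def)
  have \<Psi>c: "\<Psi> x \<in> carrier (profinite_completion H)" if "x \<in> carrier (profinite_completion G)" for x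
    using \<Psi>(1) that by (auto simp: hom_def)
  have "bij_betw \<Phi> (carrier (profinite_completion H)) (carrier (profinite_completion G))"
    by (rule bij_betw_byWitness[where f' = \<Psi>]) (use inv1 inv2 \<Phi>c \<Psi>c in auto)
  then have "\<Phi> \<in> iso (profinite_completion H) (profinite_completion G)" using \<Phi>(1) by (simp add: iso_def)
  moreover have "homeomorphic_maps (profinite_topology H) (profinite_topology G) \<Phi> \<Psi>"
    using \<Phi>(2) \<Psi>(2) inv1 inv2
    by (simp add: homeomorphic_maps_def group.topspace_profinite_topology grp)
  ultimately show ?thesis
    unfolding isomorphic_completions_def by (meson homeomorphic_maps_map)
qed

section \<open>Isomorphism of completions as an equivalence\<close>

lemma isomorphic_completions_if_iso:
  assumes "group H" "group G" "f \<in> iso H G"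
  shows "isomorphic_completions H G"
proof (rule isomorphic_completions_limit[of H G "\<lambda>_. f" "\<lambda>_. inv_into (carrier H) f"])
  have b: "bij_betw f (carrier H) (carrier G)" using assms(3) by (simp add: iso_def)
  show "f \<in> hom H G" using assms(3) by (simp add: iso_def)
  show "inv_into (carrier H) f \<in> hom G H" using group.iso_set_sym[OF assms(1,3)] by (simp add: iso_def)
  show "\<exists>K. \<forall>k\<ge>K. \<forall>g\<in>carrier G. N #>\<^bsub>G\<^esub> f (inv_into (carrier H) f g) = N #>\<^bsub>G\<^esub> g" for N
    using b by (auto simp: bij_betw_inv_into_right)
  show "\<exists>K. \<forall>k\<ge>K. \<forall>h\<in>carrier H. N #>\<^bsub>H\<^esub> inv_into (carrier H) f (f h) = N #>\<^bsub>H\<^esub> h" for N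
    using b by (auto simp: bij_betw_inv_into_left)
qed (use assms in auto)

lemma isomorphic_completions_trans:
  "isomorphic_completions G H \<Longrightarrow> isomorphic_completions H K \<Longrightarrow> isomorphic_completions G K"
  unfolding isomorphic_completions_def by (meson iso_set_trans homeomorphic_map_compose)

lemma isomorphic_completions_sym:
  assumes "group G" "group H" "isomorphic_completions G H"
  shows "isomorphic_completions H G"
proof -
  interpret G: group G by fact
  interpret H: group H by fact
  obtain f where f: "f \<in> iso (profinite_completion G) (profinite_completion H)"
    "homeomorphic_map (profinite_topology G) (profinite_topology H) f"
    using assms(3) by (auto simp: isomorphic_completions_def)
  obtain g where g: "homeomorphic_maps (profinite_topology G) (profinite_topology H) f g"
    using f(2) by (auto simp: homeomorphic_map_maps)
  have gc: "g y \<in> carrier (profinite_completion G)" "f (g y) = y" if "y \<in> carrier (profinite_completion H)" for y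
    using g that unfolding homeomorphic_maps_def continuous_map_def
    by (auto simp: G.topspace_profinite_topology H.topspace_profinite_topology)
  have gf: "g (f x) = x" if "x \<in> carrier (profinite_completion G)" for x
    using g that unfolding homeomorphic_maps_def by (auto simp: G.topspace_profinite_topology)
  have fc: "f x \<in> carrier (profinite_completion H)" if "x \<in> carrier (profinite_completion G)" for x
    using f(1) that by (auto simp: iso_def hom_def)
  have "g (x \<otimes>\<^bsub>profinite_completion H\<^esub> y) = g x \<otimes>\<^bsub>profinite_completion G\<^esub> g y"
    if "x \<in> carrier (profinite_completion H)" "y \<in> carrier (profinite_completion H)" for x y
  proof -
    have "f (g x \<otimes>\<^bsub>profinite_completion G\<^esub> g y) = x \<otimes>\<^bsub>profinite_completion H\<^esub> y"
      using f(1) gc that by (auto simp: iso_def hom_def)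
    then show ?thesis using gf[OF G.completion_mult_closed] gc that by metis
  qed
  moreover have "bij_betw g (carrier (profinite_completion H)) (carrier (profinite_completion G))"
    by (rule bij_betw_byWitness[where f' = f]) (use gc gf fc in auto)
  ultimately have "g \<in> iso (profinite_completion H) (profinite_completion G)"
    using gc by (auto simp: iso_def hom_def)
  moreover have "homeomorphic_map (profinite_topology H) (profinite_topology G) g"
    using g by (meson homeomorphic_maps_map homeomorphic_maps_sym)
  ultimately show ?thesis by (auto simp: isomorphic_completions_def)
qed

section \<open>Torsion-free abelian groups\<close>

context comm_group begin

definition lincomb :: "('i \<Rightarrow> 'a) \<Rightarrow> 'i set \<Rightarrow> ('i \<Rightarrow> int) \<Rightarrow> 'a"
  where "lincomb e I c = (\<Otimes>i\<in>I. e i [^] c i)"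

lemma lincomb_range: "lincomb e I c = x \<Longrightarrow> x \<in> range (lincomb e I)"
  by blast

lemma lincomb_closed: "e \<in> I \<rightarrow> carrier G \<Longrightarrow> lincomb e I c \<in> carrier G"
  unfolding lincomb_def by (rule finprod_closed) auto

lemma lincomb_cong: "e \<in> I \<rightarrow> carrier G \<Longrightarrow> (\<And>i. i \<in> I \<Longrightarrow> c i = d i) \<Longrightarrow> (\<And>i. i \<in> I \<Longrightarrow> f i = e i) \<Longrightarrow> lincomb e I c = lincomb f I d"
  unfolding lincomb_def by (rule finprod_cong') (auto simp: Pi_iff)

lemma lincomb_add:
  assumes e: "e \<in> I \<rightarrow> carrier G"
  shows "lincomb e I (\<lambda>i. c i + d i) = lincomb e I c \<otimes> lincomb e I d"
proof -
  have "lincomb e I (\<lambda>i. c i + d i) = (\<Otimes>i\<in>I. e i [^] c i \<otimes> e i [^] d i)"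
    unfolding lincomb_def by (rule finprod_cong') (use e in \<open>auto simp: int_pow_mult Pi_iff\<close>)
  also have "\<dots> = lincomb e I c \<otimes> lincomb e I d"
    unfolding lincomb_def by (rule finprod_multf) (use e in auto)
  finally show ?thesis .
qed

lemma lincomb_zero: "e \<in> I \<rightarrow> carrier G \<Longrightarrow> lincomb e I (\<lambda>i. 0) = \<one>"
  unfolding lincomb_def by (simp add: finprod_one_eqI)

lemma lincomb_uminus:
  assumes "e \<in> I \<rightarrow> carrier G"
  shows "lincomb e I (\<lambda>i. - c i) = inv (lincomb e I c)"
proof -
  have "lincomb e I (\<lambda>i. - c i) \<otimes> lincomb e I c = \<one>"
    using lincomb_add[OF assms, of "\<lambda>i. - c i" c] lincomb_zero[OF assms] by simp
  then show ?thesis using inv_equality lincomb_closed[OF assms] by metis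
qed

lemma lincomb_insert:
  "finite I \<Longrightarrow> i \<notin> I \<Longrightarrow> e \<in> insert i I \<rightarrow> carrier G \<Longrightarrow> lincomb e (insert i I) c = e i [^] c i \<otimes> lincomb e I c"
  unfolding lincomb_def by (rule finprod_insert) auto

lemma lincomb_single:
  assumes "finite I" "i \<in> I" "e \<in> I \<rightarrow> carrier G" "\<And>k. k \<in> I \<Longrightarrow> k \<noteq> i \<Longrightarrow> c k = 0"
  shows "lincomb e I c = e i [^] c i"
proof -
  have I: "insert i (I - {i}) = I" using assms(2) by auto
  have e: "e \<in> I - {i} \<rightarrow> carrier G" using assms(3) by auto
  have "lincomb e (I - {i}) c = \<one>"
    using lincomb_cong[OF e, of c "\<lambda>_. 0" e] lincomb_zero[OF e] assms(4) by auto
  then show ?thesis using lincomb_insert[of "I - {i}" i e c] assms(1,2,3) I by auto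
qed

text \<open>The elementary operation of the Euclidean algorithm: the generated subgroup stays the
  same, while the coefficient at \<open>i\<close> absorbs a multiple of the coefficient at
  \<open>j\<close>.\<close>

lemma lincomb_transvection:
  assumes "finite I" "i \<in> I" "j \<in> I" "i \<noteq> j" and e: "e \<in> I \<rightarrow> carrier G"
  shows "lincomb (e(j := e j \<otimes> e i [^] (a::int))) I c = lincomb e I (c(i := c i + a * c j))"
proof -
  let ?e' = "e(j := e j \<otimes> e i [^] a)" and ?c' = "c(i := c i + a * c j)"
  define R where "R = I - {i, j}"
  have I: "I = insert i (insert j R)" "i \<notin> insert j R" "j \<notin> R" "finite R" "finite (insert j R)"
    using assms by (auto simp: R_def)
  have ec: "e i \<in> carrier G" "e j \<in> carrier G" using assms(2,3) e by auto
  have e': "?e' \<in> insert i (insert j R) \<rightarrow> carrier G" "?e' \<in> insert j R \<rightarrow> carrier G" "e \<in> insert i (insert j R) \<rightarrow> carrier G"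
    "e \<in> insert j R \<rightarrow> carrier G" "e \<in> R \<rightarrow> carrier G" "?e' \<in> R \<rightarrow> carrier G"
    using e ec unfolding I(1) by auto
  have R: "lincomb ?e' R c = lincomb e R c" by (rule lincomb_cong[OF e'(6)]) (use I in auto)
  have R': "lincomb e R ?c' = lincomb e R c" by (rule lincomb_cong[OF e'(5)]) (use I in auto)
  have c: "lincomb e R c \<in> carrier G" by (rule lincomb_closed[OF e'(5)])
  have "lincomb ?e' I c = e i [^] c i \<otimes> ((e j \<otimes> e i [^] a) [^] c j \<otimes> lincomb e R c)"
    unfolding I(1) lincomb_insert[OF I(5,2) e'(1)] lincomb_insert[OF I(4,3) e'(2)] R using assms(4) by simp
  also have "(e j \<otimes> e i [^] a) [^] c j = e j [^] c j \<otimes> e i [^] (a * c j)"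
    using ec by (simp add: int_pow_distrib int_pow_pow)
  also have "e i [^] c i \<otimes> (e j [^] c j \<otimes> e i [^] (a * c j) \<otimes> lincomb e R c) =
      e i [^] (c i + a * c j) \<otimes> (e j [^] c j \<otimes> lincomb e R c)"
    using ec c by (simp add: int_pow_mult m_ac)
  also have "\<dots> = lincomb e I ?c'"
    unfolding I(1) lincomb_insert[OF I(5,2) e'(3)] lincomb_insert[OF I(4,3) e'(4)] R' using assms(4) by simp
  finally show ?thesis .
qed

text \<open>
  A nontrivial relation with two nonzero exponents can be shortened by a transvection of the
  generators, as in the Euclidean algorithm, until some generator is seen to be trivial.
\<close>
lemma relation_drops_generator:
  fixes c :: "'i \<Rightarrow> int"
  assumes I: "finite I" and tf: "\<And>x n. x \<in> carrier G \<Longrightarrow> (n::int) \<noteq> 0 \<Longrightarrow> x [^] n = \<one> \<Longrightarrow> x = \<one>"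
    and "e \<in> I \<rightarrow> carrier G" "carrier G = range (lincomb e I)" "lincomb e I c = \<one>" "i \<in> I" "c i \<noteq> 0"
  shows "\<exists>j\<in>I. \<exists>f. f \<in> I - {j} \<rightarrow> carrier G \<and> carrier G = range (lincomb f (I - {j}))"
  using assms(3-)
proof (induction "nat (\<Sum>k\<in>I. \<bar>c k\<bar>)" arbitrary: e c i rule: less_induct)
  case less
  show ?case
  proof (cases "\<forall>k\<in>I. k \<noteq> i \<longrightarrow> c k = 0")
    case True
    have ei: "e i \<in> carrier G" using less.prems by auto
    have "e i [^] c i = \<one>" using lincomb_single[OF I less.prems(4) less.prems(1), of c] True less.prems(3) by auto
    then have 1: "e i = \<one>" using tf[OF ei less.prems(5)] by simp
    have e: "e \<in> I - {i} \<rightarrow> carrier G" using less.prems(1) by auto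
    have "lincomb e I d = lincomb e (I - {i}) d" for d
      using lincomb_insert[of "I - {i}" i e d] I less.prems 1 lincomb_closed[OF e, of d] by (auto simp: insert_absorb)
    then have "lincomb e I = lincomb e (I - {i})" by blast
    then have "carrier G = range (lincomb e (I - {i}))" using less.prems(2) by metis
    then show ?thesis using less.prems(4) e by blast
  next
    case False
    then obtain k where k: "k \<in> I" "k \<noteq> i" "c k \<noteq> 0" by blast
    obtain p q where pq: "p \<in> I" "q \<in> I" "p \<noteq> q" "c q \<noteq> 0" "\<bar>c q\<bar> \<le> \<bar>c p\<bar>"
    proof (cases "\<bar>c k\<bar> \<le> \<bar>c i\<bar>")
      case True then show ?thesis using that[of i k] k less.prems by blast
    next
      case False then show ?thesis using that[of k i] k less.prems by auto
    qed
    \<comment> \<open>With this sign, subtracting \<open>a * c q\<close> lowers the absolute value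
      of \<open>c p\<close> by that of \<open>c q\<close>, so the induction measure drops.\<close>
    define a where "a = sgn (c p) * sgn (c q)"
    define c' where "c' = c(p := c p - a * c q)"
    let ?e = "e(q := e q \<otimes> e p [^] a)"
    have e: "?e \<in> I \<rightarrow> carrier G" using less.prems(1) pq by (auto simp: Pi_iff)
    have "lincomb ?e I c' = lincomb e I (c'(p := c' p + a * c' q))" by (rule lincomb_transvection[OF I pq(1-3) less.prems(1)])
    also have "c'(p := c' p + a * c' q) = c" using pq(3) by (auto simp: c'_def)
    also note less.prems(3)
    finally have r: "lincomb ?e I c' = \<one>" .
    have "lincomb e I d \<in> range (lincomb ?e I)" for d
    proof -
      have "lincomb ?e I (d(p := d p - a * d q)) = lincomb e I d"
        unfolding lincomb_transvection[OF I pq(1-3) less.prems(1)] using pq(3) by (intro arg_cong[of _ _ "lincomb e I"]) auto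
      then show ?thesis by (rule lincomb_range)
    qed
    moreover have "range (lincomb ?e I) \<subseteq> carrier G" using lincomb_closed[OF e] by auto
    ultimately have sp: "carrier G = range (lincomb ?e I)" unfolding less.prems(2) by blast
    have "\<bar>c' p\<bar> < \<bar>c p\<bar>"
    proof -
      have "a * c q = sgn (c p) * \<bar>c q\<bar>" by (simp add: a_def abs_sgn mult.assoc mult.commute)
      moreover have "c p = sgn (c p) * \<bar>c p\<bar>" by (simp add: sgn_mult_abs)
      ultimately have "c' p = sgn (c p) * (\<bar>c p\<bar> - \<bar>c q\<bar>)" 
        using pq(3) by (simp add: c'_def right_diff_distrib)
      then have "\<bar>c' p\<bar> = \<bar>sgn (c p)\<bar> * (\<bar>c p\<bar> - \<bar>c q\<bar>)" using pq(5) by (simp add: abs_mult)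
      moreover have "\<bar>sgn (c p)\<bar> = 1" using pq(4,5) by (auto simp: sgn_if)
      ultimately show ?thesis using pq(4) by simp
    qed
    moreover have "(\<Sum>k\<in>I - {p}. \<bar>c' k\<bar>) = (\<Sum>k\<in>I - {p}. \<bar>c k\<bar>)" by (rule sum.cong) (auto simp: c'_def)
    ultimately have "(\<Sum>k\<in>I. \<bar>c' k\<bar>) < (\<Sum>k\<in>I. \<bar>c k\<bar>)"
      unfolding sum.remove[OF I pq(1)] by simp
    moreover have "0 \<le> (\<Sum>k\<in>I. \<bar>c' k\<bar>)" by (simp add: sum_nonneg)
    ultimately have "nat (\<Sum>k\<in>I. \<bar>c' k\<bar>) < nat (\<Sum>k\<in>I. \<bar>c k\<bar>)" by linarith
    then show ?thesis
      by (rule less.hyps[OF _ e sp r pq(2)]) (use pq in \<open>simp add: c'_def\<close>)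
  qed
qed

lemma lincomb_span_generate:
  assumes F: "finite F" "F \<subseteq> carrier G"
  shows "generate G F = range (lincomb (\<lambda>x. x) F)"
proof
  have e: "(\<lambda>x. x) \<in> F \<rightarrow> carrier G" using F by auto
  show "generate G F \<subseteq> range (lincomb (\<lambda>x. x) F)"
  proof
    fix x assume "x \<in> generate G F"
    then show "x \<in> range (lincomb (\<lambda>x. x) F)"
    proof (induction rule: generate.induct)
      case one
      show ?case by (rule lincomb_range[OF lincomb_zero[OF e]])
    next
      case (incl h)
      have "lincomb (\<lambda>x. x) F (\<lambda>k. if k = h then 1 else 0) = h"
        using lincomb_single[OF F(1) incl e, of "\<lambda>k. if k = h then 1 else 0"] incl F by auto
      then show ?case by (rule lincomb_range)
    next
      case (inv h)
      have "lincomb (\<lambda>x. x) F (\<lambda>k. if k = h then - 1 else 0) = inv h"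
        using lincomb_single[OF F(1) inv e, of "\<lambda>k. if k = h then - 1 else 0"] inv F by (auto simp: int_pow_neg)
      then show ?case by (rule lincomb_range)
    next
      case (eng h1 h2)
      then obtain c d where "h1 = lincomb (\<lambda>x. x) F c" "h2 = lincomb (\<lambda>x. x) F d" by auto
      then have "h1 \<otimes> h2 = lincomb (\<lambda>x. x) F (\<lambda>i. c i + d i)" using lincomb_add[OF e] by simp
      then show ?case by (rule lincomb_range[OF sym])
    qed
  qed
  show "range (lincomb (\<lambda>x. x) F) \<subseteq> generate G F"
  proof
    fix x assume "x \<in> range (lincomb (\<lambda>x. x) F)"
    then obtain c where c: "x = lincomb (\<lambda>x. x) F c" by blast
    have s: "subgroup (generate G F) G" by (rule generate_is_subgroup[OF F(2)])
    have "lincomb (\<lambda>x. x) E c \<in> generate G F" if "finite E" "E \<subseteq> F" for E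
      using that
    proof (induction E rule: finite_induct)
      case empty
      show ?case by (simp add: lincomb_def generate.one)
    next
      case (insert y E)
      have "lincomb (\<lambda>x. x) (insert y E) c = y [^] c y \<otimes> lincomb (\<lambda>x. x) E c"
        by (rule lincomb_insert) (use insert F in auto)
      moreover have "y [^] c y \<in> generate G F"
        by (rule subgroup_int_pow_closed[OF s generate.incl]) (use insert in auto)
      ultimately show ?case using insert by (auto intro: generate.eng)
    qed
    then show "x \<in> generate G F" using c F(1) by blast
  qed
qed

text \<open>A generating family with a nontrivial relation can be replaced by one with a member
  fewer, so the process ends with a basis.\<close>

lemma torsion_free_basis:
  assumes tf: "\<And>x n. x \<in> carrier G \<Longrightarrow> (n::int) \<noteq> 0 \<Longrightarrow> x [^] n = \<one> \<Longrightarrow> x = \<one>"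
    and F: "finite F" "F \<subseteq> carrier G" "carrier G = generate G F"
  shows "\<exists>(I::'a set) e. finite I \<and> e \<in> I \<rightarrow> carrier G \<and> carrier G = range (lincomb e I) \<and>
      (\<forall>c. lincomb e I c = \<one> \<longrightarrow> (\<forall>i\<in>I. c i = 0))"
proof -
  have *: "\<exists>(J::'a set) e. finite J \<and> e \<in> J \<rightarrow> carrier G \<and> carrier G = range (lincomb e J) \<and>
      (\<forall>c. lincomb e J c = \<one> \<longrightarrow> (\<forall>i\<in>J. c i = 0))"
    if "finite I" "e \<in> I \<rightarrow> carrier G" "carrier G = range (lincomb e I)" for I :: "'a set" and e
    using that
  proof (induction "card I" arbitrary: I e rule: less_induct)
    case less
    show ?case
    proof (cases "\<forall>c. lincomb e I c = \<one> \<longrightarrow> (\<forall>i\<in>I. c i = 0)")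
      case True
      show ?thesis
        by (intro exI[of _ I] exI[of _ e] conjI less.prems True)
    next
      case False
      then obtain c i where c: "lincomb e I c = \<one>" "i \<in> I" "c i \<noteq> 0" by blast
      obtain j f where j: "j \<in> I" "f \<in> I - {j} \<rightarrow> carrier G" "carrier G = range (lincomb f (I - {j}))"
        by (rule bexE[OF relation_drops_generator[OF less.prems(1) _ less.prems(2,3) c]]) (use tf in blast)+
      have "card (I - {j}) < card I" by (rule card_Diff1_less[OF less.prems(1) j(1)])
      then show ?thesis by (rule less.hyps[OF _ finite_Diff[OF less.prems(1)] j(2,3)])
    qed
  qed
  have e: "(\<lambda>x. x) \<in> F \<rightarrow> carrier G" using F(2) by auto
  have sp: "carrier G = range (lincomb (\<lambda>x. x) F)" by (rule trans[OF F(3) lincomb_span_generate[OF F(1,2)]])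
  show ?thesis by (rule *[OF F(1) e sp])
qed

end

section \<open>Mapping tori\<close>

lemma vec2_eq: "(v::'a^2) = w \<longleftrightarrow> v$1 = w$1 \<and> v$2 = w$2"
  by (auto simp: vec_eq_iff forall_2)

lemma invertible_int_matrixI:
  fixes A :: "int^2^2"
  assumes "\<bar>det A\<bar> = 1"
  shows "invertible A"
proof -
  \<comment> \<open>The adjugate times the determinant, which is its own inverse here.\<close>
  let ?B = "vector [vector [det A * A$2$2, - det A * A$1$2], vector [- det A * A$2$1, det A * A$1$1]] :: int^2^2"
  have d: "det A * det A = 1" using assms by (auto simp: abs_if split: if_splits)
  have e: "A$1$1 * A$2$2 = det A + A$1$2 * A$2$1" by (simp add: det_2)
  have "A ** ?B = mat 1" "?B ** A = mat 1"
    using d by (simp_all add: vec_eq_iff forall_2 matrix_matrix_mult_def sum_2 vector_2 mat_def algebra_simps e)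
  then show ?thesis unfolding invertible_def by blast
qed

lemma smult_Suc: "(i + 1) *s w = i *s w + w" and smult_pred: "(i - 1) *s w = i *s w - w" for w :: "int^2"
  by (simp_all add: vec_eq_iff algebra_simps)

text \<open>The power of A used in \<open>mapping_torus_group\<close>, negative exponents included.
  It stays a map, because powers are formed in the automorphism group.\<close>

definition act :: "int^2^2 \<Rightarrow> int \<Rightarrow> int^2 \<Rightarrow> int^2"
  where "act A n v = ((\<lambda>v. A *v v) [^]\<^bsub>AutoGroup Z2_group\<^esub> n) v"

context
  fixes A :: "int^2^2"
  assumes inv: "invertible A"
begin

lemma act_in_AutoGroup: "act A n \<in> carrier (AutoGroup Z2_group)"
proof -
  have "(\<lambda>v. A *v v) [^]\<^bsub>AutoGroup Z2_group\<^esub> n \<in> carrier (AutoGroup Z2_group)"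
    by (rule group.int_pow_closed[OF group.AutoGroup[OF group_Z2_group] mult_vec_in_AutoGroup[OF inv]])
  then show ?thesis by (simp add: act_def[abs_def])
qed

lemma act_add_vec: "act A n (v + w) = act A n v + act A n w"
  using act_in_AutoGroup[of n] by (auto simp: AutoGroup_def auto_def hom_def Z2_group_def)

lemma act_0: "act A 0 v = v"
  by (simp add: act_def AutoGroup_def BijGroup_def Z2_group_def)

lemma act_1: "act A 1 v = A *v v"
  using group.int_pow_1[OF group.AutoGroup[OF group_Z2_group] mult_vec_in_AutoGroup[OF inv]]
  by (simp add: act_def)

lemma act_add: "act A (m + n) v = act A m (act A n v)"
proof -
  let ?G = "AutoGroup Z2_group"
  have c: "(\<lambda>v. A *v v) [^]\<^bsub>?G\<^esub> k \<in> carrier ?G" for k :: int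
    by (rule group.int_pow_closed[OF group.AutoGroup[OF group_Z2_group] mult_vec_in_AutoGroup[OF inv]])
  have "(\<lambda>v. A *v v) [^]\<^bsub>?G\<^esub> (m + n) = (\<lambda>v. A *v v) [^]\<^bsub>?G\<^esub> m \<otimes>\<^bsub>?G\<^esub> (\<lambda>v. A *v v) [^]\<^bsub>?G\<^esub> n"
    by (rule group.int_pow_mult[OF group.AutoGroup[OF group_Z2_group] mult_vec_in_AutoGroup[OF inv]])
  then show ?thesis using c[of m] c[of n]
    by (simp add: act_def AutoGroup_def BijGroup_def auto_def Z2_group_def compose_def)
qed

lemma act_zero_vec: "act A n 0 = 0"
  using act_add_vec[of n 0 0] by simp

lemma act_uminus_vec: "act A n (- v) = - act A n v"
  using act_add_vec[of n v "- v"] by (simp add: act_zero_vec eq_neg_iff_add_eq_0 add.commute)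

lemma act_inverse: "act A n (act A (- n) v) = v" "act A (- n) (act A n v) = v"
  using act_add[of n "- n" v] act_add[of "- n" n v] by (simp_all add: act_0)

lemma mapping_torus_simps:
  "carrier (mapping_torus_group A) = UNIV"
  "(v, m) \<otimes>\<^bsub>mapping_torus_group A\<^esub> (w, n) = (v + act A m w, m + n)"
  "\<one>\<^bsub>mapping_torus_group A\<^esub> = (0, 0)"
  by (simp_all add: mapping_torus_group_def semidirect_product_def Z2_group_def integer_group_def act_def)

interpretation G: group "mapping_torus_group A" by (rule group_mapping_torus_group[OF inv])

lemma mapping_torus_inv: "inv\<^bsub>mapping_torus_group A\<^esub> (v, m) = (- act A (- m) v, - m)"
  by (rule G.inv_equality) (simp_all add: mapping_torus_simps)

lemma mapping_torus_pow_vec: "(v, 0) [^]\<^bsub>mapping_torus_group A\<^esub> (k::int) = (k *s v, 0)"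
proof (induction k rule: int_induct[of _ 0])
  case base
  then show ?case by (simp add: mapping_torus_simps)
next
  case (step1 i)
  then show ?case by (simp add: G.int_pow_mult mapping_torus_simps act_0 smult_Suc)
next
  case (step2 i)
  then show ?case by (simp add: smult_pred G.int_pow_diff mapping_torus_simps mapping_torus_inv act_0)
qed

lemma mapping_torus_pow_snd: "snd (g [^]\<^bsub>mapping_torus_group A\<^esub> (k::int)) = k * snd g"
proof (induction k rule: int_induct[of _ 0])
  case base
  then show ?case by (simp add: mapping_torus_simps)
next
  case (step1 i)
  then show ?case
    by (cases g; cases "g [^]\<^bsub>mapping_torus_group A\<^esub> i") (simp add: G.int_pow_mult mapping_torus_simps algebra_simps)
next
  case (step2 i)
  then show ?case
    by (cases g; cases "g [^]\<^bsub>mapping_torus_group A\<^esub> i")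
      (simp add: G.int_pow_diff mapping_torus_simps mapping_torus_inv algebra_simps)
qed

lemma mapping_torus_pow_t: "(0, 1) [^]\<^bsub>mapping_torus_group A\<^esub> (k::int) = (0, k)"
proof (induction k rule: int_induct[of _ 0])
  case base
  then show ?case by (simp add: mapping_torus_simps)
next
  case (step1 i)
  then show ?case by (simp add: G.int_pow_mult mapping_torus_simps act_zero_vec)
next
  case (step2 i)
  then show ?case by (simp add: G.int_pow_diff mapping_torus_simps mapping_torus_inv act_zero_vec)
qed

lemma mapping_torus_conj:
  "(w, m) \<otimes>\<^bsub>mapping_torus_group A\<^esub> (v, 0) \<otimes>\<^bsub>mapping_torus_group A\<^esub> inv\<^bsub>mapping_torus_group A\<^esub> (w, m) = (act A m v, 0)"
  by (simp add: mapping_torus_simps mapping_torus_inv act_uminus_vec act_inverse act_add_vec act_0)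

lemma mapping_torus_ext: "G.inf_cyclic_ext (range (\<lambda>v. (v, 0))) (0, 1) UNIV"
proof -
  have "subgroup (range (\<lambda>v. (v, 0))) (mapping_torus_group A)"
    by (rule G.subgroupI) (auto simp: mapping_torus_simps mapping_torus_inv)
  moreover have "G.normalizes UNIV (range (\<lambda>v. (v, 0)))"
    by (auto simp: G.normalizes_def mapping_torus_conj)
  moreover have "subgroup UNIV (mapping_torus_group A)" using G.subgroup_self by (simp add: mapping_torus_simps)
  moreover have "(v, m) = (v, 0) \<otimes>\<^bsub>mapping_torus_group A\<^esub> (0, m)" for v m by (simp add: mapping_torus_simps act_0)
  then have "\<forall>g\<in>UNIV. \<exists>n\<in>range (\<lambda>v. (v, 0)). \<exists>i. g = n \<otimes>\<^bsub>mapping_torus_group A\<^esub> (0, i)" by fast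
  moreover have "\<forall>i::int. (0, i) \<in> range (\<lambda>v::int^2. (v, 0)) \<longrightarrow> i = 0" by auto
  ultimately show ?thesis unfolding G.inf_cyclic_ext_def mapping_torus_pow_t by simp
qed

lemma subgroup_mapping_torus_line: "subgroup {(v, 0 :: int) | v. v $ 2 = 0} (mapping_torus_group A)"
proof -
  have "\<exists>a::int^2. a $ 2 = 0" by (rule exI[of _ 0]) simp
  then show ?thesis by (intro G.subgroupI) (auto simp: mapping_torus_simps mapping_torus_inv act_0)
qed

text \<open>Coordinate lines give the series 1 < Z e1 < Z^2 with infinite cyclic steps. Each term is
  normal in the next one only: the line Z e1 may fail to be invariant under A.\<close>

lemma mapping_torus_chain:
  "G.inf_cyclic_ext {\<one>\<^bsub>mapping_torus_group A\<^esub>} (axis 1 1, 0) {(v, 0) | v. v $ 2 = 0}"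
  "G.inf_cyclic_ext {(v, 0) | v. v $ 2 = 0} (axis 2 1, 0) (range (\<lambda>v. (v, 0)))"
proof -
  have s: "subgroup (range (\<lambda>v. (v, 0))) (mapping_torus_group A)"
    using G.inf_cyclic_extD(1)[OF mapping_torus_ext] .
  have "\<exists>k. (v, 0 :: int) = (k *s axis 1 1, 0)" if "v $ 2 = 0" for v :: "int^2"
    using that by (intro exI[of _ "v $ 1"]) (simp add: vec2_eq axis_def)
  then have 1: "\<forall>g\<in>{(v, 0) | v. v $ 2 = 0}. \<exists>n\<in>{\<one>\<^bsub>mapping_torus_group A\<^esub>}.
      \<exists>i. g = n \<otimes>\<^bsub>mapping_torus_group A\<^esub> (i *s axis 1 1, 0)"
    by (auto simp: mapping_torus_simps act_0)
  have 2: "G.normalizes {(v, 0) | v. v $ 2 = 0} {\<one>\<^bsub>mapping_torus_group A\<^esub>}"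
    by (auto simp: G.normalizes_def mapping_torus_simps mapping_torus_inv act_0 act_zero_vec)
  have 3: "\<forall>i. (i *s axis 1 1, 0) \<in> {\<one>\<^bsub>mapping_torus_group A\<^esub>} \<longrightarrow> i = 0"
    by (auto simp: mapping_torus_simps vec2_eq axis_def)
  show "G.inf_cyclic_ext {\<one>\<^bsub>mapping_torus_group A\<^esub>} (axis 1 1, 0) {(v, 0) | v. v $ 2 = 0}"
    unfolding G.inf_cyclic_ext_def mapping_torus_pow_vec
    using G.triv_subgroup subgroup_mapping_torus_line 1 2 3 by (simp add: mapping_torus_simps axis_def)
  have 1: "\<forall>g\<in>range (\<lambda>v. (v, 0)). \<exists>n\<in>{(v, 0) | v. v $ 2 = 0}.
      \<exists>i. g = n \<otimes>\<^bsub>mapping_torus_group A\<^esub> (i *s axis 2 1, 0)"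
  proof
    fix g :: "(int^2) \<times> int" assume "g \<in> range (\<lambda>v. (v, 0))"
    then obtain v where v: "g = (v, 0)" by blast
    have "v = v $ 1 *s axis 1 1 + v $ 2 *s axis 2 1" by (simp add: vec2_eq axis_def)
    then have "g = (v $ 1 *s axis 1 1, 0) \<otimes>\<^bsub>mapping_torus_group A\<^esub> (v $ 2 *s axis 2 1, 0)"
      using v by (simp add: mapping_torus_simps act_0)
    moreover have "(v $ 1 *s axis 1 1 :: int^2, 0 :: int) \<in> {(v, 0) | v. v $ 2 = 0}" by (simp add: axis_def)
    ultimately show "\<exists>n\<in>{(v, 0) | v. v $ 2 = 0}. \<exists>i. g = n \<otimes>\<^bsub>mapping_torus_group A\<^esub> (i *s axis 2 1, 0)" by blast
  qed
  have 2: "G.normalizes (range (\<lambda>v. (v, 0))) {(v, 0) | v. v $ 2 = 0}"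
    by (auto simp: G.normalizes_def mapping_torus_conj act_0)
  have 3: "\<forall>i. (i *s axis 2 1, 0 :: int) \<in> {(v, 0) | v :: int^2. v $ 2 = 0} \<longrightarrow> i = 0"
    by (auto simp: axis_def)
  have 4: "{(v, 0 :: int) | v :: int^2. v $ 2 = 0} \<subseteq> range (\<lambda>v. (v, 0))" by auto
  show "G.inf_cyclic_ext {(v, 0) | v. v $ 2 = 0} (axis 2 1, 0) (range (\<lambda>v. (v, 0)))"
    unfolding G.inf_cyclic_ext_def mapping_torus_pow_vec
    by (intro conjI s subgroup_mapping_torus_line 1 2 3 4) simp
qed

lemma poly_cyc_fin_mapping_torus: "G.poly_cyc_fin (carrier (mapping_torus_group A))"
  using G.poly_cyc_fin.cyc[OF G.poly_cyc_fin.cyc[OF G.poly_cyc_fin.cyc[OF G.poly_cyc_fin.base mapping_torus_chain(1)] mapping_torus_chain(2)] mapping_torus_ext]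
  by (simp add: mapping_torus_simps)

end

lemma inf_cyclic_ext_iso:
  assumes "group G" "group K" and f: "f \<in> iso G K" and ext: "group.inf_cyclic_ext G N x M"
  shows "group.inf_cyclic_ext K (f ` N) (f x) (f ` M)"
proof -
  interpret G: group G by fact
  interpret K: group K by fact
  interpret f: group_hom G K f using f by (simp add: group_hom_def group_hom_axioms_def iso_def assms)
  have inj: "inj_on f (carrier G)" using f by (simp add: iso_def bij_betw_def)
  note E = G.inf_cyclic_extD[OF ext]
  have pow: "f x [^]\<^bsub>K\<^esub> (i::int) = f (x [^]\<^bsub>G\<^esub> i)" for i using f.hom_int_pow[OF E(8)] by simp
  have "subgroup (f ` N) K" "subgroup (f ` M) K" using E(1,2) f.subgroup_img_is_subgroup by auto
  moreover have "f ` N \<subseteq> f ` M" "f x \<in> f ` M" using E(3,5) by auto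
  moreover have "K.normalizes (f ` M) (f ` N)"
    unfolding K.normalizes_def
  proof (intro ballI)
    fix g n assume "g \<in> f ` M" "n \<in> f ` N"
    then obtain g' n' where gn: "g' \<in> M" "g = f g'" "n' \<in> N" "n = f n'" by blast
    have c: "g' \<in> carrier G" "n' \<in> carrier G" using gn E(6,7) by auto
    have "g' \<otimes>\<^bsub>G\<^esub> n' \<otimes>\<^bsub>G\<^esub> inv\<^bsub>G\<^esub> g' \<in> N" using E(4) gn by (simp add: G.normalizes_def)
    then have "f (g' \<otimes>\<^bsub>G\<^esub> n' \<otimes>\<^bsub>G\<^esub> inv\<^bsub>G\<^esub> g') \<in> f ` N" by (rule imageI)
    then show "g \<otimes>\<^bsub>K\<^esub> n \<otimes>\<^bsub>K\<^esub> inv\<^bsub>K\<^esub> g \<in> f ` N" using gn(2,4) c by simp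
  qed
  moreover have "\<forall>g\<in>f ` M. \<exists>n\<in>f ` N. \<exists>i::int. g = n \<otimes>\<^bsub>K\<^esub> f x [^]\<^bsub>K\<^esub> i"
  proof
    fix g assume "g \<in> f ` M"
    then obtain g' where g: "g' \<in> M" "g = f g'" by blast
    obtain n i where n: "n \<in> N" "g' = n \<otimes>\<^bsub>G\<^esub> x [^]\<^bsub>G\<^esub> (i::int)" using G.inf_cyclic_ext_decomp[OF ext g(1)] by blast
    have "n \<in> carrier G" using n(1) E(6) by blast
    then have "g = f n \<otimes>\<^bsub>K\<^esub> f x [^]\<^bsub>K\<^esub> i" using g(2) n(2) E(8) by (simp add: pow)
    then show "\<exists>n\<in>f ` N. \<exists>i::int. g = n \<otimes>\<^bsub>K\<^esub> f x [^]\<^bsub>K\<^esub> i" using n(1) by blast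
  qed
  moreover have "\<forall>i::int. f x [^]\<^bsub>K\<^esub> i \<in> f ` N \<longrightarrow> i = 0"
  proof (intro allI impI)
    fix i :: int assume "f x [^]\<^bsub>K\<^esub> i \<in> f ` N"
    then obtain n where n: "n \<in> N" "f (x [^]\<^bsub>G\<^esub> i) = f n" unfolding pow by blast
    have "x [^]\<^bsub>G\<^esub> i = n" by (rule inj_onD[OF inj n(2)]) (use E(6,8) n(1) in auto)
    then show "i = 0" using ext n(1) unfolding G.inf_cyclic_ext_def by blast
  qed
  ultimately show ?thesis unfolding K.inf_cyclic_ext_def by simp
qed

lemma (in group) inf_cyclic_ext_normal_cyclic:
  assumes ext: "inf_cyclic_ext N x M"
  shows "N \<lhd> G\<lparr>carrier := M\<rparr>" "cyclic_group (G\<lparr>carrier := M\<rparr> Mod N)"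
proof -
  let ?M = "G\<lparr>carrier := M\<rparr>"
  note E = inf_cyclic_extD[OF ext]
  interpret M: group ?M by (rule subgroup_imp_group[OF E(2)])
  have "subgroup N ?M" by (rule subgroup_incl[OF E(1,2,3)])
  then show N: "N \<lhd> ?M"
    using E(4) m_inv_consistent[OF E(2)] by (simp add: M.normal_inv_iff normalizes_def)
  interpret N: normal N ?M by (rule N)
  have xM: "x \<in> carrier ?M" using E(5) by simp
  have "\<exists>i::int. C = (N #>\<^bsub>?M\<^esub> x) [^]\<^bsub>?M Mod N\<^esub> i" if "C \<in> carrier (?M Mod N)" for C
  proof -
    obtain g where g: "g \<in> M" "C = N #>\<^bsub>?M\<^esub> g" using \<open>C \<in> carrier (?M Mod N)\<close> by (auto simp: carrier_FactGroup)
    obtain n i where n: "n \<in> N" "g = n \<otimes> x [^] (i::int)" by (rule inf_cyclic_ext_decomp[OF ext g(1)])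
    have "g \<in> N #>\<^bsub>?M\<^esub> (x [^] i)" using n by (auto simp: r_coset_def)
    then have "N #>\<^bsub>?M\<^esub> (x [^] i) = N #>\<^bsub>?M\<^esub> g"
      by (rule M.repr_independence) (use E(9) N.subgroup_axioms in simp_all)
    also have "x [^] i = x [^]\<^bsub>?M\<^esub> i" using int_pow_consistent[OF E(2,5)] by simp
    finally show ?thesis using g(2) N.FactGroup_int_pow[OF xM, of i] by auto
  qed
  moreover have X: "N #>\<^bsub>?M\<^esub> x \<in> carrier (?M Mod N)" using E(5) by (auto simp: carrier_FactGroup)
  moreover have "(N #>\<^bsub>?M\<^esub> x) [^]\<^bsub>?M Mod N\<^esub> (i::int) \<in> carrier (?M Mod N)" for i
    by (rule group.int_pow_closed[OF N.factorgroup_is_group X])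
  ultimately show "cyclic_group (?M Mod N)"
    unfolding group.cyclic_group[OF N.factorgroup_is_group] by (intro bexI[OF _ X]) blast
qed

text \<open>The series 1 < Z e1 < Z^2 < G is carried along \<open>f\<close>. The target is arbitrary
  so that copies on the natural numbers are covered.\<close>

lemma polycyclic_by_finite_if_iso_mapping_torus:
  assumes A: "invertible A" and K: "group K" and f: "f \<in> iso (mapping_torus_group A) K"
  shows "polycyclic_by_finite K"
proof -
  interpret G: group "mapping_torus_group A" by (rule group_mapping_torus_group[OF A])
  interpret K: group K by fact
  interpret f: group_hom "mapping_torus_group A" K f
    using f by (simp add: group_hom_def group_hom_axioms_def iso_def G.group_axioms K)
  have surj: "f ` UNIV = carrier K" using f by (simp add: iso_def bij_betw_def mapping_torus_simps[OF A])
  define H :: "nat \<Rightarrow> _" where "H i = f ` (if i = 0 then {\<one>\<^bsub>mapping_torus_group A\<^esub>} else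
    if i = 1 then {(v, 0) | v. v $ 2 = 0} else if i = 2 then range (\<lambda>v. (v, 0)) else UNIV)" for i
  have "\<exists>x. K.inf_cyclic_ext (H i) x (H (Suc i))" if i: "i < 3" for i
  proof -
    consider "i = 0" | "i = 1" | "i = 2" using i by linarith
    then show ?thesis
    proof cases
      case 1
      then show ?thesis using inf_cyclic_ext_iso[OF G.group_axioms K f mapping_torus_chain(1)[OF A]]
        by (auto simp: H_def)
    next
      case 2
      then show ?thesis using inf_cyclic_ext_iso[OF G.group_axioms K f mapping_torus_chain(2)[OF A]]
        by (auto simp: H_def)
    next
      case 3
      then show ?thesis using inf_cyclic_ext_iso[OF G.group_axioms K f mapping_torus_ext[OF A]]
        by (auto simp: H_def)
    qed
  qed
  then have "\<forall>i<3. subgroup (H (Suc i)) K \<and> H i \<lhd> K\<lparr>carrier := H (Suc i)\<rparr> \<and>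
      cyclic_group (K\<lparr>carrier := H (Suc i)\<rparr> Mod H i)"
    using K.inf_cyclic_extD(2) K.inf_cyclic_ext_normal_cyclic by metis
  moreover have "H 0 = {\<one>\<^bsub>K\<^esub>}" "H 3 = carrier K" using surj by (simp_all add: H_def)
  ultimately have "polycyclic K" unfolding polycyclic_def using K by blast
  then show ?thesis
    unfolding polycyclic_by_finite_def using K K.finite_index_normal_carrier by (intro conjI bexI[of _ "carrier K"]) simp_all
qed

text \<open>Since det A = -1, the matrix A - 1 has determinant -t with t the trace of A. So minus
  its adjugate sends \<open>v\<close> to a vector \<open>w\<close> with (A - 1) w = t v, and the
  left side is the commutator of the generator with \<open>w\<close>.\<close>

lemma fibre_trace:
  fixes A :: "int^2^2"
  assumes "det A = -1"
  shows "\<exists>w. A *v w - w = trace A *s v"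
proof -
  define w :: "int^2" where "w = (\<chi> i. if i = 1 then (1 - A$2$2) * v$1 + A$1$2 * v$2 else A$2$1 * v$1 + (1 - A$1$1) * v$2)"
  have d: "A$1$1 * A$2$2 = A$1$2 * A$2$1 - 1" using assms by (simp add: det_2)
  have "A *v w - w = trace A *s v"
    by (simp add: vec2_eq matrix_vector_mult_def sum_2 w_def trace_def algebra_simps d)
  then show ?thesis by blast
qed

section \<open>Groups with the completion of a mapping torus\<close>

context group begin

text \<open>In an abelian group the n-th powers already form a subgroup.\<close>

lemma power_sub_powers:
  assumes N: "subgroup N G" and comm: "\<And>a b. a \<in> N \<Longrightarrow> b \<in> N \<Longrightarrow> a \<otimes> b = b \<otimes> a" and y: "y \<in> power_sub n N"
  shows "\<exists>z\<in>N. y = z [^] n"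
proof -
  note Nc = subgroup.mem_carrier[OF N]
  have "subgroup ((\<lambda>z. z [^] n) ` N) G"
  proof (rule subgroupI)
    show "(\<lambda>z. z [^] n) ` N \<subseteq> carrier G" using Nc by auto
    show "(\<lambda>z. z [^] n) ` N \<noteq> {}" using subgroup.one_closed[OF N] by auto
    fix a assume "a \<in> (\<lambda>z. z [^] n) ` N"
    then obtain a' where a: "a' \<in> N" "a = a' [^] n" by blast
    have "inv a = (inv a') [^] n" using a Nc by (simp add: nat_pow_inv)
    then show "inv a \<in> (\<lambda>z. z [^] n) ` N" using subgroup.m_inv_closed[OF N a(1)] by blast
    fix b assume "b \<in> (\<lambda>z. z [^] n) ` N"
    then obtain b' where b: "b' \<in> N" "b = b' [^] n" by blast
    have "a \<otimes> b = (a' \<otimes> b') [^] n" using a b Nc comm by (simp add: pow_mult_distrib)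
    then show "a \<otimes> b \<in> (\<lambda>z. z [^] n) ` N" using subgroup.m_closed[OF N a(1) b(1)] by blast
  qed
  then have "power_sub n N \<subseteq> (\<lambda>z. z [^] n) ` N" by (intro power_sub_subset) auto
  then show ?thesis using y by auto
qed

text \<open>The subgroup \<open>ext_sub (power_sub n N) x d\<close> has finite index but may fail to
  be normal. It contains a power subgroup of the whole group, which is normal, and \<open>U\<close>
  is intersected with that one.\<close>

lemma separating_normal:
  assumes ext: "inf_cyclic_ext N x (carrier G)" and fi: "fin_index (power_sub n N) N"
    and poly_cyc_fin: "poly_cyc_fin (carrier G)" and U: "U \<in> finite_index_normal G" and d: "d > 0"
  obtains V where "V \<in> finite_index_normal G" "V \<subseteq> U"
    "\<And>y i. y \<in> N \<Longrightarrow> y \<otimes> x [^] (i::int) \<in> V \<Longrightarrow> y \<in> power_sub n N \<and> d dvd i"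
proof -
  note S = ext_sub_power_sub[OF ext fi d]
  obtain j where j: "j > 0" "power_sub j (carrier G) \<subseteq> ext_sub (power_sub n N) x d"
    by (rule fin_index_power_sub_subset[OF S subgroup_self])
  have "U \<inter> power_sub j (carrier G) \<in> finite_index_normal G"
    by (rule finite_index_normal_Int[OF U poly_cyc_fin_finite_index_normal_power_sub[OF poly_cyc_fin j(1)]])
  moreover have "y \<in> power_sub n N \<and> d dvd i" if "y \<in> N" "y \<otimes> x [^] i \<in> U \<inter> power_sub j (carrier G)" for y and i :: int
  proof -
    have "y \<otimes> x [^] i \<in> ext_sub (power_sub n N) x d" using that j(2) by blast
    then show ?thesis
      using mem_ext_sub_iff[OF ext that(1) power_sub_self[OF inf_cyclic_extD(1)[OF ext]]] by simp
  qed
  ultimately show ?thesis using that by blast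
qed

lemma finite_index_normal_exponent:
  assumes "U \<in> finite_index_normal G"
  obtains m :: nat where "m > 0" "\<And>g. g \<in> carrier G \<Longrightarrow> g [^] m \<in> U"
proof -
  have U: "subgroup U G" "fin_index U (carrier G)" using assms by (simp_all add: finite_index_normal_iff)
  obtain m where m: "m > 0" "power_sub m (carrier G) \<subseteq> U" by (rule fin_index_power_sub_subset[OF U subgroup_self])
  then show ?thesis using that power_sub_pow by blast
qed

end

section \<open>Calculus of the approximation relation\<close>

context completion_relation begin

lemma rel_shift:
  assumes "rel U h g" "g' \<in> carrier G" "g \<otimes>\<^bsub>G\<^esub> inv\<^bsub>G\<^esub> g' \<in> U"
  shows "rel U h g'"
proof -
  have c: "g \<in> carrier G" "h \<in> carrier H" and U: "U \<in> finite_index_normal G" using rel_carrier assms by blast+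
  have "inv\<^bsub>G\<^esub> (g \<otimes>\<^bsub>G\<^esub> inv\<^bsub>G\<^esub> g') \<in> U"
    using subgroup.m_inv_closed[OF G.finite_index_normalD(2)[OF U] assms(3)] .
  then have "rel U \<one>\<^bsub>H\<^esub> (g' \<otimes>\<^bsub>G\<^esub> inv\<^bsub>G\<^esub> g)" using rel_one[OF U] c assms(2) by (simp add: G.inv_mult_group)
  from rel_mult[OF this assms(1)] show ?thesis using c assms(2) by (simp add: G.m_assoc)
qed

lemma rel_1: "U \<in> finite_index_normal G \<Longrightarrow> rel U \<one>\<^bsub>H\<^esub> \<one>\<^bsub>G\<^esub>"
  using rel_one subgroup.one_closed[OF G.finite_index_normalD(2)] by blast

lemma rel_inv:
  assumes "rel U h g"
  shows "rel U (inv\<^bsub>H\<^esub> h) (inv\<^bsub>G\<^esub> g)"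
proof -
  have c: "g \<in> carrier G" "h \<in> carrier H" and U: "U \<in> finite_index_normal G" using rel_carrier assms by blast+
  obtain g' where g': "rel U (inv\<^bsub>H\<^esub> h) g'" using rel_left[OF U] c by blast
  have gc: "g' \<in> carrier G" using rel_carrier[OF g'] by blast
  have "rel U \<one>\<^bsub>H\<^esub> (g' \<otimes>\<^bsub>G\<^esub> g)" using rel_mult[OF g' assms] c by simp
  from rel_coset[OF this rel_1[OF U]] have "g' \<otimes>\<^bsub>G\<^esub> g \<in> U" using c gc by simp
  then show ?thesis using rel_shift[OF g', of "inv\<^bsub>G\<^esub> g"] c by simp
qed

lemma rel_pow:
  assumes "rel U h g"
  shows "rel U (h [^]\<^bsub>H\<^esub> (i::int)) (g [^]\<^bsub>G\<^esub> i)"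
proof -
  have c: "g \<in> carrier G" "h \<in> carrier H" and U: "U \<in> finite_index_normal G" using rel_carrier assms by blast+
  have n: "rel U (h [^]\<^bsub>H\<^esub> (n::nat)) (g [^]\<^bsub>G\<^esub> n)" for n
    by (induction n) (use rel_1[OF U] rel_mult[OF _ assms] in auto)
  show ?thesis
  proof (cases i rule: int_cases2)
    case (nonneg n)
    then show ?thesis using n[of n] by (simp add: int_pow_int)
  next
    case (nonpos n)
    then show ?thesis using rel_inv[OF n[of n]] c by (simp add: H.int_pow_neg_int G.int_pow_neg_int)
  qed
qed

lemma rel_one_iff:
  assumes "U \<in> finite_index_normal G" "rel U h g"
  shows "rel U h \<one>\<^bsub>G\<^esub> \<longleftrightarrow> g \<in> U"
  using rel_shift[OF assms(2) G.one_closed] rel_coset[OF assms(2), of "\<one>\<^bsub>G\<^esub>"] rel_carrier[OF assms(2)] by auto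

text \<open>By residual finiteness a nontrivial \<open>h\<close> survives modulo some power subgroup
  of \<open>H\<close>, and \<open>rel_kernel\<close> detects this in a finite quotient of
  \<open>G\<close>.\<close>

lemma trivial_if_rel_one:
  assumes "H.poly_cyc_fin (carrier H)" "h \<in> carrier H" "\<And>U. U \<in> finite_index_normal G \<Longrightarrow> rel U h \<one>\<^bsub>G\<^esub>"
  shows "h = \<one>\<^bsub>H\<^esub>"
proof (rule ccontr)
  assume "h \<noteq> \<one>\<^bsub>H\<^esub>"
  then obtain m where m: "m > 0" "h \<notin> H.power_sub m (carrier H)" using H.poly_cyc_fin_residually_finite[OF assms(1,2)] by blast
  obtain U where "U \<in> finite_index_normal G" "\<And>h. rel U h \<one>\<^bsub>G\<^esub> \<Longrightarrow> h \<in> H.power_sub m (carrier H)"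
    using rel_kernel[OF H.poly_cyc_fin_finite_index_normal_power_sub[OF assms(1) m(1)]] by blast
  then show False using assms(3) m(2) by blast
qed

end

section \<open>The closure of the fibre\<close>

locale torus_relation =
  fixes H :: "'h monoid" (structure) and A :: "int^2^2" and rel
  assumes rel: "completion_relation H (mapping_torus_group A) rel"
    and inv_A: "invertible A" and det_A: "det A = -1" and trace_A: "trace A \<noteq> 0"
    and poly_cyc_fin_H: "group.poly_cyc_fin H (carrier H)"
begin

abbreviation "G \<equiv> mapping_torus_group A"
abbreviation "FIN \<equiv> finite_index_normal G"

sublocale completion_relation H "mapping_torus_group A" rel by (rule rel)

lemmas Gs [simp] = mapping_torus_simps[OF inv_A]
lemmas Ginv [simp] = mapping_torus_inv[OF inv_A]
lemmas Gpow_vec [simp] = mapping_torus_pow_vec[OF inv_A]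
lemmas Gpow_t [simp] = mapping_torus_pow_t[OF inv_A]
lemmas Gpow_snd [simp] = mapping_torus_pow_snd[OF inv_A]
lemmas act0 [simp] = act_0[OF inv_A] and act1 = act_1[OF inv_A] and act_zero [simp] = act_zero_vec[OF inv_A]

lemma snd_mult [simp]: "snd (g \<otimes>\<^bsub>G\<^esub> h) = snd g + snd h"
  by (cases g; cases h) simp

lemma snd_inv [simp]: "snd (inv\<^bsub>G\<^esub> g) = - snd g"
  by (cases g) simp

lemma G_nat_pow: "g [^]\<^bsub>G\<^esub> (n::nat) = g [^]\<^bsub>G\<^esub> int n"
  by (simp add: int_pow_int)

lemma G_separating:
  assumes U: "U \<in> FIN" and "n > 0" "d > 0"
  shows "\<exists>V\<in>FIN. V \<subseteq> U \<and> (\<forall>v i. (v, i) \<in> V \<longrightarrow> d dvd i \<and> (\<exists>w. v = int n *s w))"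
proof -
  let ?Z = "range (\<lambda>v::int^2. (v, 0::int))"
  have Z: "subgroup ?Z G" using G.inf_cyclic_extD(1)[OF mapping_torus_ext[OF inv_A]] .
  have pZ: "G.poly_cyc_fin ?Z"
    by (rule G.poly_cyc_fin.cyc[OF G.poly_cyc_fin.cyc[OF G.poly_cyc_fin.base mapping_torus_chain(1)[OF inv_A]] mapping_torus_chain(2)[OF inv_A]])
  have ext: "G.inf_cyclic_ext ?Z (0, 1) (carrier G)" using mapping_torus_ext[OF inv_A] by simp
  obtain V where V: "V \<in> FIN" "V \<subseteq> U"
    "\<And>y i. y \<in> ?Z \<Longrightarrow> y \<otimes>\<^bsub>G\<^esub> (0, 1) [^]\<^bsub>G\<^esub> (i::int) \<in> V \<Longrightarrow> y \<in> G.power_sub n ?Z \<and> d dvd i"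
    using G.separating_normal[OF ext G.poly_cyc_fin_fin_index_power_sub[OF pZ \<open>n > 0\<close>] poly_cyc_fin_mapping_torus[OF inv_A] U \<open>d > 0\<close>] by metis
  have "d dvd i \<and> (\<exists>w. v = int n *s w)" if "(v, i) \<in> V" for v i
  proof -
    have 1: "(v, 0) \<in> G.power_sub n ?Z \<and> d dvd i" using V(3)[of "(v, 0)" i] that by simp
    have comm: "a \<otimes>\<^bsub>G\<^esub> b = b \<otimes>\<^bsub>G\<^esub> a" if "a \<in> ?Z" "b \<in> ?Z" for a b using that by (auto simp: add.commute)
    obtain z where "z \<in> ?Z" "(v, 0) = z [^]\<^bsub>G\<^esub> n"
      using G.power_sub_powers[OF Z comm conjunct1[OF 1]] by blast
    then show ?thesis using 1 by (auto simp: G_nat_pow)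
  qed
  then show ?thesis using V(1,2) by blast
qed

lemma G_exponent:
  assumes "U \<in> FIN"
  obtains m where "m > 0" "\<And>g. g [^]\<^bsub>G\<^esub> int m \<in> U"
  using G.finite_index_normal_exponent[OF assms] by (metis Gs(1) UNIV_I int_pow_int)

lemma mem_if_dvd:
  assumes "U \<in> FIN" "\<And>g. g [^]\<^bsub>G\<^esub> int m \<in> U" "int m dvd i"
  shows "g [^]\<^bsub>G\<^esub> i \<in> U"
proof -
  obtain q where "i = int m * q" using assms(3) by (auto elim: dvdE)
  then have "g [^]\<^bsub>G\<^esub> i = (g [^]\<^bsub>G\<^esub> int m) [^]\<^bsub>G\<^esub> q" by (simp add: G.int_pow_pow mult.commute)
  then show ?thesis using G.subgroup_int_pow_closed[OF G.finite_index_normalD(2)[OF assms(1)] assms(2)] by simp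
qed

lemma normal_conj: "U \<in> FIN \<Longrightarrow> u \<in> U \<Longrightarrow> g \<otimes>\<^bsub>G\<^esub> u \<otimes>\<^bsub>G\<^esub> inv\<^bsub>G\<^esub> g \<in> U"
  unfolding G.finite_index_normal_iff G.normalizes_def Gs(1) by blast

lemma rel_vec_shift:
  assumes "rel U h (v, k)" "(0, k) \<in> U"
  shows "rel U h (v, 0)"
proof (rule rel_shift[OF assms(1)])
  have "U \<in> FIN" using rel_carrier[OF assms(1)] by blast
  \<comment> \<open>The pair (v, k) is the product of (v, 0) and (0, k), so the quotient in question
    is a conjugate of (0, k).\<close>
  from normal_conj[OF this assms(2), of "(v, 0)"] show "(v, k) \<otimes>\<^bsub>G\<^esub> inv\<^bsub>G\<^esub> (v, 0) \<in> U" by simp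
qed simp

text \<open>The elements of \<open>H\<close> that lie in the closure of the fibre \<open>\<int>\<^sup>2\<close> in the common completion.\<close>
definition M :: "'h set"
  where "M = {h \<in> carrier H. \<forall>U\<in>FIN. \<exists>v. rel U h (v, 0)}"

lemma M_carrier: "h \<in> M \<Longrightarrow> h \<in> carrier H"
  by (simp add: M_def)

lemma M_rel:
  assumes "h \<in> M" "U \<in> FIN"
  obtains v where "rel U h (v, 0)"
  using assms by (auto simp: M_def)

lemma subgroup_M: "subgroup M H"
proof (rule H.subgroupI)
  show "M \<subseteq> carrier H" using M_carrier by blast
  have "\<one> \<in> M" unfolding M_def using rel_1 by auto
  then show "M \<noteq> {}" by blast
  fix h assume h: "h \<in> M"
  show "inv h \<in> M" unfolding M_def
  proof (intro CollectI conjI ballI)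
    fix U assume "U \<in> FIN"
    then obtain v where "rel U h (v, 0)" using M_rel h by blast
    from rel_inv[OF this] show "\<exists>v. rel U (inv h) (v, 0)" by auto
  qed (use M_carrier h in simp)
  fix k assume k: "k \<in> M"
  show "h \<otimes> k \<in> M" unfolding M_def
  proof (intro CollectI conjI ballI)
    fix U assume U: "U \<in> FIN"
    obtain v where v: "rel U h (v, 0)" using M_rel h U by blast
    obtain w where w: "rel U k (w, 0)" using M_rel k U by blast
    from rel_mult[OF v w] show "\<exists>v. rel U (h \<otimes> k) (v, 0)" by auto
  qed (use M_carrier h k in simp)
qed

lemma conj_M:
  assumes "g \<in> carrier H" "h \<in> M"
  shows "g \<otimes> h \<otimes> inv g \<in> M"
  unfolding M_def
proof (intro CollectI conjI ballI)
  fix U assume U: "U \<in> FIN"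
  obtain v where v: "rel U h (v, 0)" using M_rel assms(2) U by blast
  obtain x where x: "rel U g x" using rel_left[OF U assms(1)] by blast
  obtain w k where "x = (w, k)" by (cases x)
  with rel_mult[OF rel_mult[OF x v] rel_inv[OF x]] show "\<exists>v. rel U (g \<otimes> h \<otimes> inv g) (v, 0)"
    using mapping_torus_conj[OF inv_A, of w k v] by auto
qed (use M_carrier assms in simp)

lemma commutator_M:
  assumes "g \<in> carrier H" "h \<in> carrier H"
  shows "g \<otimes> h \<otimes> inv g \<otimes> inv h \<in> M"
  unfolding M_def
proof (intro CollectI conjI ballI)
  fix U assume U: "U \<in> FIN"
  obtain x where x: "rel U g x" using rel_left[OF U assms(1)] by blast
  obtain y where y: "rel U h y" using rel_left[OF U assms(2)] by blast
  define z where "z = x \<otimes>\<^bsub>G\<^esub> y \<otimes>\<^bsub>G\<^esub> inv\<^bsub>G\<^esub> x \<otimes>\<^bsub>G\<^esub> inv\<^bsub>G\<^esub> y"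
  have "snd z = 0" by (simp add: z_def)
  moreover have "rel U (g \<otimes> h \<otimes> inv g \<otimes> inv h) z"
    unfolding z_def by (rule rel_mult[OF rel_mult[OF rel_mult[OF x y] rel_inv[OF x]] rel_inv[OF y]])
  ultimately show "\<exists>v. rel U (g \<otimes> h \<otimes> inv g \<otimes> inv h) (v, 0)" by (metis prod.collapse)
qed (use assms in simp)

lemma M_normal: "M \<lhd> H"
  by (simp add: H.normal_inv_iff subgroup_M conj_M)

text \<open>Let \<open>m\<close> be an exponent of the quotient by \<open>U\<close>, and choose
  \<open>V\<close> so small that last coordinates of its members are divisible by
  \<open>i * m\<close>. If the i-th power of \<open>h\<close> lies over the fibre, then
  \<open>i * m\<close> divides \<open>i * k\<close>, where \<open>k\<close> is the last coordinate
  of \<open>h\<close> modulo \<open>V\<close>. Hence \<open>m\<close> divides \<open>k\<close>, and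
  \<open>k\<close> disappears modulo \<open>U\<close>. In other words, H/M is torsion-free.\<close>

lemma M_isolated:
  assumes h: "h \<in> carrier H" and i: "i \<noteq> 0" and hi: "h [^] (i::int) \<in> M"
  shows "h \<in> M"
  unfolding M_def
proof (intro CollectI conjI ballI)
  fix U assume U: "U \<in> FIN"
  obtain m where m: "m > 0" "\<And>g. g [^]\<^bsub>G\<^esub> int m \<in> U" using G_exponent[OF U] by blast
  have pos: "\<bar>i * int m\<bar> > 0" using i m(1) by simp
  obtain V where V: "V \<in> FIN" "V \<subseteq> U"
    "\<And>v k. (v, k) \<in> V \<Longrightarrow> \<bar>i * int m\<bar> dvd k \<and> (\<exists>w. v = int 1 *s w)"
    using G_separating[OF U zero_less_one pos] by blast
  obtain g where g: "rel V h g" using rel_left[OF V(1) h] by blast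
  obtain v k where vk: "g = (v, k)" by (cases g)
  obtain w where w: "rel V (h [^] i) (w, 0)" using M_rel[OF hi V(1)] .
  define y where "y = g [^]\<^bsub>G\<^esub> i \<otimes>\<^bsub>G\<^esub> inv\<^bsub>G\<^esub> (w, 0)"
  have "y \<in> V" unfolding y_def by (rule rel_coset[OF rel_pow[OF g] w])
  moreover have "snd y = i * k" by (simp add: y_def vk)
  ultimately have "\<bar>i * int m\<bar> dvd i * k" using V(3) by (metis prod.collapse)
  then have "int m dvd k" using i by simp
  then have "(0, k) \<in> U" using mem_if_dvd[OF U m(2), of k "(0, 1)"] by simp
  then show "\<exists>v. rel U h (v, 0)" using rel_vec_shift[OF rel_mono[OF g U V(2), unfolded vk]] by blast
qed (rule h)

text \<open>The fibre is abelian, so the commutator dies in every finite quotient.\<close>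

lemma M_comm:
  assumes "h \<in> M" "k \<in> M"
  shows "h \<otimes> k = k \<otimes> h"
proof -
  have c: "h \<in> carrier H" "k \<in> carrier H" using assms M_carrier by auto
  have "h \<otimes> k \<otimes> inv h \<otimes> inv k = \<one>"
  proof (rule trivial_if_rel_one[OF poly_cyc_fin_H])
    fix U assume U: "U \<in> FIN"
    obtain v where v: "rel U h (v, 0)" using M_rel assms(1) U by blast
    obtain w where w: "rel U k (w, 0)" using M_rel assms(2) U by blast
    from rel_mult[OF rel_mult[OF rel_mult[OF v w] rel_inv[OF v]] rel_inv[OF w]]
    show "rel U (h \<otimes> k \<otimes> inv h \<otimes> inv k) \<one>\<^bsub>G\<^esub>" by simp
  qed (use c in simp)
  then have "h \<otimes> k \<otimes> inv h \<otimes> inv k \<otimes> (k \<otimes> h) = k \<otimes> h" using c by simp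
  then show ?thesis using c by (simp add: H.m_assoc)
qed

text \<open>The modulus is enlarged by the factor \<open>n\<close> before passing to the quotient:
  if \<open>n *s v\<close> is divisible by \<open>n * m\<close>, then \<open>v\<close> is divisible
  by \<open>m\<close> and hence trivial modulo \<open>U\<close>.\<close>

lemma M_torsion_free:
  assumes h: "h \<in> M" and n: "n \<noteq> 0" and hn: "h [^] (n::int) = \<one>"
  shows "h = \<one>"
proof (rule trivial_if_rel_one[OF poly_cyc_fin_H M_carrier[OF h]])
  fix U assume U: "U \<in> FIN"
  obtain m where m: "m > 0" "\<And>g. g [^]\<^bsub>G\<^esub> int m \<in> U" using G_exponent[OF U] by blast
  define r where "r = nat \<bar>n\<bar> * m"
  have "r > 0" using n m(1) by (simp add: r_def)
  then obtain V where V: "V \<in> FIN" "V \<subseteq> U" "\<And>v k. (v, k) \<in> V \<Longrightarrow> 1 dvd k \<and> (\<exists>w. v = int r *s w)"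
    using G_separating[OF U _ zero_less_one] by blast
  obtain v where v: "rel V h (v, 0)" using M_rel[OF h V(1)] .
  have "(n *s v, 0) \<in> V" using rel_pow[OF v, of n] rel_one_iff[OF V(1)] rel_1[OF V(1)] hn by (metis Gpow_vec)
  then obtain w where w: "n *s v = int r *s w" using V(3) by blast
  have "n * v$j = n * (int m * (sgn n * w$j))" for j
  proof -
    have "n * v$j = int r * w$j" using w by (simp add: vec_eq_iff)
    also have "int r = \<bar>n\<bar> * int m" by (simp add: r_def)
    also have "\<bar>n\<bar> = n * sgn n" by (simp add: abs_sgn)
    finally show ?thesis by (simp add: mult_ac)
  qed
  then have "v = int m *s (sgn n *s w)" using n by (simp add: vec_eq_iff)
  then have "(v, 0) \<in> U" using m(2)[of "(sgn n *s w, 0)"] by simp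
  then show "rel U h \<one>\<^bsub>G\<^esub>" using rel_one_iff[OF U rel_mono[OF v U V(2)]] by blast
qed

lemma rel_commutator:
  assumes "rel U a (0, 1)" "rel U b (w, 0)"
  shows "rel U (a \<otimes> b \<otimes> inv a \<otimes> inv b) (A *v w - w, 0)"
  using rel_mult[OF rel_mult[OF rel_mult[OF assms(1,2)] rel_inv[OF assms(1)]] rel_inv[OF assms(2)]]
  by (simp add: act1)

end

context comm_group begin

lemma lincomb_smult:
  assumes "e \<in> I \<rightarrow> carrier G"
  shows "lincomb e I (\<lambda>i. k * c i) = lincomb e I c [^] (k::int)"
proof (induction k rule: int_induct[of _ 0])
  case base
  then show ?case using lincomb_zero[OF assms] by simp
next
  case (step1 k)
  have "lincomb e I (\<lambda>i. (k + 1) * c i) = lincomb e I (\<lambda>i. k * c i) \<otimes> lincomb e I c"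
    using lincomb_add[OF assms, of "\<lambda>i. k * c i" c] by (simp add: distrib_right)
  then show ?case using step1 lincomb_closed[OF assms] by (simp add: int_pow_mult)
next
  case (step2 k)
  have "lincomb e I (\<lambda>i. (k - 1) * c i) = lincomb e I (\<lambda>i. k * c i) \<otimes> inv (lincomb e I c)"
    using lincomb_add[OF assms, of "\<lambda>i. k * c i" "\<lambda>i. - c i"] lincomb_uminus[OF assms, of c] by (simp add: left_diff_distrib)
  then show ?case using step2 lincomb_closed[OF assms] by (simp add: int_pow_diff)
qed

lemma lincomb_inj:
  assumes e: "e \<in> I \<rightarrow> carrier G" and ind: "\<forall>c. lincomb e I c = \<one> \<longrightarrow> (\<forall>i\<in>I. c i = 0)"
    and eq: "lincomb e I c = lincomb e I d" and i: "i \<in> I"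
  shows "c i = d i"
proof -
  have "lincomb e I (\<lambda>i. c i + - d i) = \<one>"
    unfolding lincomb_add[OF e] lincomb_uminus[OF e] eq using lincomb_closed[OF e] by simp
  with ind i have "c i + - d i = 0" by blast
  then show ?thesis by simp
qed

end

context torus_relation begin

text \<open>By \<open>fibre_trace\<close> the vector t v is the commutator of the generator with
  some \<open>w\<close>. Lifts of these two to \<open>H\<close> have a commutator in
  \<open>M\<close> that agrees with \<open>y [^] trace A\<close> in the quotient by
  \<open>U\<close>.\<close>

lemma commutator_power_kernel:
  assumes N: "\<And>h. rel U h \<one>\<^bsub>G\<^esub> \<Longrightarrow> h \<in> N" and y: "rel U y (v, 0)" and U: "U \<in> FIN"
  shows "\<exists>c\<in>M. y [^] trace A \<otimes> inv c \<in> N"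
proof -
  obtain w where w: "A *v w - w = trace A *s v" using fibre_trace[OF det_A] by blast
  obtain a where a: "rel U a (0, 1)" using rel_right[OF U, of "(0, 1)"] by auto
  obtain b where b: "rel U b (w, 0)" using rel_right[OF U, of "(w, 0)"] by auto
  have "rel U (y [^] trace A \<otimes> inv (a \<otimes> b \<otimes> inv a \<otimes> inv b)) \<one>\<^bsub>G\<^esub>"
    using rel_mult[OF rel_pow[OF y, of "trace A"] rel_inv[OF rel_commutator[OF a b]]] by (simp add: w)
  moreover have "a \<otimes> b \<otimes> inv a \<otimes> inv b \<in> M"
    using commutator_M rel_carrier[OF a] rel_carrier[OF b] by blast
  ultimately show ?thesis using N by blast
qed

lemma quotient_comm_group: "comm_group (H Mod M)"
proof -
  interpret normal M H by (rule M_normal)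
  interpret X: group "H Mod M" by (rule factorgroup_is_group)
  show ?thesis
  proof (rule X.group_comm_groupI)
    fix x y assume "x \<in> carrier (H Mod M)" "y \<in> carrier (H Mod M)"
    then obtain g h where gh: "g \<in> carrier H" "h \<in> carrier H" "x = M #> g" "y = M #> h"
      by (auto simp: carrier_FactGroup)
    have "(g \<otimes> h) \<otimes> inv (h \<otimes> g) = g \<otimes> h \<otimes> inv g \<otimes> inv h" using gh by (simp add: H.inv_mult_group H.m_assoc)
    then have "M #> (g \<otimes> h) = M #> (h \<otimes> g)"
      using H.rcoset_eq_iff[OF subgroup_M, of "g \<otimes> h" "h \<otimes> g"] commutator_M gh by simp
    then show "x \<otimes>\<^bsub>H Mod M\<^esub> y = y \<otimes>\<^bsub>H Mod M\<^esub> x" using gh by (simp add: rcos_sum)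
  qed
qed

text \<open>The quotient H/M is abelian, finitely generated and torsion-free, so it has a basis.
  Modulo squares every class is a power of the class of one element \<open>s1\<close>, which leaves
  room for at most one basis element; a parity obstruction shows that there is one.\<close>

lemma exists_generator: "\<exists>s. H.inf_cyclic_ext M s (carrier H)"
proof -
  interpret M: normal M H by (rule M_normal)
  interpret X: comm_group "H Mod M" by (rule quotient_comm_group)
  let ?X = "H Mod M"
  define \<pi> where "\<pi> h = M #> h" for h
  interpret \<pi>: group_hom H ?X \<pi>
    unfolding group_hom_def group_hom_axioms_def \<pi>_def[abs_def]
    using M.r_coset_hom_Mod X.group_axioms H.group_axioms by simp
  have surj: "carrier ?X = \<pi> ` carrier H" by (simp add: carrier_FactGroup \<pi>_def[abs_def])
  have \<pi>1: "\<pi> h = \<one>\<^bsub>?X\<^esub> \<longleftrightarrow> h \<in> M" if "h \<in> carrier H" for h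
    using H.rcoset_eq_iff[OF subgroup_M that H.one_closed] that M_carrier
    by (simp add: \<pi>_def H.coset_mult_one subsetI)
  have tf: "x = \<one>\<^bsub>?X\<^esub>" if x: "x \<in> carrier ?X" "n \<noteq> 0" "x [^]\<^bsub>?X\<^esub> (n::int) = \<one>\<^bsub>?X\<^esub>" for x n
  proof -
    obtain h where h: "h \<in> carrier H" "x = \<pi> h" using x(1) surj by blast
    then have "h [^] n \<in> M" using x(3) \<pi>1[of "h [^] n"] \<pi>.hom_int_pow[OF h(1), of n] by simp
    then show ?thesis using M_isolated[OF h(1) x(2)] \<pi>1 h by simp
  qed
  define T where "T = nat \<bar>trace A\<bar>"
  have T: "T > 0" using trace_A by (simp add: T_def)
  \<comment> \<open>The factor t in the exponent is cancelled later by torsion-freeness; the factor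
    2 is what leaves a square.\<close>
  let ?S = "{h \<in> carrier H. \<exists>x\<in>carrier ?X. \<pi> h = x [^]\<^bsub>?X\<^esub> (2 * T)}"
  have S: "subgroup ?S H"
  proof (rule H.subgroupI)
    have "\<one> \<in> ?S" by (auto intro!: bexI[of _ "\<one>\<^bsub>?X\<^esub>"] simp del: one_FactGroup)
    then show "?S \<noteq> {}" by blast
    fix a assume "a \<in> ?S"
    then obtain x where x: "a \<in> carrier H" "x \<in> carrier ?X" "\<pi> a = x [^]\<^bsub>?X\<^esub> (2 * T)" by blast
    have "\<pi> (inv a) = (inv\<^bsub>?X\<^esub> x) [^]\<^bsub>?X\<^esub> (2 * T)" using x by (simp add: X.nat_pow_inv)
    then show "inv a \<in> ?S" using x X.inv_closed by blast
    fix b assume "b \<in> ?S"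
    then obtain y where y: "b \<in> carrier H" "y \<in> carrier ?X" "\<pi> b = y [^]\<^bsub>?X\<^esub> (2 * T)" by blast
    have "\<pi> (a \<otimes> b) = (x \<otimes>\<^bsub>?X\<^esub> y) [^]\<^bsub>?X\<^esub> (2 * T)"
      using x y by (simp add: X.nat_pow_distrib del: mult_FactGroup)
    then show "a \<otimes> b \<in> ?S" using x y X.m_closed by blast
  qed auto
  have "H.power_sub (2 * T) (carrier H) \<subseteq> ?S"
    by (rule H.power_sub_subset[OF _ S]) (auto intro!: bexI[of _ "\<pi> _"] simp: \<pi>.hom_nat_pow)
  moreover obtain U where U: "U \<in> FIN" "\<And>h. rel U h \<one>\<^bsub>G\<^esub> \<Longrightarrow> h \<in> H.power_sub (2 * T) (carrier H)"
    using rel_kernel[OF H.poly_cyc_fin_finite_index_normal_power_sub[OF poly_cyc_fin_H, of "2 * T"]] T by auto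
  ultimately have US: "\<And>h. rel U h \<one>\<^bsub>G\<^esub> \<Longrightarrow> h \<in> ?S" by blast
  obtain s1 where s1: "rel U s1 (0, 1)" using rel_right[OF U(1), of "(0, 1)"] by auto
  have s1c: "s1 \<in> carrier H" using rel_carrier[OF s1] by blast
  \<comment> \<open>After division by a power of \<open>s1\<close>, the element \<open>h\<close>
    lies over the fibre modulo \<open>U\<close>. Its t-th power is then an element of
    \<open>M\<close> times one whose class is a power with exponent 2 |t|.\<close>
  have key: "\<exists>k x. x \<in> carrier ?X \<and> \<pi> h = \<pi> s1 [^]\<^bsub>?X\<^esub> (k::int) \<otimes>\<^bsub>?X\<^esub> x [^]\<^bsub>?X\<^esub> (2::int)" if h: "h \<in> carrier H" for h
  proof -
    obtain g where "rel U h g" using rel_left[OF U(1) h] by blast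
    then obtain v k where vk: "rel U h (v, k)" by (cases g) auto
    define y where "y = h \<otimes> inv (s1 [^] k)"
    have yc: "y \<in> carrier H" using h s1c by (simp add: y_def)
    have y: "rel U y (v, 0)" using rel_mult[OF vk rel_inv[OF rel_pow[OF s1, of k]]] by (simp add: y_def)
    obtain c where c: "c \<in> M" "y [^] trace A \<otimes> inv c \<in> ?S" using commutator_power_kernel[OF US y U(1)] by blast
    have cc: "c \<in> carrier H" "\<pi> c = \<one>\<^bsub>?X\<^esub>" using c(1) M_carrier \<pi>1 by auto
    obtain x where x: "x \<in> carrier ?X" "\<pi> (y [^] trace A \<otimes> inv c) = x [^]\<^bsub>?X\<^esub> (2 * T)" using c(2) by blast
    have "\<pi> y [^]\<^bsub>?X\<^esub> trace A = x [^]\<^bsub>?X\<^esub> (2 * T)"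
      using x yc cc \<pi>.hom_int_pow[OF yc] by (simp del: one_FactGroup mult_FactGroup)
    also have "\<dots> = (x [^]\<^bsub>?X\<^esub> (2 * sgn (trace A))) [^]\<^bsub>?X\<^esub> trace A"
    proof -
      have "int (2 * T) = 2 * \<bar>trace A\<bar>" by (simp add: T_def)
      also have "\<dots> = 2 * sgn (trace A) * trace A" by (simp add: abs_sgn mult_ac)
      finally show ?thesis using x(1) by (simp only: X.int_pow_pow int_pow_int [symmetric])
    qed
    finally have e: "\<pi> y [^]\<^bsub>?X\<^esub> trace A = (x [^]\<^bsub>?X\<^esub> (2 * sgn (trace A))) [^]\<^bsub>?X\<^esub> trace A" .
    let ?z = "\<pi> y \<otimes>\<^bsub>?X\<^esub> inv\<^bsub>?X\<^esub> (x [^]\<^bsub>?X\<^esub> (2 * sgn (trace A)))"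
    have zc: "?z \<in> carrier ?X" using yc x(1) by (simp del: mult_FactGroup)
    have "?z [^]\<^bsub>?X\<^esub> trace A = \<one>\<^bsub>?X\<^esub>"
      using yc x(1) e by (simp add: X.int_pow_distrib X.int_pow_inv del: mult_FactGroup one_FactGroup)
    then have "?z = \<one>\<^bsub>?X\<^esub>" using tf[OF zc trace_A] by blast
    then have "\<pi> y = x [^]\<^bsub>?X\<^esub> (2 * sgn (trace A))" 
      using yc x(1) X.inv_equality[of "\<pi> y" "inv\<^bsub>?X\<^esub> (x [^]\<^bsub>?X\<^esub> (2 * sgn (trace A)))"] by (simp del: mult_FactGroup one_FactGroup)
    also have "\<dots> = (x [^]\<^bsub>?X\<^esub> sgn (trace A)) [^]\<^bsub>?X\<^esub> (2::int)" using x(1) by (simp add: X.int_pow_pow mult.commute)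
    finally have "\<pi> y = (x [^]\<^bsub>?X\<^esub> sgn (trace A)) [^]\<^bsub>?X\<^esub> (2::int)" .
    moreover have "h = y \<otimes> s1 [^] k" using h s1c by (simp add: y_def H.m_assoc)
    then have "\<pi> h = \<pi> s1 [^]\<^bsub>?X\<^esub> k \<otimes>\<^bsub>?X\<^esub> \<pi> y"
      using yc s1c \<pi>.hom_int_pow[OF s1c] X.m_comm by (simp del: mult_FactGroup)
    ultimately show ?thesis using x(1) X.int_pow_closed by metis
  qed
  obtain F where F: "finite F" "F \<subseteq> carrier H" "carrier H = generate H F"
    using H.poly_cyc_fin_subgroup_fg[OF poly_cyc_fin_H H.subgroup_self order_refl] by blast
  have genX: "carrier ?X = generate ?X (\<pi> ` F)"
    by (simp only: surj \<pi>.generate_img[OF F(2)] F(3)[symmetric])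
  have FX: "\<pi> ` F \<subseteq> carrier ?X" using surj F(2) by blast
  have "\<exists>(I :: 'h set set) e. finite I \<and> e \<in> I \<rightarrow> carrier ?X \<and> carrier ?X = range (X.lincomb e I) \<and>
      (\<forall>c. X.lincomb e I c = \<one>\<^bsub>?X\<^esub> \<longrightarrow> (\<forall>i\<in>I. c i = 0))"
  proof (rule X.torsion_free_basis[OF _ finite_imageI[OF F(1)] FX genX])
    fix x and n :: int assume "x \<in> carrier ?X" "n \<noteq> 0" "x [^]\<^bsub>?X\<^esub> n = \<one>\<^bsub>?X\<^esub>"
    then show "x = \<one>\<^bsub>?X\<^esub>" by (rule tf)
  qed
  then obtain I :: "'h set set" and e where basis: "finite I \<and> e \<in> I \<rightarrow> carrier ?X \<and> carrier ?X = range (X.lincomb e I) \<and>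
      (\<forall>c. X.lincomb e I c = \<one>\<^bsub>?X\<^esub> \<longrightarrow> (\<forall>i\<in>I. c i = 0))"
    by (elim exE) (rule that)
  note I = conjunct1[OF basis] conjunct1[OF conjunct2[OF basis]] conjunct1[OF conjunct2[OF conjunct2[OF basis]]]
  have ind: "\<And>c i. X.lincomb e I c = \<one>\<^bsub>?X\<^esub> \<Longrightarrow> i \<in> I \<Longrightarrow> c i = 0" using conjunct2[OF conjunct2[OF conjunct2[OF basis]]] by blast
  obtain c1 where c1: "\<pi> s1 = X.lincomb e I c1" using I(3) \<pi>.hom_closed[OF s1c] by blast
  have cond: "\<exists>k d. \<forall>j\<in>I. (if j = i then 1 else 0) = k * c1 j + 2 * d j" if i: "i \<in> I" for i
  proof -
    have ei: "e i \<in> carrier ?X" using I(2) i by auto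
    then obtain h where h: "h \<in> carrier H" "e i = \<pi> h" using surj by blast
    obtain k x where x: "x \<in> carrier ?X" "\<pi> h = \<pi> s1 [^]\<^bsub>?X\<^esub> (k::int) \<otimes>\<^bsub>?X\<^esub> x [^]\<^bsub>?X\<^esub> (2::int)" using key[OF h(1)] by blast
    obtain d where d: "x = X.lincomb e I d" using x(1) I(3) by blast
    have "X.lincomb e I (\<lambda>j. if j = i then 1 else 0) = e i"
      using X.lincomb_single[OF I(1) i I(2), of "\<lambda>j. if j = i then 1 else 0"] ei by simp
    also have "\<dots> = X.lincomb e I (\<lambda>j. k * c1 j + 2 * d j)"
      unfolding h(2) x(2) c1 d X.lincomb_add[OF I(2)] X.lincomb_smult[OF I(2)] ..
    finally show ?thesis using X.lincomb_inj[OF I(2) conjunct2[OF conjunct2[OF conjunct2[OF basis]]]] by blast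
  qed
  \<comment> \<open>The two instances of \<open>cond\<close> make \<open>c1 i\<close> and
    \<open>k'\<close> odd, while the coordinate at \<open>i\<close> of the second instance makes
    their product even.\<close>
  have uniq: "i = j" if ij: "i \<in> I" "j \<in> I" for i j
  proof (rule ccontr)
    assume ne: "i \<noteq> j"
    obtain k d where "\<forall>l\<in>I. (if l = i then 1 else 0) = k * c1 l + 2 * d l" using cond[OF ij(1)] by blast
    then have "1 = k * c1 i + 2 * d i" using ij(1) by auto
    then have "odd (k * c1 i + 2 * d i)" by (metis odd_one)
    then have o: "odd (c1 i)" by simp
    obtain k' d' where kd: "\<forall>l\<in>I. (if l = j then 1 else 0) = k' * c1 l + 2 * d' l" using cond[OF ij(2)] by blast
    have "1 = k' * c1 j + 2 * d' j" "0 = k' * c1 i + 2 * d' i"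
      using bspec[OF kd ij(2)] bspec[OF kd ij(1)] ne by simp_all
    then have "odd (k' * c1 j + 2 * d' j)" "even (k' * c1 i + 2 * d' i)" by (metis odd_one, metis even_zero)
    then show False using o by simp
  qed
  \<comment> \<open>Otherwise H = M, but an element over (0, 1) cannot lie over the fibre in a
    quotient that sees the parity of the last coordinate.\<close>
  have "I \<noteq> {}"
  proof
    assume "I = {}"
    then have triv: "carrier ?X \<subseteq> {\<one>\<^bsub>?X\<^esub>}" using I(3) by (auto simp: X.lincomb_def simp del: one_FactGroup)
    have all: "h \<in> M" if "h \<in> carrier H" for h using triv \<pi>1[OF that] \<pi>.hom_closed[OF that] by blast
    obtain V where V: "V \<in> FIN" "\<And>v k. (v, k) \<in> V \<Longrightarrow> 2 dvd k"
      using G_separating[OF U(1) zero_less_one, of 2] by auto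
    obtain h where h: "rel V h (0, 1)" using rel_right[OF V(1), of "(0, 1)"] by auto
    obtain v where v: "rel V h (v, 0)" using M_rel[OF all V(1)] rel_carrier[OF h] by blast
    have "(0, 1) \<otimes>\<^bsub>G\<^esub> inv\<^bsub>G\<^esub> (v, 0) \<in> V" by (rule rel_coset[OF h v])
    then show False using V(2)[of _ 1] by auto
  qed
  then obtain i0 where i0: "i0 \<in> I" by blast
  have ei: "e i0 \<in> carrier ?X" using I(2) i0 by auto
  then obtain s where s: "s \<in> carrier H" "e i0 = \<pi> s" using surj by blast
  have lc1: "X.lincomb e I c = \<pi> s [^]\<^bsub>?X\<^esub> c i0" for c
    using X.lincomb_single[OF I(1) i0 I(2), of c] uniq[OF i0] s(2) by auto
  have dec: "\<exists>n\<in>M. \<exists>i::int. h = n \<otimes> s [^] i" if h: "h \<in> carrier H" for h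
  proof -
    obtain c where c: "\<pi> h = X.lincomb e I c" using I(3) \<pi>.hom_closed[OF h] by blast
    have "\<pi> (h \<otimes> inv (s [^] c i0)) = \<one>\<^bsub>?X\<^esub>"
      using h s(1) c \<pi>.hom_int_pow[OF s(1)] by (simp add: lc1 del: one_FactGroup mult_FactGroup)
    then have "h \<otimes> inv (s [^] c i0) \<in> M"
      using \<pi>1[of "h \<otimes> inv (s [^] c i0)"] h s(1) by (simp only: H.m_closed H.inv_closed H.int_pow_closed)
    moreover have "h = h \<otimes> inv (s [^] c i0) \<otimes> s [^] c i0" using h s(1) by (simp add: H.m_assoc)
    ultimately show ?thesis by blast
  qed
  have "i = 0" if "s [^] (i::int) \<in> M" for i
  proof -
    have "\<pi> s [^]\<^bsub>?X\<^esub> i = \<one>\<^bsub>?X\<^esub>" using \<pi>1[of "s [^] i"] that s(1) \<pi>.hom_int_pow[OF s(1)] by (simp del: one_FactGroup)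
    then have "X.lincomb e I (\<lambda>_. i) = \<one>\<^bsub>?X\<^esub>" by (simp add: lc1 del: one_FactGroup)
    from ind[OF this i0] show ?thesis .
  qed
  moreover have Mc: "M \<subseteq> carrier H" using M_carrier by blast
  ultimately have "H.inf_cyclic_ext M s (carrier H)"
    unfolding H.inf_cyclic_ext_def H.normalizes_def
    using dec by (intro conjI ballI allI impI subgroup_M H.subgroup_self s(1) Mc conj_M)
  then show ?thesis by blast
qed

text \<open>An \<open>h\<close> close to (v, 0) has the form \<open>y \<otimes> s [^] i\<close> with
  \<open>y\<close> in \<open>M\<close>. Its t-th power is close to an element of \<open>M\<close>,
  so t i is divisible by t m with \<open>m\<close> an exponent of the quotient by \<open>U\<close>.
  Then \<open>s [^] i\<close> is invisible modulo \<open>U\<close>, and \<open>y\<close>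
  approximates the same vector.\<close>

lemma M_dense:
  assumes ext: "H.inf_cyclic_ext M s (carrier H)" and U: "U \<in> FIN"
  shows "\<exists>h\<in>M. rel U h (v, 0)"
proof -
  have sc: "s \<in> carrier H" using H.inf_cyclic_extD(8)[OF ext] .
  obtain m where m: "m > 0" "\<And>g. g [^]\<^bsub>G\<^esub> int m \<in> U" using G_exponent[OF U] by blast
  \<comment> \<open>With first powers the separating subgroup constrains the exponent of
    \<open>s\<close> only.\<close>
  have "M \<subseteq> H.power_sub 1 M" using H.power_sub_pow[of _ M 1] M_carrier by (auto simp: subset_iff)
  then have fi: "H.fin_index (H.power_sub 1 M) M" by (rule H.fin_index_mono[OF H.fin_index_self[OF subgroup_M]])
  have pos: "\<bar>trace A * int m\<bar> > 0" using trace_A m(1) by simp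
  obtain N where N: "N \<in> finite_index_normal H"
    "\<And>y i. y \<in> M \<Longrightarrow> y \<otimes> s [^] (i::int) \<in> N \<Longrightarrow> \<bar>trace A * int m\<bar> dvd i"
    using H.separating_normal[OF ext fi poly_cyc_fin_H H.finite_index_normal_carrier pos] by metis
  obtain U' where U': "U' \<in> FIN" "\<And>h. rel U' h \<one>\<^bsub>G\<^esub> \<Longrightarrow> h \<in> N" using rel_kernel[OF N(1)] by blast
  have V: "U \<inter> U' \<in> FIN" by (rule G.finite_index_normal_Int[OF U U'(1)])
  obtain h where h: "rel (U \<inter> U') h (v, 0)" using rel_right[OF V, of "(v, 0)"] by auto
  have hU: "rel U h (v, 0)" "rel U' h (v, 0)" using rel_mono[OF h] U U'(1) by auto
  have hc: "h \<in> carrier H" using rel_carrier[OF h] by blast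
  obtain y i where yi: "y \<in> M" "h = y \<otimes> s [^] (i::int)" by (rule H.inf_cyclic_ext_decomp[OF ext hc])
  obtain c where c: "c \<in> M" "h [^] trace A \<otimes> inv c \<in> N" using commutator_power_kernel[OF U'(2) hU(2) U'(1)] by blast
  obtain l where l: "l \<in> M" "h [^] trace A = l \<otimes> s [^] (i * trace A)"
    using H.inf_cyclic_ext_pow[OF ext yi(1), of i "trace A"] yi(2) by blast
  have lincomb: "l \<in> carrier H" "c \<in> carrier H" "y \<in> carrier H" using l(1) c(1) yi(1) M_carrier by auto
  let ?l = "l \<otimes> (s [^] (i * trace A) \<otimes> inv c \<otimes> inv (s [^] (i * trace A)))"
  have "h [^] trace A \<otimes> inv c = ?l \<otimes> s [^] (i * trace A)"
    unfolding l(2) using lincomb sc by (simp add: H.m_assoc)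
  moreover have "?l \<in> M"
    by (rule subgroup.m_closed[OF subgroup_M l(1) conj_M[OF _ subgroup.m_inv_closed[OF subgroup_M c(1)]]]) (use sc in simp)
  ultimately have "\<bar>trace A * int m\<bar> dvd i * trace A" using N(2) c(2) by simp
  then have "int m dvd i" using trace_A by (simp add: mult.commute)
  obtain g where g: "rel U s g" using rel_left[OF U sc] by blast
  have "g [^]\<^bsub>G\<^esub> i \<in> U" by (rule mem_if_dvd[OF U m(2) \<open>int m dvd i\<close>])
  then have "rel U (s [^] i) \<one>\<^bsub>G\<^esub>" using rel_one_iff[OF U rel_pow[OF g]] by blast
  from rel_mult[OF hU(1) rel_inv[OF this]] have "rel U (h \<otimes> inv (s [^] i)) (v, 0)" by simp
  moreover have "h \<otimes> inv (s [^] i) = y" using yi(2) lincomb sc by (simp add: H.m_assoc)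
  ultimately show ?thesis using yi(1) by auto
qed

end

section \<open>Coordinates on the closed fibre and its rank\<close>

locale torus_structure = torus_relation H A rel
  for H :: "'h monoid" (structure) and A rel +
  fixes s :: 'h and I :: "'i set" and L :: "('i \<Rightarrow> int) \<Rightarrow> 'h"
  assumes ext: "H.inf_cyclic_ext M s (carrier H)"
    and fin_I: "finite I" and range_L: "M = range L"
    and L_add: "L (\<lambda>i. c i + d i) = L c \<otimes> L d"
    and L_smult: "L (\<lambda>i. k * c i) = L c [^] k"
    and L_eq_iff: "L c = L d \<longleftrightarrow> (\<forall>i\<in>I. c i = d i)"
begin

lemma L_M: "L c \<in> M" and L_carrier: "L c \<in> carrier H"
  using range_L M_carrier by auto

lemma M_eq_L: "h \<in> M \<Longrightarrow> \<exists>c. h = L c"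
  unfolding range_L by auto

lemma s_carrier: "s \<in> carrier H"
  by (rule H.inf_cyclic_extD(8)[OF ext])

lemma L_diff: "L (\<lambda>i. c i - d i) = L c \<otimes> inv (L d)"
proof -
  have "L (\<lambda>i. - d i) = inv (L d)" using L_smult[of "-1" d] L_carrier by (simp add: H.int_pow_neg)
  then show ?thesis using L_add[of c "\<lambda>i. - d i"] by simp
qed

lemma L_power_iff: "(\<exists>z\<in>M. L c = z [^] (n::int)) \<longleftrightarrow> (\<forall>i\<in>I. n dvd c i)"
proof
  assume "\<exists>z\<in>M. L c = z [^] n"
  then obtain d where "L c = L d [^] n" using M_eq_L by metis
  then have "L c = L (\<lambda>i. n * d i)" by (simp add: L_smult)
  then show "\<forall>i\<in>I. n dvd c i" by (simp add: L_eq_iff)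
next
  assume "\<forall>i\<in>I. n dvd c i"
  then have "L c = L (\<lambda>i. n * (c i div n))" by (simp add: L_eq_iff)
  then show "\<exists>z\<in>M. L c = z [^] n" using L_smult L_M by metis
qed

lemma fin_index_power_sub_M:
  assumes "n > 0"
  shows "H.fin_index (H.power_sub n M) M"
proof -
  define cf where "cf h = (SOME c. L c = h)" for h
  have cf: "L (cf h) = h" if h: "h \<in> M" for h
  proof -
    obtain c where "L c = h" using M_eq_L[OF h] by metis
    then show ?thesis unfolding cf_def by (rule someI[of "\<lambda>c. L c = h"])
  qed
  show ?thesis
  proof (rule H.fin_indexI[of "\<lambda>h. restrict (\<lambda>i. cf h i mod int n) I"])
    show "finite ((\<lambda>h. restrict (\<lambda>i. cf h i mod int n) I) ` M)"
      by (rule finite_subset[OF _ finite_PiE[OF fin_I, of "\<lambda>_. {0..<int n}"]]) (use assms in auto)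
    fix g h assume gh: "g \<in> M" "h \<in> M"
      "restrict (\<lambda>i. cf g i mod int n) I = restrict (\<lambda>i. cf h i mod int n) I"
    have "int n dvd cf g i - cf h i" if "i \<in> I" for i
      using fun_cong[OF gh(3), of i] that by (simp add: mod_eq_dvd_iff)
    then obtain z where z: "z \<in> M" "L (\<lambda>i. cf g i - cf h i) = z [^] int n" using L_power_iff by blast
    then have "g \<otimes> inv h = z [^] n" using L_diff cf gh by (simp add: int_pow_int)
    then show "g \<otimes> inv h \<in> H.power_sub n M" using H.power_sub_pow z(1) by metis
  qed
qed

text \<open>The quotient of \<open>M\<close> by n-th powers is matched with Z^2/nZ^2: divisibility
  by \<open>n\<close> is visible in a suitable finite quotient on either side. The parity of the
  last coordinate is recorded for comparing generators later.\<close>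

lemma congruence_neighbourhood:
  assumes n: "n > 0"
  shows "\<exists>V\<in>FIN. (\<forall>v k. (v, k) \<in> V \<longrightarrow> even k) \<and> (\<forall>v. (v, 0) \<in> V \<longrightarrow> (\<exists>w. v = int n *s w)) \<and>
    (\<forall>h\<in>M. \<forall>v. rel V h (v, 0) \<longrightarrow> ((\<exists>z\<in>M. h = z [^] int n) \<longleftrightarrow> (\<exists>w. v = int n *s w)))"
proof -
  obtain N where N: "N \<in> finite_index_normal H" "\<And>y i. y \<in> M \<Longrightarrow> y \<otimes> s [^] (i::int) \<in> N \<Longrightarrow> y \<in> H.power_sub n M \<and> 1 dvd i"
    using H.separating_normal[OF ext fin_index_power_sub_M[OF n] poly_cyc_fin_H H.finite_index_normal_carrier zero_less_one] by metis
  obtain U where U: "U \<in> FIN" "\<And>h. rel U h \<one>\<^bsub>G\<^esub> \<Longrightarrow> h \<in> N" using rel_kernel[OF N(1)] by blast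
  obtain V where V: "V \<in> FIN" "V \<subseteq> U" "\<And>v k. (v, k) \<in> V \<Longrightarrow> 2 dvd k \<and> (\<exists>w. v = int n *s w)"
    using G_separating[OF U(1) n, of 2] by auto
  have "(\<exists>z\<in>M. h = z [^] int n) \<longleftrightarrow> (\<exists>w. v = int n *s w)" if h: "h \<in> M" "rel V h (v, 0)" for h v
  proof
    assume "\<exists>z\<in>M. h = z [^] int n"
    then obtain z where z: "z \<in> M" "h = z [^] int n" by blast
    obtain w where w: "rel V z (w, 0)" using M_rel[OF z(1) V(1)] .
    have "(v, 0) \<otimes>\<^bsub>G\<^esub> inv\<^bsub>G\<^esub> (int n *s w, 0) \<in> V"
      using rel_coset[OF h(2), of "(int n *s w, 0)"] rel_pow[OF w, of "int n"] z(2) by simp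
    then obtain w' where "v - int n *s w = int n *s w'" using V(3) by auto
    then have "v = int n *s (w + w')" by (simp add: vec_eq_iff algebra_simps)
    then show "\<exists>w. v = int n *s w" by blast
  next
    assume "\<exists>w. v = int n *s w"
    then obtain w where w: "v = int n *s w" by blast
    \<comment> \<open>Density supplies an approximate root; the remaining factor of \<open>h\<close>
      is trivial modulo \<open>V\<close> and hence an n-th power in \<open>M\<close>.\<close>
    obtain z where z: "z \<in> M" "rel V z (w, 0)" using M_dense[OF ext V(1)] by blast
    have hz: "h \<otimes> inv (z [^] int n) \<in> M"
      by (rule subgroup.m_closed[OF subgroup_M h(1) subgroup.m_inv_closed[OF subgroup_M H.subgroup_int_pow_closed[OF subgroup_M z(1)]]])
    have "rel V (h \<otimes> inv (z [^] int n)) \<one>\<^bsub>G\<^esub>"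
      using rel_mult[OF h(2) rel_inv[OF rel_pow[OF z(2), of "int n"]]] w by simp
    then have "h \<otimes> inv (z [^] int n) \<in> N" using rel_mono[OF _ U(1) V(2)] U(2) by blast
    then have "h \<otimes> inv (z [^] int n) \<in> H.power_sub n M" using N(2)[OF hz, of 0] M_carrier[OF hz] by simp
    then obtain y where y: "y \<in> M" "h \<otimes> inv (z [^] int n) = y [^] int n"
      using H.power_sub_powers[OF subgroup_M M_comm] by (metis int_pow_int)
    have c: "h \<in> carrier H" "z \<in> carrier H" "y \<in> carrier H" using h(1) z(1) y(1) M_carrier by auto
    have "h = h \<otimes> inv (z [^] int n) \<otimes> z [^] int n" using c by (simp add: H.m_assoc)
    also have "\<dots> = (y \<otimes> z) [^] int n" unfolding y(2)
      using H.int_pow_mult_distrib[OF M_comm[OF y(1) z(1)] c(3,2)] by simp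
    finally show "\<exists>z\<in>M. h = z [^] int n" using subgroup.m_closed[OF subgroup_M y(1) z(1)] by blast
  qed
  then show ?thesis using V by (intro bexI[OF _ V(1)] conjI) blast+
qed

text \<open>Modulo squares \<open>M\<close> has 2^(card I) classes, while Z^2/2Z^2 has four. The
  case n = 2 of \<open>congruence_neighbourhood\<close> gives injections both ways between subsets
  of \<open>I\<close> and pairs of parities.\<close>

lemma card_I: "card I = 2"
proof -
  obtain V where V: "V \<in> FIN" "\<And>v. (v, 0) \<in> V \<Longrightarrow> \<exists>w. v = 2 *s w"
    "\<And>h v. h \<in> M \<Longrightarrow> rel V h (v, 0) \<Longrightarrow> (\<exists>z\<in>M. h = z [^] (2::int)) \<longleftrightarrow> (\<exists>w. v = 2 *s w)"
    using congruence_neighbourhood[of 2] by auto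
  have even_iff: "(\<exists>w. v = 2 *s w) \<longleftrightarrow> even (v$1) \<and> even (v$2)" for v :: "int^2"
  proof
    assume "even (v$1) \<and> even (v$2)"
    then have "v = 2 *s (\<chi> i. v$i div 2)" by (simp add: vec2_eq)
    then show "\<exists>w. v = 2 *s w" by blast
  qed auto
  have cong: "(\<forall>i\<in>I. even (c i - d i)) \<longleftrightarrow> even (v$1 - w$1) \<and> even (v$2 - w$2)"
    if "rel V (L c) (v, 0)" "rel V (L d) (w, 0)" for c d v w
  proof -
    have "rel V (L (\<lambda>i. c i - d i)) (v - w, 0)" using rel_mult[OF that(1) rel_inv[OF that(2)]] by (simp add: L_diff)
    from V(3)[OF L_M this] show ?thesis unfolding L_power_iff even_iff by simp
  qed
  define c where "c S = (\<lambda>i. if i \<in> S then 1 else 0 :: int)" for S :: "'i set"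
  have "\<exists>v. rel V (L (c S)) (v, 0)" for S using M_rel[OF L_M V(1)] by metis
  then obtain v where v: "\<And>S. rel V (L (c S)) (v S, 0)" by metis
  have "inj_on (\<lambda>S. (even (v S $ 1), even (v S $ 2))) (Pow I)"
  proof (rule inj_onI)
    fix S T assume ST: "S \<in> Pow I" "T \<in> Pow I" "(even (v S $ 1), even (v S $ 2)) = (even (v T $ 1), even (v T $ 2))"
    then have "\<forall>i\<in>I. even (c S i - c T i)" unfolding cong[OF v v] by auto
    then have "i \<in> S \<longleftrightarrow> i \<in> T" if "i \<in> I" for i using that unfolding c_def by (auto split: if_splits)
    then show "S = T" using ST by blast
  qed
  then have "card (Pow I) \<le> card (UNIV :: (bool \<times> bool) set)"
    by (rule card_inj_on_le) auto
  then have le: "2 ^ card I \<le> (4::nat)" using fin_I by (simp add: card_Pow card_prod UNIV_bool flip: UNIV_Times_UNIV)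
  define u where "u p = (vector [of_bool (fst p), of_bool (snd p)] :: int^2)" for p
  have "\<exists>c. rel V (L c) (u p, 0)" for p using M_dense[OF ext V(1), of "u p"] M_eq_L by metis
  then obtain d where d: "\<And>p. rel V (L (d p)) (u p, 0)" by metis
  have "inj (\<lambda>p. {i \<in> I. odd (d p i)})"
  proof (rule injI)
    fix p q assume pq: "{i \<in> I. odd (d p i)} = {i \<in> I. odd (d q i)}"
    then have "\<forall>i\<in>I. even (d p i - d q i)" by auto
    then have "even (u p $ 1 - u q $ 1) \<and> even (u p $ 2 - u q $ 2)" unfolding cong[OF d d] .
    then show "p = q" unfolding u_def by (cases p; cases q) (auto simp: vector_2 of_bool_def split: if_splits)
  qed
  then have "card (UNIV :: (bool \<times> bool) set) \<le> card (Pow I)"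
    using fin_I by (intro card_inj_on_le[of "\<lambda>p. {i \<in> I. odd (d p i)}"]) auto
  then have "4 \<le> (2::nat) ^ card I" using fin_I by (simp add: card_Pow card_prod UNIV_bool flip: UNIV_Times_UNIV)
  with le have "(2::nat) ^ card I = 2 ^ 2" by simp
  then show ?thesis by (subst (asm) power_inject_exp) simp_all
qed

end

context torus_relation begin

lemma exists_structure: "\<exists>s (I::'h set) L. torus_structure H A rel s I L"
proof -
  let ?M = "H\<lparr>carrier := M\<rparr>"
  interpret Mg: group ?M by (rule H.subgroup_imp_group[OF subgroup_M])
  interpret M: comm_group ?M by (rule Mg.group_comm_groupI) (simp add: M_comm)
  have pow: "x [^]\<^bsub>?M\<^esub> n = x [^] n" if "x \<in> M" for x and n :: int
    using H.int_pow_consistent[OF subgroup_M that] by simp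
  have Msub: "M \<subseteq> carrier H" using M_carrier by blast
  obtain F where F: "finite F" "F \<subseteq> M" "M = generate H F"
    using H.poly_cyc_fin_subgroup_fg[OF poly_cyc_fin_H subgroup_M Msub] by blast
  have gen: "carrier ?M = generate ?M F" using H.generate_consistent[OF F(2) subgroup_M] F(3) by simp
  have tf: "x = \<one>\<^bsub>?M\<^esub>" if "x \<in> carrier ?M" "n \<noteq> 0" "x [^]\<^bsub>?M\<^esub> (n::int) = \<one>\<^bsub>?M\<^esub>" for x n
    using M_torsion_free that pow by simp
  have Fc: "F \<subseteq> carrier ?M" using F(2) by simp
  have "\<exists>(I :: 'h set) e. finite I \<and> e \<in> I \<rightarrow> carrier ?M \<and> carrier ?M = range (M.lincomb e I) \<and>
      (\<forall>c. M.lincomb e I c = \<one>\<^bsub>?M\<^esub> \<longrightarrow> (\<forall>i\<in>I. c i = 0))"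
  proof (rule M.torsion_free_basis[OF _ F(1) Fc gen])
    fix x and n :: int assume "x \<in> carrier ?M" "n \<noteq> 0" "x [^]\<^bsub>?M\<^esub> n = \<one>\<^bsub>?M\<^esub>"
    then show "x = \<one>\<^bsub>?M\<^esub>" by (rule tf)
  qed
  then obtain I :: "'h set" and e where basis: "finite I \<and> e \<in> I \<rightarrow> carrier ?M \<and> carrier ?M = range (M.lincomb e I) \<and>
      (\<forall>c. M.lincomb e I c = \<one>\<^bsub>?M\<^esub> \<longrightarrow> (\<forall>i\<in>I. c i = 0))"
    by (elim exE) (rule that)
  note I = conjunct1[OF basis] conjunct1[OF conjunct2[OF basis]] conjunct1[OF conjunct2[OF conjunct2[OF basis]]]
  have ind: "\<And>c i. M.lincomb e I c = \<one>\<^bsub>?M\<^esub> \<Longrightarrow> i \<in> I \<Longrightarrow> c i = 0" using conjunct2[OF conjunct2[OF conjunct2[OF basis]]] by blast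
  obtain s where s: "H.inf_cyclic_ext M s (carrier H)" using exists_generator by blast
  have "torus_structure H A rel s I (M.lincomb e I)"
  proof (unfold_locales)
    show "H.inf_cyclic_ext M s (carrier H)" by (rule s)
    show "finite I" by (rule I(1))
    show "M = range (M.lincomb e I)" using I(3) by simp
    fix c d :: "'h \<Rightarrow> int" and k :: int
    show "M.lincomb e I (\<lambda>i. c i + d i) = M.lincomb e I c \<otimes> M.lincomb e I d" using M.lincomb_add[OF I(2)] by simp
    show "M.lincomb e I (\<lambda>i. k * c i) = M.lincomb e I c [^] k"
      using M.lincomb_smult[OF I(2)] pow M.lincomb_closed[OF I(2), of c] by simp
    show "M.lincomb e I c = M.lincomb e I d \<longleftrightarrow> (\<forall>i\<in>I. c i = d i)"
      using M.lincomb_inj[OF I(2) conjunct2[OF conjunct2[OF conjunct2[OF basis]]]] M.lincomb_cong[OF I(2)] by metis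
  qed
  then show ?thesis by blast
qed

end

section \<open>Recovering the monodromy\<close>

definition cols :: "int^2 \<Rightarrow> int^2 \<Rightarrow> int^2^2"
  where "cols a b = (\<chi> i j. if j = 1 then a$i else b$i)"

lemma cols_mult: "cols a b *v v = v$1 *s a + v$2 *s b"
  by (simp add: vec2_eq cols_def matrix_vector_mult_def sum_2 mult.commute)

lemma vec2_axis: "v = v$1 *s axis 1 1 + v$2 *s axis 2 1" for v :: "int^2"
  by (simp add: vec2_eq axis_def)

lemma additive_matrix:
  fixes f :: "int^2 \<Rightarrow> int^2"
  assumes add: "\<And>v w. f (v + w) = f v + f w"
  shows "\<exists>B. \<forall>v. f v = B *v v"
proof -
  have 0: "f 0 = 0" using add[of 0 0] by simp
  have diff: "f (v - w) = f v - f w" for v w using add[of "v - w" w] by simp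
  have smult: "f (k *s v) = k *s f v" for k v
  proof (induction k rule: int_induct[of _ 0])
    case base
    then show ?case by (simp add: 0)
  next
    case (step1 i)
    then show ?case by (simp add: smult_Suc add)
  next
    case (step2 i)
    then show ?case by (simp add: smult_pred diff)
  qed
  have "f v = cols (f (axis 1 1)) (f (axis 2 1)) *v v" for v
    by (subst vec2_axis[of v]) (simp only: add smult cols_mult)
  then show ?thesis by blast
qed

lemma trace_2: "trace (A :: 'a::comm_ring_1^2^2) = A$1$1 + A$2$2"
  by (simp add: trace_def sum_2)

lemma matrix_2_eq: "(A :: 'a^2^2) = B \<longleftrightarrow> A$1$1 = B$1$1 \<and> A$1$2 = B$1$2 \<and> A$2$1 = B$2$1 \<and> A$2$2 = B$2$2"
  by (auto simp: vec_eq_iff forall_2)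

lemma mult_2: 
  fixes A B :: "int^2^2"
  shows "(A ** B)$1$1 = A$1$1 * B$1$1 + A$1$2 * B$2$1" "(A ** B)$1$2 = A$1$1 * B$1$2 + A$1$2 * B$2$2"
    "(A ** B)$2$1 = A$2$1 * B$1$1 + A$2$2 * B$2$1" "(A ** B)$2$2 = A$2$1 * B$1$2 + A$2$2 * B$2$2"
  by (simp_all add: matrix_matrix_mult_def sum_2)

definition mcong :: "int \<Rightarrow> int^2^2 \<Rightarrow> int^2^2 \<Rightarrow> bool"
  where "mcong n X Y \<longleftrightarrow> (\<forall>i j. [X$i$j = Y$i$j] (mod n))"

lemma mcongI:
  assumes "\<And>v. \<exists>w. X *v v - Y *v v = n *s w"
  shows "mcong n X Y"
proof -
  have col: "(X *v axis j 1)$i = X$i$j" for X :: "int^2^2" and i j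
    using exhaust_2[of j] by (auto simp: matrix_vector_mult_def sum_2 axis_def)
  have "[X$i$j = Y$i$j] (mod n)" for i j
  proof -
    obtain w where "X *v axis j 1 - Y *v axis j 1 = n *s w" using assms by blast
    then have "(X *v axis j 1 - Y *v axis j 1)$i = (n *s w)$i" by simp
    then have "X$i$j - Y$i$j = n * w$i" by (simp add: col)
    then show ?thesis by (simp add: cong_iff_dvd_diff)
  qed
  then show ?thesis by (simp add: mcong_def)
qed

lemma mcong_det: "mcong n X Y \<Longrightarrow> [det X = det Y] (mod n)"
  unfolding mcong_def det_2 by (intro cong_diff cong_mult) auto

text \<open>Multiplying \<open>P ** B - C ** P\<close> by the adjugate of \<open>P\<close> shows that congruence conjugates have congruent traces.\<close>
lemma mcong_conjugate:
  assumes PB: "mcong n (P ** B) (C ** P)" and PQ: "mcong n (P ** Q) (mat 1)"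
  shows "[det B = det C] (mod n)" "[trace B = trace C] (mod n)"
proof -
  have "[det P * det Q = 1] (mod n)" using mcong_det[OF PQ] by (simp add: det_mul det_I)
  then have cancel: "[x = y] (mod n)" if "[det P * x = det P * y] (mod n)" for x y
  proof -
    assume u: "[det P * det Q = 1] (mod n)"
    have "[x = (det P * det Q) * x] (mod n)" using cong_mult[OF cong_sym[OF u] cong_refl[of x]] by simp
    also have "[(det P * det Q) * x = (det P * det Q) * y] (mod n)"
      using cong_mult[OF cong_refl[of "det Q"] that] by (simp add: mult_ac)
    also have "[(det P * det Q) * y = y] (mod n)" using cong_mult[OF u cong_refl[of y]] by simp
    finally show ?thesis .
  qed
  have "[det P * det B = det P * det C] (mod n)" using mcong_det[OF PB] by (simp add: det_mul mult.commute)
  then show "[det B = det C] (mod n)" by (rule cancel)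
  \<comment> \<open>The trace of the adjugate of \<open>P\<close> times \<open>X\<close>.\<close>
  define adj where "adj X = P$2$2 * X$1$1 - P$1$2 * X$2$1 - P$2$1 * X$1$2 + P$1$1 * X$2$2" for X :: "int^2^2"
  have "[adj (P ** B) = adj (C ** P)] (mod n)"
    unfolding adj_def using PB unfolding mcong_def by (intro cong_add cong_diff cong_mult cong_refl) blast+
  moreover have "adj (P ** B) = det P * trace B" "adj (C ** P) = det P * trace C"
    by (simp_all add: adj_def mult_2 det_2 trace_2 algebra_simps)
  ultimately show "[trace B = trace C] (mod n)" using cancel by metis
qed

text \<open>By Cayley-Hamilton the square of A is t A + 1, so multiplication by it changes a trace
  by a multiple of t, and likewise for the inverse. Steps of two from A reach all odd
  exponents.\<close>

lemma act_odd:
  assumes A: "invertible A" "det A = -1" and i: "odd i"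
  shows "\<exists>C. (\<forall>v. act A i v = C *v v) \<and> det C = -1 \<and> trace A dvd trace C"
proof -
  have d: "A$1$1 * A$2$2 = A$1$2 * A$2$1 - 1" using A(2) by (simp add: det_2)
  \<comment> \<open>This is A - t, the inverse of A because A (A - t) = 1.\<close>
  define R where "R = (\<chi> i j. if i = j then A$i$j - trace A else A$i$j)"
  have Re: "R$1$1 = - A$2$2" "R$2$2 = - A$1$1" "R$1$2 = A$1$2" "R$2$1 = A$2$1"
    by (simp_all add: R_def trace_2)
  have RA: "R ** A = mat 1" "A ** R = mat 1"
    by (simp_all add: matrix_2_eq mult_2 R_def trace_2 mat_def algebra_simps d)
  have detR: "det R = -1" by (simp add: det_2 R_def trace_2 algebra_simps d)
  have Rv: "act A (-1) v = R *v v" for v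
  proof -
    have "act A (-1) v = R *v (A *v act A (-1) v)" by (simp add: matrix_vector_mul_assoc RA)
    also have "A *v act A (-1) v = v" using act_inverse(1)[OF A(1), of 1 v] by (simp add: act_1[OF A(1)])
    finally show ?thesis .
  qed
  have step: "act A (1 + m) v = A *v act A m v" "act A (-1 + m) v = R *v act A m v" for m v
    by (simp_all only: act_add[OF A(1)] act_1[OF A(1)] Rv)
  obtain k where k: "i = 2 * k + 1" using i by (elim oddE)
  show ?thesis unfolding k
  proof (induction k rule: int_induct[of _ 0])
    case base
    show ?case using A by (intro exI[of _ A]) (simp add: act_1)
  next
    case (step1 k)
    then obtain C where C: "\<And>v. act A (2 * k + 1) v = C *v v" "det C = -1" "trace A dvd trace C" by blast
    have "act A (2 * (k + 1) + 1) v = (A ** (A ** C)) *v v" for v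
    proof -
      have "2 * (k + 1) + 1 = 1 + (1 + (2 * k + 1))" by simp
      then show ?thesis by (simp only: step C(1) matrix_vector_mul_assoc)
    qed
    moreover have "det (A ** (A ** C)) = -1" by (simp add: det_mul A C)
    moreover have "trace (A ** (A ** C)) = trace A * trace (A ** C) + trace C"
      using d unfolding trace_2 mult_2 by algebra
    then have "trace A dvd trace (A ** (A ** C))" using C(3) by simp
    ultimately show ?case by blast
  next
    case (step2 k)
    then obtain C where C: "\<And>v. act A (2 * k + 1) v = C *v v" "det C = -1" "trace A dvd trace C" by blast
    have "act A (2 * (k - 1) + 1) v = (R ** (R ** C)) *v v" for v
    proof -
      have "2 * (k - 1) + 1 = -1 + (-1 + (2 * k + 1))" by simp
      then show ?thesis by (simp only: step C(1) matrix_vector_mul_assoc)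
    qed
    moreover have "det (R ** (R ** C)) = -1" by (simp add: det_mul detR C)
    moreover have "trace (R ** (R ** C)) = - trace A * trace (R ** C) + trace C"
      using d unfolding trace_2 mult_2 Re by algebra
    then have "trace A dvd trace (R ** (R ** C))" using C(3) by simp
    ultimately show ?case by blast
  qed
qed

section \<open>The monodromy of H and its determinant and trace\<close>

locale torus_model = torus_structure H A rel s I L
  for H :: "'h monoid" (structure) and A rel s and I :: "'i set" and L +
  fixes E :: "int^2 \<Rightarrow> 'h"
  assumes range_E: "M = range E" and E_add: "E (v + w) = E v \<otimes> E w" and inj_E: "inj E"
begin

lemma E_M: "E v \<in> M" and E_carrier [simp]: "E v \<in> carrier H"
  using range_E M_carrier by auto

lemma M_eq_E: "h \<in> M \<Longrightarrow> \<exists>v. h = E v"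
  unfolding range_E by auto

lemma s_in [simp]: "s \<in> carrier H" by (rule s_carrier)

lemma E_0: "E 0 = \<one>"
  using E_add[of 0 0] H.l_cancel_one[of "E 0" "E 0"] by simp

lemma E_uminus: "E (- v) = inv (E v)"
  using E_add[of "- v" v] E_0 by (metis E_carrier H.inv_equality add.left_inverse)

lemma E_smult: "E (k *s v) = E v [^] (k::int)"
proof (induction k rule: int_induct[of _ 0])
  case base
  then show ?case by (simp add: E_0)
next
  case (step1 i)
  then show ?case by (simp add: smult_Suc E_add H.int_pow_mult)
next
  case (step2 i)
  then show ?case using E_add[of "i *s v" "- v"] by (simp add: smult_pred E_uminus H.int_pow_diff)
qed

lemma conj_matrix:
  assumes g: "g \<in> carrier H"
  shows "\<exists>B. \<forall>v. g \<otimes> E v \<otimes> inv g = E (B *v v)"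
proof -
  have "\<exists>w. g \<otimes> E v \<otimes> inv g = E w" for v using M_eq_E[OF conj_M[OF g E_M]] .
  then obtain f where f: "\<And>v. g \<otimes> E v \<otimes> inv g = E (f v)" by metis
  have "E (f (v + w)) = E (f v + f w)" for v w
    unfolding E_add f[symmetric] using g by (simp add: H.m_assoc)
  then have "f (v + w) = f v + f w" for v w using inj_E by (simp add: inj_eq)
  then obtain B where "\<forall>v. f v = B *v v" using additive_matrix by blast
  then show ?thesis using f by metis
qed

lemma exists_monodromy: "\<exists>B. invertible B \<and> (\<forall>v. s \<otimes> E v \<otimes> inv s = E (B *v v))"
proof -
  obtain B where B: "\<And>v. s \<otimes> E v \<otimes> inv s = E (B *v v)" using conj_matrix[OF s_in] by blast
  obtain B' where B': "\<And>v. inv s \<otimes> E v \<otimes> inv (inv s) = E (B' *v v)" using conj_matrix[OF H.inv_closed[OF s_in]] by blast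
  have "E (B *v (B' *v v)) = E v" for v unfolding B[symmetric] B'[symmetric] by (simp add: H.m_assoc)
  then have "B ** B' = mat 1"
    using inj_E by (simp add: matrix_eq inj_eq flip: matrix_vector_mul_assoc)
  moreover have "E (B' *v (B *v v)) = E v" for v unfolding B[symmetric] B'[symmetric] by (simp add: H.m_assoc)
  then have "B' ** B = mat 1"
    using inj_E by (simp add: matrix_eq inj_eq flip: matrix_vector_mul_assoc)
  ultimately show ?thesis unfolding invertible_def using B by blast
qed

context
  fixes B :: "int^2^2"
  assumes inv_B: "invertible B" and B: "\<And>v. s \<otimes> E v \<otimes> inv s = E (B *v v)"
begin

lemma conj_s_pow: "s [^] i \<otimes> E v \<otimes> inv (s [^] i) = E (act B i v)"
proof (induction i arbitrary: v rule: int_induct[of _ 0])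
  case base
  show ?case by (simp add: act_0[OF inv_B])
next
  case (step1 i)
  have "s [^] (i + 1) \<otimes> E v \<otimes> inv (s [^] (i + 1)) = s [^] i \<otimes> (s \<otimes> E v \<otimes> inv s) \<otimes> inv (s [^] i)"
    by (simp add: H.int_pow_mult H.m_assoc H.inv_mult_group)
  also have "\<dots> = E (act B i (B *v v))" by (simp only: B step1)
  finally show ?case by (simp add: act_add[OF inv_B] act_1[OF inv_B])
next
  case (step2 i)
  define w where "w = act B (-1) v"
  have "v = B *v w" using act_inverse(1)[OF inv_B, of 1 v] by (simp add: w_def act_1[OF inv_B])
  then have "s [^] (i - 1) \<otimes> E v \<otimes> inv (s [^] (i - 1)) = s [^] (i - 1) \<otimes> (s \<otimes> E w \<otimes> inv s) \<otimes> inv (s [^] (i - 1))"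
    by (simp only: B)
  also have "\<dots> = s [^] i \<otimes> E w \<otimes> inv (s [^] i)"
    by (simp add: H.int_pow_diff H.m_assoc H.inv_mult_group)
  also have "\<dots> = E (act B i w)" by (rule step2)
  finally show ?case by (simp add: w_def flip: act_add[OF inv_B])
qed

lemma model_iso: "(\<lambda>(v, i). E v \<otimes> s [^] (i::int)) \<in> iso (mapping_torus_group B) H"
proof -
  let ?f = "\<lambda>(v, i). E v \<otimes> s [^] (i::int)"
  have "?f \<in> hom (mapping_torus_group B) H"
  proof (rule homI)
    fix x y :: "(int^2) \<times> int"
    obtain v i w j where xy: "x = (v, i)" "y = (w, j)" by (cases x; cases y)
    have "E v \<otimes> s [^] i \<otimes> (E w \<otimes> s [^] j) = E v \<otimes> (s [^] i \<otimes> E w \<otimes> inv (s [^] i)) \<otimes> s [^] (i + j)"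
      by (simp add: H.m_assoc H.int_pow_mult)
    then show "?f (x \<otimes>\<^bsub>mapping_torus_group B\<^esub> y) = ?f x \<otimes> ?f y"
      by (simp add: xy mapping_torus_simps[OF inv_B] conj_s_pow E_add)
  qed auto
  moreover have "inj_on ?f UNIV"
  proof (rule injI)
    fix x y :: "(int^2) \<times> int"
    assume eq: "?f x = ?f y"
    obtain v i w j where xy: "x = (v, i)" "y = (w, j)" by (cases x; cases y)
    have "E v = E w \<and> i = j"
      by (rule H.inf_cyclic_ext_unique[OF ext E_M E_M]) (use eq xy in simp)
    then show "x = y" using inj_E xy by (simp add: inj_eq)
  qed
  moreover have "?f ` UNIV = carrier H"
  proof
    show "carrier H \<subseteq> ?f ` UNIV"
    proof
      fix h assume "h \<in> carrier H"
      then obtain n i where n: "n \<in> M" "h = n \<otimes> s [^] (i::int)" using H.inf_cyclic_ext_decomp[OF ext] by metis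
      then obtain v where "n = E v" using M_eq_E by blast
      then have "h = ?f (v, i)" using n(2) by simp
      then show "h \<in> ?f ` UNIV" by blast
    qed
  qed auto
  ultimately show ?thesis by (simp add: iso_def bij_betw_def mapping_torus_simps[OF inv_B])
qed

lemma rel_columns:
  assumes "rel V (E a) (b, 0)" "rel V (E a') (b', 0)"
  shows "rel V (E (cols a a' *v v)) (cols b b' *v v, 0)"
  using rel_mult[OF rel_pow[OF assms(1), of "v$1"] rel_pow[OF assms(2), of "v$2"]]
  by (simp add: cols_mult E_add E_smult)

text \<open>\<open>P\<close> and \<open>Q\<close> express, modulo \<open>n\<close>, the
  identification of \<open>M\<close> with the fibre in the quotient by \<open>V\<close>, in both
  directions. Conjugation by \<open>s\<close> acts on the fibre as the u-th power of
  \<open>A\<close>, and conjugation by a lift of (0, 1) acts on \<open>M\<close> as the i-th power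
  of \<open>B\<close>. These powers enter through matrices \<open>C\<close> representing them,
  because \<open>act\<close> is a map.\<close>

lemma congruence_conjugation:
  assumes n: "n > 0"
  shows "\<exists>P Q u i. odd u \<and> odd i \<and> mcong (int n) (P ** Q) (mat 1) \<and>
    (\<forall>C. (\<forall>v. act A u v = C *v v) \<longrightarrow> mcong (int n) (P ** B) (C ** P)) \<and>
    (\<forall>C. (\<forall>v. act B i v = C *v v) \<longrightarrow> mcong (int n) (P ** C) (A ** P))"
proof -
  obtain V where V: "V \<in> FIN" "\<And>v k. (v, k) \<in> V \<Longrightarrow> even k" "\<And>v. (v, 0) \<in> V \<Longrightarrow> \<exists>w. v = int n *s w"
    using congruence_neighbourhood[OF n] by blast
  have vec: "\<exists>w. v - v' = int n *s w" if "rel V h (v, 0)" "rel V h (v', 0)" for h v v'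
    using rel_coset[OF that] V(3) by simp
  obtain p1 p2 where p: "rel V (E (axis 1 1)) (p1, 0)" "rel V (E (axis 2 1)) (p2, 0)"
    using M_rel[OF E_M V(1)] by metis
  define P where "P = cols p1 p2"
  have id: "cols (axis 1 1) (axis 2 1) *v v = v" for v unfolding cols_mult by (rule vec2_axis[symmetric])
  have P: "rel V (E v) (P *v v, 0)" for v using rel_columns[OF p, of v] by (simp add: P_def id)
  have "\<exists>q. rel V (E q) (v, 0)" for v using M_dense[OF ext V(1)] M_eq_E by metis
  then obtain q1 q2 where q: "rel V (E q1) (axis 1 1, 0)" "rel V (E q2) (axis 2 1, 0)" by metis
  define Q where "Q = cols q1 q2"
  have Q: "rel V (E (Q *v v)) (v, 0)" for v using rel_columns[OF q, of v] by (simp add: Q_def id)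
  have PQ: "mcong (int n) (P ** Q) (mat 1)"
  proof (rule mcongI)
    show "\<exists>w. P ** Q *v v - mat 1 *v v = int n *s w" for v
      using vec[OF P[of "Q *v v"] Q[of v]] by (simp add: matrix_vector_mul_assoc)
  qed
  obtain w u where wu: "rel V s (w, u)" using rel_left[OF V(1) s_in] by (metis prod.collapse)
  obtain z where z: "rel V z (0, 1)" using rel_right[OF V(1), of "(0, 1)"] by auto
  have zc: "z \<in> carrier H" using rel_carrier[OF z] by blast
  obtain y i where yi: "y \<in> M" "z = y \<otimes> s [^] (i::int)" by (rule H.inf_cyclic_ext_decomp[OF ext zc])
  obtain y' where y': "rel V y (y', 0)" using M_rel[OF yi(1) V(1)] .
  \<comment> \<open>Last coordinates are multiplied by \<open>u * i\<close> on the way from G to H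
    and back, and \<open>V\<close> sees their parity.\<close>
  have "odd (u * i)"
  proof -
    define g where "g = (y', 0) \<otimes>\<^bsub>G\<^esub> (w, u) [^]\<^bsub>G\<^esub> i"
    have "rel V z g" unfolding g_def yi(2) by (rule rel_mult[OF y' rel_pow[OF wu]])
    then have "g \<otimes>\<^bsub>G\<^esub> inv\<^bsub>G\<^esub> (0, 1) \<in> V" by (rule rel_coset[OF _ z])
    moreover have "snd (g \<otimes>\<^bsub>G\<^esub> inv\<^bsub>G\<^esub> (0, 1)) = u * i - 1" by (simp add: g_def mult.commute)
    ultimately have "even (u * i - 1)" using V(2) by (metis prod.collapse)
    then show ?thesis by simp
  qed
  then have odd: "odd u" "odd i" by auto
  have PB: "mcong (int n) (P ** B) (C ** P)" if C: "\<forall>v. act A u v = C *v v" for C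
  proof (rule mcongI)
    fix v
    have "rel V (E (B *v v)) (act A u (P *v v), 0)"
      using rel_mult[OF rel_mult[OF wu P[of v]] rel_inv[OF wu]] mapping_torus_conj[OF inv_A, of w u "P *v v"]
      unfolding B[symmetric] by metis
    from vec[OF P[of "B *v v"] this] show "\<exists>w. P ** B *v v - C ** P *v v = int n *s w"
      using C by (simp add: matrix_vector_mul_assoc)
  qed
  have PA: "mcong (int n) (P ** C) (A ** P)" if C: "\<forall>v. act B i v = C *v v" for C
  proof (rule mcongI)
    fix v
    have "z \<otimes> E v \<otimes> inv z = y \<otimes> (s [^] i \<otimes> E v \<otimes> inv (s [^] i)) \<otimes> inv y"
      using M_carrier[OF yi(1)] by (simp add: yi(2) H.m_assoc H.inv_mult_group)
    also have "\<dots> = y \<otimes> E (C *v v) \<otimes> inv y" using C by (simp only: conj_s_pow)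
    also have "\<dots> = E (C *v v)"
      using M_comm[OF yi(1) E_M] M_carrier[OF yi(1)] by (simp add: H.m_assoc)
    finally have "z \<otimes> E v \<otimes> inv z = E (C *v v)" .
    moreover have "rel V (z \<otimes> E v \<otimes> inv z) (A *v (P *v v), 0)"
      using rel_mult[OF rel_mult[OF z P[of v]] rel_inv[OF z]] mapping_torus_conj[OF inv_A, of 0 1 "P *v v"]
      unfolding act1 by metis
    ultimately have "rel V (E (C *v v)) (A *v (P *v v), 0)" by simp
    from vec[OF P[of "C *v v"] this] show "\<exists>w. P ** C *v v - A ** P *v v = int n *s w"
      by (simp add: matrix_vector_mul_assoc)
  qed
  show ?thesis using odd PQ PB PA by blast
qed

text \<open>Already the modulus 3 separates the possible determinants 1 and -1.\<close>

lemma det_B: "det B = -1"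
proof -
  obtain P Q u where P: "odd u" "mcong 3 (P ** Q) (mat 1)"
    "\<And>C. (\<forall>v. act A u v = C *v v) \<Longrightarrow> mcong 3 (P ** B) (C ** P)"
    using congruence_conjugation[of 3] by auto
  obtain C where C: "\<forall>v. act A u v = C *v v" "det C = -1" using act_odd[OF inv_A det_A P(1)] by blast
  have "[det B = -1] (mod 3)" using mcong_conjugate(1)[OF P(3)[OF C(1)] P(2)] C(2) by simp
  moreover have "det B dvd 1"
    using inv_B by (auto simp: invertible_def dvd_def) (metis det_I det_mul)
  then have "\<bar>det B\<bar> = 1" by simp
  ultimately show ?thesis by (auto simp: abs_if cong_def split: if_splits)
qed

text \<open>Modulo the trace of \<open>A\<close>, the trace of \<open>B\<close> is that of an odd
  power of \<open>A\<close> and hence 0; the same holds with the roles exchanged. Mutual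
  divisibility leaves only the sign open.\<close>

lemma trace_B: "\<bar>trace B\<bar> = \<bar>trace A\<bar>"
proof -
  have 1: "trace A dvd trace B"
  proof -
    define n where "n = nat \<bar>trace A\<bar>"
    have n: "n > 0" "int n dvd trace A" "trace A dvd int n" using trace_A by (simp_all add: n_def)
    obtain P Q u where P: "odd u" "mcong (int n) (P ** Q) (mat 1)"
      "\<And>C. (\<forall>v. act A u v = C *v v) \<Longrightarrow> mcong (int n) (P ** B) (C ** P)"
      using congruence_conjugation[OF n(1)] by blast
    obtain C where C: "\<forall>v. act A u v = C *v v" "trace A dvd trace C" using act_odd[OF inv_A det_A P(1)] by blast
    have "[trace B = trace C] (mod (int n))" using mcong_conjugate(2)[OF P(3)[OF C(1)] P(2)] .
    then have "int n dvd trace B - trace C" by (simp add: cong_iff_dvd_diff)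
    then have "trace A dvd (trace B - trace C) + trace C" using n(3) C(2) by (meson dvd_add dvd_trans)
    then show ?thesis by simp
  qed
  have 2: "trace B dvd trace A"
  proof -
    \<comment> \<open>The first alternative excludes a vanishing trace of \<open>B\<close>: the
      modulus |t| + 1 divides t only if t = 0.\<close>
    define n where "n = (if trace B = 0 then nat \<bar>trace A\<bar> + 1 else nat \<bar>trace B\<bar>)"
    have n: "n > 0" by (simp add: n_def)
    obtain P Q i where P: "odd i" "mcong (int n) (P ** Q) (mat 1)"
      "\<And>C. (\<forall>v. act B i v = C *v v) \<Longrightarrow> mcong (int n) (P ** C) (A ** P)"
      using congruence_conjugation[OF n(1)] by blast
    obtain C where C: "\<forall>v. act B i v = C *v v" "trace B dvd trace C" using act_odd[OF inv_B det_B P(1)] by blast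
    have "[trace C = trace A] (mod (int n))" using mcong_conjugate(2)[OF P(3)[OF C(1)] P(2)] .
    then have d: "int n dvd trace C - trace A" by (simp add: cong_iff_dvd_diff)
    show ?thesis
    proof (cases "trace B = 0")
      case True
      then have "\<bar>trace A\<bar> + 1 dvd trace A" using d C(2) by (simp add: n_def add.commute)
      then have "trace A = 0" using zdvd_imp_le[of "\<bar>trace A\<bar> + 1" "\<bar>trace A\<bar>"] by auto
      then show ?thesis by simp
    next
      case False
      then have "trace B dvd trace C - trace A" using d by (simp add: n_def)
      from dvd_diff[OF C(2) this] have "trace B dvd trace C - (trace C - trace A)" .
      also have "trace C - (trace C - trace A) = trace A" by simp
      finally show ?thesis .
    qed
  qed
  show ?thesis by (rule zdvd_antisym_abs[OF 2 1])
qed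

end

end

lemma (in torus_structure) exists_model: "\<exists>E. torus_model H A rel s I L E"
proof -
  obtain i1 i2 where I: "I = {i1, i2}" "i1 \<noteq> i2" using card_I by (auto simp: card_2_iff)
  define E where "E v = L (\<lambda>i. if i = i1 then v$1 else v$2)" for v :: "int^2"
  have eq: "E v = L c \<longleftrightarrow> v$1 = c i1 \<and> v$2 = c i2" for v c
    using I by (auto simp: E_def L_eq_iff)
  have "torus_model H A rel s I L E"
  proof (unfold_locales)
    have "h \<in> range E" if h: "h \<in> M" for h
    proof -
      obtain c where "h = L c" using M_eq_L[OF h] by blast
      then have "E (vector [c i1, c i2]) = h" using eq by (simp add: vector_2)
      then show ?thesis by blast
    qed
    moreover have "E v \<in> M" for v by (simp add: E_def L_M)
    ultimately show "M = range E" by blast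
    show "E (v + w) = E v \<otimes> E w" for v w
      unfolding E_def L_add[symmetric] by (rule arg_cong[of _ _ L]) auto
    show "inj E"
    proof (rule injI)
      fix v w assume "E v = E w"
      then show "v = w" using I(2) unfolding E_def[of w] eq by (simp add: vec2_eq)
    qed
  qed
  then show ?thesis by blast
qed

theorem genus_group_is_mapping_torus:
  assumes A: "invertible A" "det A = -1" "trace A \<noteq> 0"
    and H: "polycyclic_by_finite H" "isomorphic_completions H (mapping_torus_group A)"
  shows "\<exists>B f. invertible B \<and> det B = -1 \<and> \<bar>trace B\<bar> = \<bar>trace A\<bar> \<and> f \<in> iso (mapping_torus_group B) (H :: 'h monoid)"
proof -
  have gH: "group H" using H(1) by (simp add: polycyclic_by_finite_def)
  obtain rel where rel: "completion_relation H (mapping_torus_group A) rel"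
    using isomorphic_completions_relation[OF gH group_mapping_torus_group[OF A(1)] H(2)] by blast
  have "torus_relation H A rel"
    unfolding torus_relation_def using rel A group.polycyclic_by_finite_poly_cyc_fin[OF gH H(1)] by simp
  from torus_relation.exists_structure[OF this]
  obtain s and I :: "'h set" and L where st: "torus_structure H A rel s I L" by blast
  obtain E where "torus_model H A rel s I L E" using torus_structure.exists_model[OF st] by blast
  then interpret torus_model H A rel s I L E .
  obtain B where B: "invertible B" "\<And>v. s \<otimes>\<^bsub>H\<^esub> E v \<otimes>\<^bsub>H\<^esub> inv\<^bsub>H\<^esub> s = E (B *v v)" using exists_monodromy by (elim exE conjE) (rule that, assumption, erule spec)
  show ?thesis
    by (rule exI, rule exI, rule conjI[OF B(1) conjI[OF det_B[OF B] conjI[OF trace_B[OF B] model_iso[OF B]]]])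
qed

section \<open>Mapping tori with the same trace\<close>

lemma act_intertwine:
  assumes A: "invertible A" and B: "invertible B" and P: "P ** A = B ** P"
  shows "P *v act A i v = act B i (P *v v)"
proof (induction i arbitrary: v rule: int_induct[of _ 0])
  case base
  show ?case by (simp add: act_0 A B)
next
  case (step1 i)
  have "P *v act A (i + 1) v = act B i (P *v (A *v v))" 
    by (simp add: act_add[OF A] act_1[OF A] step1)
  also have "P *v (A *v v) = B *v (P *v v)" by (simp add: matrix_vector_mul_assoc P)
  finally show ?case by (simp add: act_add[OF B] act_1[OF B])
next
  case (step2 i)
  define w where "w = act A (-1) v"
  have "v = A *v w" using act_inverse(1)[OF A, of 1 v] by (simp add: w_def act_1[OF A])
  then have "act B (i - 1) (P *v v) = act B (i - 1) (B *v (P *v w))" by (simp add: matrix_vector_mul_assoc P)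
  also have "\<dots> = act B i (P *v w)"
    using act_add[OF B, of "i - 1" 1 "P *v w"] by (simp add: act_1[OF B])
  also have "\<dots> = P *v act A i w" by (rule step2(2)[symmetric])
  also have "act A i w = act A (i - 1) v" using act_add[OF A, of i "-1" v] by (simp add: w_def)
  finally show ?case by simp
qed

text \<open>Any integral intertwiner gives a homomorphism, whatever its determinant; the limit
  construction uses those that are invertible only modulo k!.\<close>

lemma intertwiner_hom:
  assumes A: "invertible A" and B: "invertible B" and P: "P ** A = B ** P"
  shows "(\<lambda>(v, i). (P *v v, i)) \<in> hom (mapping_torus_group A) (mapping_torus_group B)"
  by (rule homI)
    (auto simp: mapping_torus_simps[OF A] mapping_torus_simps[OF B] matrix_vector_right_distrib act_intertwine[OF A B P])

lemma mapping_torus_iso_if_conjugate: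
  assumes A: "invertible A" and B: "invertible B" and P: "invertible P" "P ** A = B ** P"
  shows "mapping_torus_group A \<cong> mapping_torus_group B"
proof -
  obtain Q where Q: "P ** Q = mat 1" "Q ** P = mat 1" using P(1) by (auto simp: invertible_def)
  have "bij (\<lambda>(v, i). (P *v v, i::int))"
    by (rule bij_betw_byWitness[where f' = "\<lambda>(v, i). (Q *v v, i)"])
      (auto simp: matrix_vector_mul_assoc Q)
  then have "(\<lambda>(v, i). (P *v v, i)) \<in> iso (mapping_torus_group A) (mapping_torus_group B)"
    using intertwiner_hom[OF A B P(2)] by (simp add: iso_def mapping_torus_simps[OF A] mapping_torus_simps[OF B])
  then show ?thesis by (auto simp: is_iso_def)
qed

text \<open>Reversing the direction of the infinite cyclic factor turns \<open>A\<close> into its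
  inverse.\<close>

lemma mapping_torus_iso_inverse:
  assumes A: "invertible A" and B: "invertible B" and AB: "A ** B = mat 1" "B ** A = mat 1"
  shows "mapping_torus_group A \<cong> mapping_torus_group B"
proof -
  have neg1: "act B (-1) v = A *v v" for v
  proof -
    have "act B (-1) v = A *v (B *v act B (-1) v)" by (simp add: matrix_vector_mul_assoc AB)
    also have "B *v act B (-1) v = v" using act_inverse(1)[OF B, of 1 v] by (simp add: act_1[OF B])
    finally show ?thesis .
  qed
  have neg: "act B (- i) v = act A i v" for i v
  proof (induction i arbitrary: v rule: int_induct[of _ 0])
    case base
    show ?case by (simp add: act_0 A B)
  next
    case (step1 i)
    have "act B (- (i + 1)) v = act B (- i) (act B (-1) v)" by (simp flip: act_add[OF B])
    then show ?case by (simp add: step1 neg1 act_add[OF A] act_1[OF A])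
  next
    case (step2 i)
    have "act A (-1) v = B *v v" for v
    proof -
      have "act A (-1) v = B *v (A *v act A (-1) v)" by (simp add: matrix_vector_mul_assoc AB)
      also have "A *v act A (-1) v = v" using act_inverse(1)[OF A, of 1 v] by (simp add: act_1[OF A])
      finally show ?thesis .
    qed
    then have "act A (i - 1) v = act A i (B *v v)" using act_add[OF A, of i "-1" v] by simp
    also have "\<dots> = act B (- i) (act B 1 v)" by (simp add: step2 act_1[OF B])
    also have "\<dots> = act B (- (i - 1)) v" by (simp flip: act_add[OF B] add: add.commute)
    finally show ?case by simp
  qed
  have "(\<lambda>(v, i). (v, - i)) \<in> hom (mapping_torus_group A) (mapping_torus_group B)"
    by (rule homI) (auto simp: mapping_torus_simps[OF A] mapping_torus_simps[OF B] neg)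
  moreover have "bij (\<lambda>(v::int^2, i::int). (v, - i))"
    by (rule bij_betw_byWitness[where f' = "\<lambda>(v, i). (v, - i)"]) auto
  ultimately have "(\<lambda>(v, i). (v, - i)) \<in> iso (mapping_torus_group A) (mapping_torus_group B)"
    by (simp add: iso_def mapping_torus_simps[OF A] mapping_torus_simps[OF B])
  then show ?thesis by (auto simp: is_iso_def)
qed

text \<open>The fibre \<open>\<int>\<^sup>2\<close> is characteristic: modulo commutators, it consists of the elements of finite order.\<close>
lemma iso_preserves_fibre:
  assumes A: "invertible A" "det A = -1" "trace A \<noteq> 0" and B: "invertible B"
    and f: "f \<in> hom (mapping_torus_group A) (mapping_torus_group B)"
  shows "snd (f (v, 0)) = 0"
proof -
  interpret GA: group "mapping_torus_group A" by (rule group_mapping_torus_group[OF A(1)])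
  interpret GB: group "mapping_torus_group B" by (rule group_mapping_torus_group[OF B])
  interpret f: group_hom "mapping_torus_group A" "mapping_torus_group B" f
    using f by (simp add: group_hom_def group_hom_axioms_def GA.group_axioms GB.group_axioms)
  have c: "x \<in> carrier (mapping_torus_group A)" for x by (simp add: mapping_torus_simps[OF A(1)])
  have mult: "snd (x \<otimes>\<^bsub>mapping_torus_group B\<^esub> y) = snd x + snd y" for x y
    by (cases x; cases y) (simp add: mapping_torus_simps[OF B])
  have inv: "snd (inv\<^bsub>mapping_torus_group B\<^esub> x) = - snd x" for x
    by (cases x) (simp add: mapping_torus_inv[OF B])
  obtain w where w: "A *v w - w = trace A *s v" using fibre_trace[OF A(2)] by blast
  define a b :: "(int^2) \<times> int" where "a = (0, 1)" and "b = (w, 0)"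
  have "(v, 0) [^]\<^bsub>mapping_torus_group A\<^esub> trace A =
      a \<otimes>\<^bsub>mapping_torus_group A\<^esub> b \<otimes>\<^bsub>mapping_torus_group A\<^esub> inv\<^bsub>mapping_torus_group A\<^esub> a
        \<otimes>\<^bsub>mapping_torus_group A\<^esub> inv\<^bsub>mapping_torus_group A\<^esub> b"
    unfolding a_def b_def mapping_torus_conj[OF A(1)]
    by (simp add: mapping_torus_pow_vec[OF A(1)] mapping_torus_inv[OF A(1)] mapping_torus_simps[OF A(1)]
        act_0[OF A(1)] act_1[OF A(1)] w[symmetric])
  then have "f ((v, 0) [^]\<^bsub>mapping_torus_group A\<^esub> trace A) = f a \<otimes>\<^bsub>mapping_torus_group B\<^esub> f b
      \<otimes>\<^bsub>mapping_torus_group B\<^esub> inv\<^bsub>mapping_torus_group B\<^esub> f a \<otimes>\<^bsub>mapping_torus_group B\<^esub> inv\<^bsub>mapping_torus_group B\<^esub> f b"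
    using c by simp
  then have "snd (f ((v, 0) [^]\<^bsub>mapping_torus_group A\<^esub> trace A)) = 0" by (simp add: mult inv)
  moreover have "f ((v, 0) [^]\<^bsub>mapping_torus_group A\<^esub> trace A) = f (v, 0) [^]\<^bsub>mapping_torus_group B\<^esub> trace A"
    by (rule f.hom_int_pow[OF c])
  ultimately show ?thesis using A(3) by (simp add: mapping_torus_pow_snd[OF B])
qed

text \<open>An isomorphism preserves the fibres, so it restricts to an invertible \<open>P\<close>
  there, and the generator acquires last coordinate u = 1 or u = -1. The second case would make
  \<open>A\<close> conjugate to the inverse of \<open>B\<close>, whose trace is the negative of the
  nonzero common trace.\<close>

lemma conjugate_if_mapping_torus_iso:
  assumes A: "invertible A" "det A = -1" and B: "invertible B" "det B = -1"
    and tr: "trace A = trace B" "trace A \<noteq> 0" and iso: "mapping_torus_group A \<cong> mapping_torus_group B"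
  shows "\<exists>P. invertible P \<and> P ** A = B ** P"
proof -
  interpret GA: group "mapping_torus_group A" by (rule group_mapping_torus_group[OF A(1)])
  interpret GB: group "mapping_torus_group B" by (rule group_mapping_torus_group[OF B(1)])
  obtain f where f: "f \<in> iso (mapping_torus_group A) (mapping_torus_group B)" using iso by (auto simp: is_iso_def)
  define g where "g = inv_into (carrier (mapping_torus_group A)) f"
  have g: "g \<in> iso (mapping_torus_group B) (mapping_torus_group A)" unfolding g_def by (rule GA.iso_set_sym[OF f])
  have bij: "bij f" using f by (simp add: iso_def mapping_torus_simps[OF A(1)] mapping_torus_simps[OF B(1)])
  have fg: "f (g x) = x" "g (f y) = y" for x y
    using bij by (simp_all add: g_def mapping_torus_simps[OF A(1)] bij_is_surj surj_f_inv_f bij_is_inj)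
  have fh: "f \<in> hom (mapping_torus_group A) (mapping_torus_group B)" and gh: "g \<in> hom (mapping_torus_group B) (mapping_torus_group A)"
    using f g by (simp_all add: iso_def)
  have fm: "f (x \<otimes>\<^bsub>mapping_torus_group A\<^esub> y) = f x \<otimes>\<^bsub>mapping_torus_group B\<^esub> f y" for x y
    using fh unfolding hom_def by (simp add: mapping_torus_simps(1)[OF A(1)] del: split_paired_All)
  have gm: "g (x \<otimes>\<^bsub>mapping_torus_group B\<^esub> y) = g x \<otimes>\<^bsub>mapping_torus_group A\<^esub> g y" for x y
    using gh unfolding hom_def by (simp add: mapping_torus_simps(1)[OF B(1)] del: split_paired_All)
  have f0: "f (v, 0) = (fst (f (v, 0)), 0)" for v
    using iso_preserves_fibre[OF A tr(2) B(1) fh, of v] by (metis prod.collapse)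
  have g0: "g (v, 0) = (fst (g (v, 0)), 0)" for v
    using iso_preserves_fibre[OF B _ A(1) gh, of v] tr by (metis prod.collapse)
  have addA: "(v, 0) \<otimes>\<^bsub>mapping_torus_group A\<^esub> (w, 0) = (v + w, 0)" for v w
    by (simp add: mapping_torus_simps[OF A(1)] act_0[OF A(1)])
  have addB: "(v, 0) \<otimes>\<^bsub>mapping_torus_group B\<^esub> (w, 0) = (v + w, 0)" for v w
    by (simp add: mapping_torus_simps[OF B(1)] act_0[OF B(1)])
  have "fst (f (v + w, 0)) = fst (f (v, 0)) + fst (f (w, 0))" for v w
    using fm[of "(v, 0)" "(w, 0)"] addA addB f0 by (metis fst_conv)
  then obtain P where P: "\<And>v. fst (f (v, 0)) = P *v v" using additive_matrix[of "\<lambda>v. fst (f (v, 0))"] by blast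
  have "fst (g (v + w, 0)) = fst (g (v, 0)) + fst (g (w, 0))" for v w
    using gm[of "(v, 0)" "(w, 0)"] addA addB g0 by (metis fst_conv)
  then obtain Q where Q: "\<And>v. fst (g (v, 0)) = Q *v v" using additive_matrix[of "\<lambda>v. fst (g (v, 0))"] by blast
  have fP: "f (v, 0) = (P *v v, 0)" and gQ: "g (v, 0) = (Q *v v, 0)" for v
    using f0[of v] g0[of v] P Q by simp_all
  have "P *v (Q *v v) = v" "Q *v (P *v v) = v" for v
    using fg(1)[of "(v, 0)"] fg(2)[of "(v, 0)"] by (simp_all add: fP gQ)
  then have PQ: "P ** Q = mat 1" "Q ** P = mat 1" by (simp_all add: matrix_eq flip: matrix_vector_mul_assoc)
  then have invP: "invertible P" by (auto simp: invertible_def)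
  have sndm: "snd (f x) = snd x * snd (f (0, 1))" for x
  proof -
    obtain v k where x: "x = (v, k)" by (cases x)
    have "x = (v, 0) \<otimes>\<^bsub>mapping_torus_group A\<^esub> (0, 1) [^]\<^bsub>mapping_torus_group A\<^esub> k"
      by (simp add: x mapping_torus_pow_t[OF A(1)] mapping_torus_simps[OF A(1)] act_0[OF A(1)])
    then have "f x = f (v, 0) \<otimes>\<^bsub>mapping_torus_group B\<^esub> f (0, 1) [^]\<^bsub>mapping_torus_group B\<^esub> k"
      using hom_int_pow[OF fh] GA.group_axioms GB.group_axioms fm by (metis mapping_torus_simps(1)[OF A(1)] UNIV_I)
    moreover have "snd (x \<otimes>\<^bsub>mapping_torus_group B\<^esub> y) = snd x + snd y" for x y
      by (cases x; cases y) (simp add: mapping_torus_simps[OF B(1)])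
    ultimately show ?thesis by (simp add: fP x mapping_torus_pow_snd[OF B(1)])
  qed
  obtain w u where wu: "f (0, 1) = (w, u)" by (cases "f (0, 1)")
  have "1 = snd (g (0, 1)) * u" using sndm[of "g (0, 1)"] fg(1)[of "(0, 1)"] wu by simp
  then have "u dvd 1" by (metis dvd_triv_right)
  then have u: "u = 1 \<or> u = -1" by auto
  have conj: "P *v (A *v v) = act B u (P *v v)" for v
  proof -
    have "(A *v v, 0) \<otimes>\<^bsub>mapping_torus_group A\<^esub> (0, 1) = (0, 1) \<otimes>\<^bsub>mapping_torus_group A\<^esub> (v, 0)"
      by (simp add: mapping_torus_simps[OF A(1)] act_0[OF A(1)] act_1[OF A(1)])
    then have "f (A *v v, 0) \<otimes>\<^bsub>mapping_torus_group B\<^esub> f (0, 1) = f (0, 1) \<otimes>\<^bsub>mapping_torus_group B\<^esub> f (v, 0)"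
      by (metis fm)
    then show ?thesis by (simp add: fP wu mapping_torus_simps[OF B(1)] act_0[OF B(1)] add.commute)
  qed
  have "u = 1"
  proof (rule ccontr)
    assume "u \<noteq> 1"
    then have u: "u = -1" using u by blast
    have "B *v (P *v (A *v v)) = P *v v" for v
      unfolding conj u using act_inverse(1)[OF B(1), of 1 "P *v v"] by (simp add: act_1[OF B(1)])
    then have "B ** (P ** A) = P" by (simp add: matrix_eq flip: matrix_vector_mul_assoc)
    then have BA: "(Q ** B ** P) ** A = mat 1" by (simp add: PQ flip: matrix_mul_assoc)
    \<comment> \<open>A conjugate of \<open>B\<close> that is inverse to \<open>A\<close>. As det A
      = -1, its diagonal is that of \<open>A\<close>, exchanged and negated.\<close>
    define B' where "B' = Q ** B ** P"
    have tB: "trace B' = trace B"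
      unfolding B'_def by (metis PQ(1) trace_mul_sym matrix_mul_assoc matrix_mul_lid)
    have dA: "A$1$1 * A$2$2 - A$1$2 * A$2$1 = -1" using A(2) by (simp add: det_2)
    have e: "B'$1$1 * A$1$1 + B'$1$2 * A$2$1 = 1" "B'$1$1 * A$1$2 + B'$1$2 * A$2$2 = 0"
      "B'$2$1 * A$1$1 + B'$2$2 * A$2$1 = 0" "B'$2$1 * A$1$2 + B'$2$2 * A$2$2 = 1"
      using BA unfolding B'_def[symmetric] matrix_2_eq mult_2 by (simp_all add: mat_def)
    have "B'$1$1 = - A$2$2" using dA e(1,2) by algebra
    moreover have "B'$2$2 = - A$1$1" using dA e(3,4) by algebra
    ultimately have "trace B' = - trace A" by (simp add: trace_2)
    then show False using tB tr by simp
  qed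
  then have "P ** A = B ** P" using conj by (simp add: matrix_eq act_1[OF B(1)] flip: matrix_vector_mul_assoc)
  then show ?thesis using invP by blast
qed

section \<open>The quadratic form of cyclic vectors and its coprime values\<close>

definition companion :: "int \<Rightarrow> int^2^2"
  where "companion t = cols (vector [0, 1]) (vector [1, t])"

text \<open>The determinant of the matrix with columns v and A v; it is prime to n exactly when
  these columns generate Z^2 modulo n. For det A = -1 the form has discriminant t^2 + 4.\<close>

definition cyc_form :: "int^2^2 \<Rightarrow> int^2 \<Rightarrow> int"
  where "cyc_form A v = A$2$1 * (v$1)^2 + (A$2$2 - A$1$1) * (v$1 * v$2) - A$1$2 * (v$2)^2"

lemma det_cols_orbit: "det (cols v (A *v v)) = cyc_form A v"
  by (simp add: det_2 cols_def cyc_form_def matrix_vector_mult_def sum_2 algebra_simps power2_eq_square)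

lemma disc_eq: "det A = -1 \<Longrightarrow> (trace A)^2 - 4 * det A = (A$2$2 - A$1$1)^2 + 4 * A$1$2 * A$2$1"
  for A :: "int^2^2"
  by (simp add: det_2 trace_2 power2_eq_square algebra_simps)

lemma cyc_form_cong:
  assumes "\<And>i. [v$i = w$i] (mod n)"
  shows "[cyc_form A v = cyc_form A w] (mod n)"
  unfolding cyc_form_def using assms by (intro cong_add cong_diff cong_mult cong_refl cong_pow) auto

text \<open>The values at e1, e2 and e1 + e2 determine all three coefficients. If a prime divided
  them all, its square would divide the discriminant.\<close>

lemma cyc_form_primitive:
  assumes "det A = -1" "squarefree ((trace A)^2 - 4 * det A)" and p: "prime (p::int)"
  shows "\<exists>w. \<not> p dvd cyc_form A w"
proof (rule ccontr)
  assume "\<not> ?thesis"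
  then have all: "p dvd cyc_form A w" for w by blast
  have 1: "p dvd A$2$1" using all[of "vector [1, 0]"] by (simp add: cyc_form_def vector_2)
  have 2: "p dvd A$1$2" using all[of "vector [0, 1]"] by (simp add: cyc_form_def vector_2)
  have "p dvd A$2$1 + (A$2$2 - A$1$1) - A$1$2" using all[of "vector [1, 1]"] by (simp add: cyc_form_def vector_2)
  from dvd_add[OF dvd_diff[OF this 1] 2] have 3: "p dvd A$2$2 - A$1$1" by simp
  have "p^2 dvd (A$2$2 - A$1$1)^2 + 4 * A$1$2 * A$2$1"
    using 1 2 3 unfolding power2_eq_square
    by (intro dvd_add mult_dvd_mono) (simp_all add: mult_dvd_mono mult.assoc)
  then have "p^2 dvd (trace A)^2 - 4 * det A" unfolding disc_eq[OF assms(1)] .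
  then have "is_unit p" using assms(2) unfolding squarefree_def by blast
  then show False using p not_prime_unit by blast
qed

text \<open>Unless p already divides n, the Chinese remainder theorem keeps v modulo n and exchanges
  it modulo p for a vector at which the form is nonzero modulo p.\<close>

lemma cyc_form_extend_prime:
  assumes A: "det A = -1" "squarefree ((trace A)^2 - 4 * det A)" and p: "prime (p::int)"
    and v: "coprime (cyc_form A v) n"
  shows "\<exists>v'. (\<forall>i. [v'$i = v$i] (mod n)) \<and> coprime (cyc_form A v') (n * p)"
proof (cases "p dvd n")
  case True
  then have "coprime (cyc_form A v) p" using v by (meson coprime_divisors dvd_refl)
  then show ?thesis using v by (intro exI[of _ v]) simp
next
  case False
  then have "coprime n p" using prime_imp_coprime[OF p] by (simp add: coprime_commute)
  then obtain x where x: "[n * x = 1] (mod p)" using cong_solve_coprime_int by blast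
  obtain w where w: "\<not> p dvd cyc_form A w" using cyc_form_primitive[OF A p] by blast
  \<comment> \<open>The factor \<open>n * x\<close> is 0 modulo n and 1 modulo p.\<close>
  define v' where "v' = v + (n * x) *s (w - v)"
  have 1: "[v'$i = v$i] (mod n)" for i by (simp add: v'_def cong_iff_dvd_diff)
  have 2: "[v'$i = w$i] (mod p)" for i
  proof -
    have "[v$i + (n * x) * (w$i - v$i) = v$i + 1 * (w$i - v$i)] (mod p)"
      by (intro cong_add cong_mult cong_refl x)
    moreover have "v'$i = v$i + (n * x) * (w$i - v$i)" by (simp add: v'_def algebra_simps)
    ultimately show ?thesis by simp
  qed
  have "coprime (cyc_form A v') n"
    using cong_imp_coprime[OF cong_sym[OF cyc_form_cong[OF 1]] v] .
  moreover have "\<not> p dvd cyc_form A v'" using w cong_dvd_iff[OF cyc_form_cong[OF 2], of A] by simp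
  then have "coprime (cyc_form A v') p" using prime_imp_coprime[OF p] coprime_commute by blast
  ultimately show ?thesis using 1 by (intro exI[of _ v']) simp
qed

lemma cyc_form_extend:
  assumes A: "det A = -1" "squarefree ((trace A)^2 - 4 * det A)"
    and v: "coprime (cyc_form A v) n" and k: "(k::int) \<noteq> 0"
  shows "\<exists>v'. (\<forall>i. [v'$i = v$i] (mod n)) \<and> coprime (cyc_form A v') (n * k)"
  using k
proof (induction k rule: prime_divisors_induct)
  case (unit k)
  have "coprime (cyc_form A v) k"
    using unit by (metis coprime_commute is_unit_left_imp_coprime)
  then show ?case using v by (intro exI[of _ v]) simp
next
  case (factor p k)
  then obtain v1 where v1: "\<forall>i. [v1$i = v$i] (mod n)" "coprime (cyc_form A v1) (n * k)" by auto
  obtain v2 where v2: "\<forall>i. [v2$i = v1$i] (mod n * k)" "coprime (cyc_form A v2) (n * k * p)"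
    using cyc_form_extend_prime[OF A factor(1) v1(2)] by blast
  have "[v2$i = v$i] (mod n)" for i
    using v1(1) v2(1) cong_modulus_mult cong_trans by blast
  then show ?case using v2(2) by (intro exI[of _ v2]) (simp add: mult_ac)
qed simp

text \<open>Factorials are cofinal for divisibility, so such a coherent sequence is a vector over
  the profinite integers at which the form is a unit.\<close>

lemma coprime_sequence:
  assumes A: "det A = -1" "squarefree ((trace A)^2 - 4 * det A)"
  shows "\<exists>v :: nat \<Rightarrow> int^2. (\<forall>k. coprime (cyc_form A (v k)) (fact k)) \<and>
    (\<forall>k l i. k \<le> l \<longrightarrow> [v l $ i = v k $ i] (mod (fact k)))"
proof -
  have "\<exists>v :: nat \<Rightarrow> int^2. \<forall>k. coprime (cyc_form A (v k)) (fact k) \<and> (\<forall>i. [v (Suc k) $ i = v k $ i] (mod (fact k)))"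
  proof (rule dependent_nat_choice)
    show "\<exists>v. coprime (cyc_form A v) (fact 0)" by simp
    fix v k assume "coprime (cyc_form A v) (fact k)"
    then obtain v' where "\<forall>i. [v'$i = v$i] (mod (fact k))" "coprime (cyc_form A v') (fact k * int (Suc k))"
      using cyc_form_extend[OF A, of v "fact k" "int (Suc k)"] by auto
    then show "\<exists>v'. coprime (cyc_form A v') (fact (Suc k)) \<and> (\<forall>i. [v'$i = v$i] (mod (fact k)))"
      by (intro exI[of _ v']) (simp add: mult.commute)
  qed
  then obtain v :: "nat \<Rightarrow> int^2" where v: "\<And>k. coprime (cyc_form A (v k)) (fact k)"
    "\<And>k i. [v (Suc k) $ i = v k $ i] (mod (fact k))" by blast
  have "[v l $ i = v k $ i] (mod (fact k))" if "k \<le> l" for k l i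
    using that
  proof (induction l rule: dec_induct)
    case (step l)
    have "[v (Suc l) $ i = v l $ i] (mod (fact k))"
      using v(2)[of l i] fact_dvd[OF step(1), where 'a = int] cong_dvd_modulus by blast
    then show ?case using step cong_trans by blast
  qed simp
  then show ?thesis using v(1) by blast
qed

section \<open>Adjugates and intertwiners with the companion matrix\<close>

definition adj :: "int^2^2 \<Rightarrow> int^2^2"
  where "adj P = (\<chi> i j. if i = j then trace P - P$i$j else - P$i$j)"

lemma adj_entries: "adj P$1$1 = P$2$2" "adj P$2$2 = P$1$1" "adj P$1$2 = - P$1$2" "adj P$2$1 = - P$2$1"
  by (simp_all add: adj_def trace_2)

text \<open>By Cayley-Hamilton, A sends the pair (v, A v) to (A v, v + t A v), which is the action
  of the companion matrix. The adjugate intertwines in the opposite direction and, unlike the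
  inverse, is always integral.\<close>

lemma orbit_intertwines:
  assumes "det A = -1"
  defines "C \<equiv> companion (trace A)"
  defines "P \<equiv> \<lambda>v. cols v (A *v v)"
  shows "P v ** C = A ** P v" "adj (P v) ** A = C ** adj (P v)"
proof -
  have d: "A$1$1 * A$2$2 - A$1$2 * A$2$1 = -1" using assms(1) by (simp add: det_2)
  have C: "C$1$1 = 0" "C$1$2 = 1" "C$2$1 = 1" "C$2$2 = A$1$1 + A$2$2"
    by (simp_all add: C_def companion_def cols_def vector_2 trace_2)
  have P: "P v$1$1 = v$1" "P v$2$1 = v$2" "P v$1$2 = A$1$1 * v$1 + A$1$2 * v$2" "P v$2$2 = A$2$1 * v$1 + A$2$2 * v$2"
    by (simp_all add: P_def cols_def matrix_vector_mult_def sum_2)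
  show "P v ** C = A ** P v" unfolding matrix_2_eq mult_2 C P
    by (intro conjI; (simp add: algebra_simps; fail | use d in algebra))
  show "adj (P v) ** A = C ** adj (P v)" unfolding matrix_2_eq mult_2 adj_entries C P
    by (intro conjI; (simp add: algebra_simps; fail | use d in algebra))
qed

lemma det_companion: "det (companion t) = -1" "trace (companion t) = t"
  by (simp_all add: companion_def det_2 trace_2 cols_def vector_2)

lemma mcong_vec: "mcong n X Y \<Longrightarrow> \<exists>w. X *v v - Y *v v = n *s w"
proof -
  assume "mcong n X Y"
  then have "\<forall>i j. \<exists>k. X$i$j - Y$i$j = n * k" by (simp add: mcong_def cong_iff_dvd_diff dvd_def)
  then obtain Z where Z: "\<And>i j. X$i$j - Y$i$j = n * Z i j" by metis
  have "X *v v - Y *v v = n *s ((\<chi> i j. Z i j) *v v)"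
  proof (simp add: vec_eq_iff matrix_vector_mult_def sum_2, intro allI)
    fix i
    have "X$i$1 = Y$i$1 + n * Z i 1" "X$i$2 = Y$i$2 + n * Z i 2" using Z[of i 1] Z[of i 2] by simp_all
    then show "X$i$1 * v$1 + X$i$2 * v$2 - (Y$i$1 * v$1 + Y$i$2 * v$2) = n * (Z i 1 * v$1 + Z i 2 * v$2)"
      by (simp add: algebra_simps)
  qed
  then show ?thesis by blast
qed

text \<open>If m is an exponent of the quotient by \<open>N\<close>, then vectors congruent modulo m
  lie in the same coset, and m divides k! for all k from m on.\<close>

lemma rcoset_cong:
  assumes A: "invertible A" and N: "N \<in> finite_index_normal (mapping_torus_group A)"
  shows "\<exists>K. \<forall>k\<ge>K. \<forall>i a b. (\<exists>w. a - b = fact k *s w) \<longrightarrow>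
    N #>\<^bsub>mapping_torus_group A\<^esub> (a, i) = N #>\<^bsub>mapping_torus_group A\<^esub> (b, i)"
proof -
  interpret G: group "mapping_torus_group A" by (rule group_mapping_torus_group[OF A])
  obtain m where m: "m > 0" "\<And>g. g [^]\<^bsub>mapping_torus_group A\<^esub> (m::nat) \<in> N"
    using G.finite_index_normal_exponent[OF N] by (metis mapping_torus_simps(1)[OF A] UNIV_I)
  show ?thesis
  proof (intro exI[of _ m] allI impI)
    fix k i and a b :: "int^2" assume "m \<le> k" "\<exists>w. a - b = fact k *s w"
    moreover have "m dvd fact k" using m(1) \<open>m \<le> k\<close> by (intro dvd_fact) auto
    then have "int m dvd fact k" by (metis of_nat_dvd_iff of_nat_fact)
    then obtain q where "fact k = int m * q" by (elim dvdE)
    ultimately obtain w where w: "a - b = int m *s w" by (metis vector_smult_assoc)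
    have "(a, i) \<otimes>\<^bsub>mapping_torus_group A\<^esub> inv\<^bsub>mapping_torus_group A\<^esub> (b, i) = (a - b, 0)"
      by (simp add: mapping_torus_simps[OF A] mapping_torus_inv[OF A] act_uminus_vec[OF A] act_inverse[OF A])
    also have "\<dots> = (w, 0) [^]\<^bsub>mapping_torus_group A\<^esub> m"
      using mapping_torus_pow_vec[OF A, of w "int m"] by (simp add: w int_pow_int)
    finally show "N #>\<^bsub>mapping_torus_group A\<^esub> (a, i) = N #>\<^bsub>mapping_torus_group A\<^esub> (b, i)"
      using m(2) G.rcoset_eq_iff[OF G.finite_index_normalD(2)[OF N]] by (simp add: mapping_torus_simps(1)[OF A])
  qed
qed

text \<open>\<open>Q k\<close> is the adjugate of \<open>P k\<close> times an inverse of its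
  determinant modulo k!. Both are integral intertwiners, they are inverse to each other modulo k!,
  and both sequences stabilise modulo every fixed integer.\<close>

lemma isomorphic_completions_companion:
  assumes det: "det A = -1" and sqf: "squarefree ((trace A)^2 - 4 * det A)"
  shows "isomorphic_completions (mapping_torus_group (companion (trace A))) (mapping_torus_group A)"
proof -
  define C where "C = companion (trace A)"
  have A: "invertible A" and C: "invertible C"
    using invertible_int_matrixI[of A] invertible_int_matrixI[of C] det by (simp_all add: C_def det_companion)
  obtain v where v: "\<And>k. coprime (cyc_form A (v k)) (fact k)"
    "\<And>k l i. k \<le> l \<Longrightarrow> [v l $ i = v k $ i] (mod (fact k))"
    using coprime_sequence[OF det sqf] by blast
  have "\<exists>u. [cyc_form A (v k) * u = 1] (mod (fact k))" for k
    using cong_solve_coprime_int[OF v(1)] .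
  then obtain u where u: "\<And>k. [cyc_form A (v k) * u k = 1] (mod (fact k))" by metis
  define P where "P k = cols (v k) (A *v v k)" for k
  define Q :: "nat \<Rightarrow> int^2^2" where "Q k = (\<chi> i j. u k * adj (P k) $ i $ j)" for k
  have Qe: "Q k $ i $ j = u k * adj (P k) $ i $ j" for k i j
    by (simp add: Q_def)
  have PC: "P k ** C = A ** P k" for k using orbit_intertwines(1)[OF det, of "v k"] by (simp add: P_def C_def)
  have adjA: "adj (P k) ** A = C ** adj (P k)" for k
    using orbit_intertwines(2)[OF det, of "v k"] by (simp add: P_def C_def)
  have QA: "Q k ** A = C ** Q k" for k
    using adjA[of k] unfolding matrix_2_eq mult_2 Qe by (simp add: mult.assoc mult.left_commute flip: distrib_left)
  have dP: "det (P k) = cyc_form A (v k)" for k by (simp add: P_def det_cols_orbit)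
  have Pcong: "mcong (fact k) (P l) (P k)" if "k \<le> l" for k l
  proof -
    have "[(A *v v l)$i = (A *v v k)$i] (mod (fact k))" for i
      unfolding matrix_vector_mult_def sum_2 using v(2)[OF that] by (simp add: cong_add cong_mult cong_refl)
    then show ?thesis using v(2)[OF that] by (simp add: mcong_def P_def cols_def)
  qed
  \<comment> \<open>Inverses of congruent units are congruent, so the scalars stabilise along with
    the determinants.\<close>
  have ucong: "[u l = u k] (mod (fact k))" if "k \<le> l" for k l
  proof -
    have q: "[cyc_form A (v l) = cyc_form A (v k)] (mod (fact k))" by (rule cyc_form_cong[OF v(2)[OF that]])
    have ul: "[cyc_form A (v l) * u l = 1] (mod (fact k))"
      using u[of l] fact_dvd[OF that, where 'a = int] cong_dvd_modulus by blast
    have "[u l = u l * (cyc_form A (v k) * u k)] (mod (fact k))"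
      using cong_mult[OF cong_refl[of "u l"] cong_sym[OF u[of k]]] by simp
    also have "[u l * (cyc_form A (v k) * u k) = u l * (cyc_form A (v l) * u k)] (mod (fact k))"
      by (intro cong_mult cong_refl cong_sym[OF q])
    also have "u l * (cyc_form A (v l) * u k) = (cyc_form A (v l) * u l) * u k" by (simp add: mult_ac)
    also have "[(cyc_form A (v l) * u l) * u k = 1 * u k] (mod (fact k))" by (intro cong_mult cong_refl ul)
    finally show ?thesis by simp
  qed
  have Qcong: "mcong (fact k) (Q l) (Q k)" if "k \<le> l" for k l
  proof -
    have "mcong (fact k) (adj (P l)) (adj (P k))"
      using Pcong[OF that] unfolding mcong_def forall_2 adj_entries by (auto simp: cong_minus_minus_iff)
    then show ?thesis using ucong[OF that] unfolding mcong_def Qe by (blast intro: cong_mult)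
  qed
  have PQ: "mcong (fact k) (P k ** Q k) (mat 1)" "mcong (fact k) (Q k ** P k) (mat 1)" for k
  proof -
    define S :: "int^2^2" where "S = (\<chi> i j. if i = j then det (P k) * u k else 0)"
    have "P k ** Q k = S" "Q k ** P k = S"
      unfolding matrix_2_eq mult_2 Qe adj_entries det_2 S_def by (simp_all add: algebra_simps)
    moreover have "mcong (fact k) S (mat 1)"
      using u[of k] unfolding mcong_def dP S_def by (auto simp: mat_def forall_2)
    ultimately show "mcong (fact k) (P k ** Q k) (mat 1)" "mcong (fact k) (Q k ** P k) (mat 1)" by simp_all
  qed
  define F where "F k = (\<lambda>(w, i :: int). (P k *v w, i))" for k
  define E where "E k = (\<lambda>(w, i :: int). (Q k *v w, i))" for k
  have conv: "\<exists>K. \<forall>k\<ge>K. \<forall>h\<in>carrier G'. N #>\<^bsub>mapping_torus_group Y\<^esub> (\<lambda>(w, i). (X k *v w, i)) h =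
      N #>\<^bsub>mapping_torus_group Y\<^esub> (\<lambda>(w, i). (X K *v w, i)) h"
    if Y: "invertible Y" and N: "N \<in> finite_index_normal (mapping_torus_group Y)"
      and X: "\<And>k l. k \<le> l \<Longrightarrow> mcong (fact k) (X l) (X k)" for N X Y and G' :: "((int^2) \<times> int) monoid"
  proof -
    obtain K where K: "\<And>a b i. \<exists>w. a - b = fact K *s w \<Longrightarrow>
        N #>\<^bsub>mapping_torus_group Y\<^esub> (a, i) = N #>\<^bsub>mapping_torus_group Y\<^esub> (b, i)"
      using rcoset_cong[OF Y N] by (metis order_refl)
    show ?thesis
      by (intro exI[of _ K] allI impI ballI) (auto intro!: K mcong_vec X)
  qed
  have inv: "\<exists>K. \<forall>k\<ge>K. \<forall>h\<in>carrier G'. N #>\<^bsub>mapping_torus_group Y\<^esub> (\<lambda>(w, i). (X k *v w, i)) ((\<lambda>(w, i). (Z k *v w, i)) h) =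
      N #>\<^bsub>mapping_torus_group Y\<^esub> h"
    if Y: "invertible Y" and N: "N \<in> finite_index_normal (mapping_torus_group Y)"
      and X: "\<And>k. mcong (fact k) (X k ** Z k) (mat 1)" for N X Y Z and G' :: "((int^2) \<times> int) monoid"
  proof -
    obtain K where K: "\<And>k a b i. k \<ge> K \<Longrightarrow> \<exists>w. a - b = fact k *s w \<Longrightarrow>
        N #>\<^bsub>mapping_torus_group Y\<^esub> (a, i) = N #>\<^bsub>mapping_torus_group Y\<^esub> (b, i)"
      using rcoset_cong[OF Y N] by metis
    have "\<exists>w. X k *v (Z k *v a) - a = fact k *s w" for k a
      using mcong_vec[OF X, of k a] by (simp add: matrix_vector_mul_assoc)
    then show ?thesis by (intro exI[of _ K] allI impI ballI) (auto intro!: K)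
  qed
  have "isomorphic_completions (mapping_torus_group C) (mapping_torus_group A)"
  proof (rule isomorphic_completions_limit[of _ _ F E])
    show "group (mapping_torus_group C)" "group (mapping_torus_group A)"
      by (rule group_mapping_torus_group[OF C], rule group_mapping_torus_group[OF A])
    show "F k \<in> hom (mapping_torus_group C) (mapping_torus_group A)" for k
      unfolding F_def by (rule intertwiner_hom[OF C A PC])
    show "E k \<in> hom (mapping_torus_group A) (mapping_torus_group C)" for k
      unfolding E_def by (rule intertwiner_hom[OF A C QA])
  qed (unfold F_def E_def, (rule conv[OF A _ Pcong] conv[OF C _ Qcong] inv[OF A _ PQ(1)] inv[OF C _ PQ(2)], assumption+)+)
  then show ?thesis by (simp add: C_def)
qed

text \<open>Both completions are compared with that of the companion matrix, which depends on the
  trace alone.\<close>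

theorem isomorphic_completions_same_trace:
  assumes A: "det A = -1" and sqf: "squarefree ((trace A)^2 - 4 * det A)"
    and B: "det B = -1" "trace B = trace A"
  shows "isomorphic_completions (mapping_torus_group B) (mapping_torus_group A)"
proof -
  have inv: "invertible B" "invertible (companion (trace A))"
    using B by (auto intro!: invertible_int_matrixI simp: det_companion)
  have "isomorphic_completions (mapping_torus_group (companion (trace A))) (mapping_torus_group B)"
    using isomorphic_completions_companion[of B] sqf A B by simp
  then have "isomorphic_completions (mapping_torus_group B) (mapping_torus_group (companion (trace A)))"
    by (rule isomorphic_completions_sym[OF group_mapping_torus_group[OF inv(2)] group_mapping_torus_group[OF inv(1)]])
  then show ?thesis using isomorphic_completions_companion[OF A sqf] isomorphic_completions_trans by blast
qed

section \<open>Ideals of the order generated by an eigenvalue\<close>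

text \<open>\<open>root\<close> is the characteristic equation of a matrix of determinant -1 and
  trace \<open>t\<close>, and t^2 + 4 is its discriminant.\<close>

locale quadratic_order =
  fixes lam :: complex and t :: int
  assumes root: "lam * lam = of_int t * lam + 1" and sqf: "squarefree (t^2 + 4)"
begin

definition R :: "complex set"
  where "R = int_adjoin lam"

abbreviation K :: "complex set"
  where "K \<equiv> fraction_field R"

lemma R_eq: "R = {of_int m + of_int n * lam | m n. True}"
proof
  have "\<exists>m n. poly (map_poly of_int p) lam = of_int m + of_int n * lam" for p :: "int poly"
  proof (induction p)
    case 0
    show ?case by (intro exI[of _ 0]) simp
  next
    case (pCons a p)
    then obtain m n where mn: "poly (map_poly of_int p) lam = of_int m + of_int n * lam" by blast
    have "poly (map_poly of_int (pCons a p)) lam = of_int a + lam * (of_int m + of_int n * lam)"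
      using pCons.hyps by (simp add: map_poly_pCons mn)
    also have "\<dots> = of_int a + of_int m * lam + of_int n * (lam * lam)" by (simp add: algebra_simps)
    also have "\<dots> = of_int (a + n) + of_int (m + n * t) * lam" unfolding root by (simp add: algebra_simps)
    finally show ?case by blast
  qed
  then show "R \<subseteq> {of_int m + of_int n * lam | m n. True}" by (auto simp: R_def int_adjoin_def)
  have "of_int m + of_int n * lam = poly (map_poly of_int [:m, n:]) lam" for m n
    by (simp add: map_poly_pCons mult.commute)
  then show "{of_int m + of_int n * lam | m n. True} \<subseteq> R" unfolding R_def int_adjoin_def by blast
qed

lemma RI: "of_int m + of_int n * lam \<in> R"
  unfolding R_eq by blast

lemma R_int: "of_int m \<in> R" and R_lam: "lam \<in> R" and R_lam_diff: "lam - of_int m \<in> R"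
  using RI[of m 0] RI[of 0 1] RI[of "- m" 1] by simp_all

lemma R_0: "0 \<in> R" and R_1: "1 \<in> R"
  using R_int[of 0] R_int[of 1] by simp_all

lemma R_add: "x \<in> R \<Longrightarrow> y \<in> R \<Longrightarrow> x + y \<in> R"
proof -
  assume "x \<in> R" "y \<in> R"
  then obtain a b c d where "x = of_int a + of_int b * lam" "y = of_int c + of_int d * lam" unfolding R_eq by blast
  then have "x + y = of_int (a + c) + of_int (b + d) * lam" by (simp add: algebra_simps)
  then show ?thesis using RI by metis
qed

lemma R_mult: "x \<in> R \<Longrightarrow> y \<in> R \<Longrightarrow> x * y \<in> R"
proof -
  assume "x \<in> R" "y \<in> R"
  then obtain a b c d where "x = of_int a + of_int b * lam" "y = of_int c + of_int d * lam" unfolding R_eq by blast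
  then have "x * y = of_int (a * c) + of_int (a * d + b * c) * lam + of_int (b * d) * (lam * lam)" by (simp add: algebra_simps)
  also have "\<dots> = of_int (a * c + b * d) + of_int (a * d + b * c + b * d * t) * lam"
    unfolding root by (simp add: algebra_simps)
  finally show ?thesis using RI by metis
qed

lemma R_sum: "(\<And>k. k < n \<Longrightarrow> f k \<in> R) \<Longrightarrow> (\<Sum>k<(n::nat). f k) \<in> R"
  by (induction n) (auto intro: R_0 R_add)

lemma K_I: "x \<in> R \<Longrightarrow> y \<in> R \<Longrightarrow> y \<noteq> 0 \<Longrightarrow> x / y \<in> K"
  by (auto simp: fraction_field_def)

lemma R_K: "x \<in> R \<Longrightarrow> x \<in> K"
  using K_I[OF _ R_1] by simp

lemma K_mult: "x \<in> K \<Longrightarrow> y \<in> K \<Longrightarrow> x * y \<in> K"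
proof -
  assume "x \<in> K" "y \<in> K"
  then obtain a b c d where "x = a / b" "y = c / d" "a \<in> R" "b \<in> R" "c \<in> R" "d \<in> R" "b \<noteq> 0" "d \<noteq> 0"
    by (auto simp: fraction_field_def)
  then have "x * y = (a * c) / (b * d)" "a * c \<in> R" "b * d \<in> R" "b * d \<noteq> 0" by (auto simp: R_mult)
  then show ?thesis using K_I by metis
qed

lemma K_inverse: "x \<in> K \<Longrightarrow> inverse x \<in> K"
proof -
  assume "x \<in> K"
  then obtain a b where ab: "x = a / b" "a \<in> R" "b \<in> R" "b \<noteq> 0" by (auto simp: fraction_field_def)
  show ?thesis
  proof (cases "a = 0")
    case True
    then show ?thesis using ab R_K[OF R_0] by simp
  next
    case False
    then show ?thesis using K_I[OF ab(3,2)] ab(1) by simp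
  qed
qed

text \<open>A square root k of the discriminant would have its square dividing it and so be a unit,
  whereas the discriminant is at least 4.\<close>

lemma disc_not_square: "t^2 + 4 \<noteq> (k::int)^2"
proof
  assume "t^2 + 4 = k^2"
  then have "is_unit k" using sqf by (auto simp: squarefree_def)
  then have "k^2 = 1" by (simp add: power2_eq_square abs_square_eq_1 zdvd1_eq abs_if split: if_splits)
  then show False using \<open>t^2 + 4 = k^2\<close> zero_le_power2[of t] by simp
qed

text \<open>Completing the square in the equation satisfied by \<open>n * lam = - m\<close> would
  exhibit the discriminant as a square.\<close>

lemma independent:
  assumes "of_int m + of_int n * lam = 0"
  shows "m = 0 \<and> n = 0"
proof (cases "n = 0")
  case True
  then show ?thesis using assms by simp
next
  case False
  have e: "of_int n * lam = - of_int m" using assms by (simp add: add_eq_0_iff)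
  have "(of_int n * lam) * (of_int n * lam) = of_int t * of_int n * (of_int n * lam) + of_int n * of_int n"
    using arg_cong[OF root, of "\<lambda>x. of_int n * of_int n * x"] by (simp add: algebra_simps)
  then have "of_int (m * m) = (of_int (- t * n * m + n * n) :: complex)" unfolding e by (simp add: algebra_simps)
  then have "m * m = - t * n * m + n * n" by (simp only: of_int_eq_iff)
  then have sq: "(2 * m + t * n)^2 = (t^2 + 4) * n^2" by (simp add: power2_eq_square algebra_simps)
  then have "n^2 dvd (2 * m + t * n)^2" by simp
  then have "n dvd 2 * m + t * n" by simp
  then obtain k where "2 * m + t * n = n * k" by (elim dvdE)
  then have "(t^2 + 4) * n^2 = (n * k)^2" by (simp only: sq [symmetric])
  then have "(t^2 + 4) * n^2 = k^2 * n^2" by (simp only: power_mult_distrib mult.commute)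
  moreover have "n^2 \<noteq> 0" using False by simp
  ultimately have "t^2 + 4 = k^2" by (blast dest: mult_right_cancel[THEN iffD1, rotated])
  then show ?thesis using disc_not_square by blast
qed

lemma independent_eq:
  assumes "of_int m + of_int n * lam = of_int m' + of_int n' * lam"
  shows "m = m' \<and> n = n'"
proof -
  have "of_int (m - m') + of_int (n - n') * lam = 0" using assms by (simp add: algebra_simps)
  then show ?thesis using independent by fastforce
qed

section \<open>Lattices attached to matrices\<close>

definition S :: "(int^2^2) set"
  where "S = {B. det B = -1 \<and> trace B = t}"

definition lat :: "complex \<Rightarrow> complex \<Rightarrow> complex set"
  where "lat x y = {of_int m * x + of_int n * y | m n. True}"

text \<open>The two generators form a row vector that is a left eigenvector of \<open>B\<close> for
  \<open>lam\<close> (see \<open>eigen_row\<close>); this makes their span stable under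
  \<open>lam\<close>.\<close>

definition ideal_of :: "int^2^2 \<Rightarrow> complex set"
  where "ideal_of B = lat (of_int (B$2$1)) (lam - of_int (B$1$1))"

lemma latI: "of_int m * x + of_int n * y \<in> lat x y"
  unfolding lat_def by blast

lemma lat_add: "u \<in> lat x y \<Longrightarrow> v \<in> lat x y \<Longrightarrow> u + v \<in> lat x y"
proof -
  assume "u \<in> lat x y" "v \<in> lat x y"
  then obtain m n m' n' where "u = of_int m * x + of_int n * y" "v = of_int m' * x + of_int n' * y" unfolding lat_def by blast
  then have "u + v = of_int (m + m') * x + of_int (n + n') * y" by (simp add: algebra_simps)
  then show ?thesis using latI by metis
qed

lemma lat_smult: "u \<in> lat x y \<Longrightarrow> of_int k * u \<in> lat x y"
proof -
  assume "u \<in> lat x y"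
  then obtain m n where "u = of_int m * x + of_int n * y" unfolding lat_def by blast
  then have "of_int k * u = of_int (k * m) * x + of_int (k * n) * y" by (simp add: algebra_simps)
  then show ?thesis using latI by metis
qed

lemma lat_gen: "x \<in> lat x y" "y \<in> lat x y"
  using latI[of 1 x 0 y] latI[of 0 x 1 y] by simp_all

lemma lat_subset: "x \<in> lat u v \<Longrightarrow> y \<in> lat u v \<Longrightarrow> lat x y \<subseteq> lat u v"
  by (auto simp: lat_def[of x y] intro!: lat_add lat_smult)

lemma lat_scale: "(\<lambda>z. a * z) ` lat x y = lat (a * x) (a * y)"
proof -
  have "a * (of_int m * x + of_int n * y) = of_int m * (a * x) + of_int n * (a * y)" for m n
    by (simp add: algebra_simps)
  then have "(\<lambda>z. a * z) ` lat x y = {of_int m * (a * x) + of_int n * (a * y) | m n. True}"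
    unfolding lat_def by (auto simp: image_iff) metis+
  then show ?thesis by (simp add: lat_def)
qed

text \<open>An off-diagonal entry equal to 0 would turn the discriminant into a square.\<close>

lemma SD:
  assumes "B \<in> S"
  shows "B$1$1 * B$2$2 - B$1$2 * B$2$1 = -1" "B$1$1 + B$2$2 = t" "B$2$1 \<noteq> 0" "B$1$2 \<noteq> 0"
    "t^2 + 4 = (B$2$2 - B$1$1)^2 + 4 * B$1$2 * B$2$1"
proof -
  show 1: "B$1$1 * B$2$2 - B$1$2 * B$2$1 = -1" and 2: "B$1$1 + B$2$2 = t"
    using assms by (simp_all add: S_def det_2 trace_2)
  show 3: "t^2 + 4 = (B$2$2 - B$1$1)^2 + 4 * B$1$2 * B$2$1"
    using 1 unfolding 2[symmetric] by algebra
  show "B$2$1 \<noteq> 0" "B$1$2 \<noteq> 0" using 3 disc_not_square[of "B$2$2 - B$1$1"] by auto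
qed

lemma SD_complex:
  assumes "B \<in> S"
  shows "of_int (B$1$1) * of_int (B$2$2) + 1 = (of_int (B$1$2) * of_int (B$2$1) :: complex)"
    and "of_int (B$1$1) + of_int (B$2$2) = (of_int t :: complex)"
proof -
  have "B$1$1 * B$2$2 + 1 = B$1$2 * B$2$1" using SD(1)[OF assms] by simp
  then have "of_int (B$1$1 * B$2$2 + 1) = (of_int (B$1$2 * B$2$1) :: complex)" by (simp only:)
  then show "of_int (B$1$1) * of_int (B$2$2) + 1 = (of_int (B$1$2) * of_int (B$2$1) :: complex)" by simp
  show "of_int (B$1$1) + of_int (B$2$2) = (of_int t :: complex)"
    unfolding SD(2)[OF assms, symmetric] by simp
qed

lemma eigen_row:
  assumes "B \<in> S"
  shows "lam * of_int (B$2$1) = of_int (B$2$1) * of_int (B$1$1) + (lam - of_int (B$1$1)) * of_int (B$2$1)"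
    and "lam * (lam - of_int (B$1$1)) = of_int (B$2$1) * of_int (B$1$2) + (lam - of_int (B$1$1)) * of_int (B$2$2)"
proof -
  show "lam * of_int (B$2$1) = of_int (B$2$1) * of_int (B$1$1) + (lam - of_int (B$1$1)) * of_int (B$2$1)"
    by (simp add: algebra_simps)
  show "lam * (lam - of_int (B$1$1)) = of_int (B$2$1) * of_int (B$1$2) + (lam - of_int (B$1$1)) * of_int (B$2$2)"
    using root SD_complex[OF assms] by algebra
qed

lemma lat_R_module:
  assumes "lam * x \<in> lat x y" "lam * y \<in> lat x y" "r \<in> R" "z \<in> lat x y"
  shows "r * z \<in> lat x y"
proof -
  obtain m n where r: "r = of_int m + of_int n * lam" using assms(3) unfolding R_eq by blast
  obtain k l where z: "z = of_int k * x + of_int l * y" using assms(4) unfolding lat_def by blast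
  have "lam * z = of_int k * (lam * x) + of_int l * (lam * y)" by (simp add: z algebra_simps)
  then have "lam * z \<in> lat x y" using assms(1,2) by (simp add: lat_add lat_smult)
  then have "of_int m * z + of_int n * (lam * z) \<in> lat x y" using assms(4) by (intro lat_add lat_smult)
  then show ?thesis by (simp add: r algebra_simps)
qed

lemma ideal_of_module:
  assumes "B \<in> S" "r \<in> R" "z \<in> ideal_of B"
  shows "r * z \<in> ideal_of B"
  unfolding ideal_of_def
proof (rule lat_R_module[OF _ _ assms(2) assms(3)[unfolded ideal_of_def]])
  let ?c = "of_int (B$2$1) :: complex" and ?x = "lam - of_int (B$1$1)"
  show "lam * ?c \<in> lat ?c ?x" using latI[of "B$1$1" ?c "B$2$1" ?x] eigen_row(1)[OF assms(1)] by (simp add: mult.commute)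
  show "lam * ?x \<in> lat ?c ?x" using latI[of "B$1$2" ?c "B$2$2" ?x] eigen_row(2)[OF assms(1)] by (simp add: mult.commute)
qed

lemma ideal_of_subset: "ideal_of B \<subseteq> R"
  unfolding ideal_of_def lat_def by (auto intro!: R_add R_mult R_int R_lam_diff)

lemma fractional_ideal_of:
  assumes "B \<in> S"
  shows "fractional_ideal R (ideal_of B)"
  unfolding fractional_ideal_def
proof (intro conjI ballI)
  have c: "of_int (B$2$1) \<in> ideal_of B" unfolding ideal_of_def by (rule lat_gen)
  show "ideal_of B \<subseteq> K" using ideal_of_subset R_K by blast
  show "0 \<in> ideal_of B" using ideal_of_module[OF assms R_0 c] by (simp only: mult_zero_left)
  have "of_int (B$2$1) \<noteq> (0::complex)" using SD(3)[OF assms] by (simp only: of_int_eq_0_iff not_False_eq_True)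
  then show "ideal_of B \<noteq> {0}" using c by blast
  show "\<exists>d\<in>R. d \<noteq> 0 \<and> (\<forall>x\<in>ideal_of B. d * x \<in> R)"
  proof (intro bexI[OF _ R_1] conjI ballI)
    show "1 * x \<in> R" if "x \<in> ideal_of B" for x using ideal_of_subset that by auto
  qed simp
  show "x + y \<in> ideal_of B" if "x \<in> ideal_of B" "y \<in> ideal_of B" for x y
    using that unfolding ideal_of_def by (rule lat_add)
qed (rule ideal_of_module[OF assms])

lemma fractional_idealD:
  assumes "fractional_ideal R I"
  shows "I \<subseteq> K" "0 \<in> I" "\<And>x y. x \<in> I \<Longrightarrow> y \<in> I \<Longrightarrow> x + y \<in> I" "\<And>r x. r \<in> R \<Longrightarrow> x \<in> I \<Longrightarrow> r * x \<in> I"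
    "\<exists>x\<in>I. x \<noteq> 0" "\<exists>d\<in>R. d \<noteq> 0 \<and> (\<forall>x\<in>I. d * x \<in> R)"
proof -
  note D0 = assms[unfolded fractional_ideal_def]
  note D1 = conjunct2[OF D0] note D2 = conjunct2[OF D1] note D3 = conjunct2[OF D2] note D4 = conjunct2[OF D3]
  note D = conjunct1[OF D0] conjunct1[OF D1] conjunct1[OF D2] conjunct1[OF D3] conjunct1[OF D4] conjunct2[OF D4]
  show "I \<subseteq> K" "0 \<in> I" "\<exists>d\<in>R. d \<noteq> 0 \<and> (\<forall>x\<in>I. d * x \<in> R)" by fact+
  show "x + y \<in> I" if "x \<in> I" "y \<in> I" for x y using D(4) that by blast
  show "r * x \<in> I" if "r \<in> R" "x \<in> I" for r x using D(5) that by blast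
  show "\<exists>x\<in>I. x \<noteq> 0" using D(2,3) by blast
qed

lemma fractional_ideal_scale:
  assumes I: "fractional_ideal R I" and a: "a \<in> K" "a \<noteq> 0"
  shows "fractional_ideal R ((\<lambda>z. a * z) ` I)"
  unfolding fractional_ideal_def
proof (intro conjI ballI)
  note D = fractional_idealD[OF I]
  show "(\<lambda>z. a * z) ` I \<subseteq> K" using D(1) K_mult[OF a(1)] by blast
  show "0 \<in> (\<lambda>z. a * z) ` I" by (rule image_eqI[OF _ D(2)]) simp
  obtain x where x: "x \<in> I" "x \<noteq> 0" using D(5) by blast
  then have "a * x \<in> (\<lambda>z. a * z) ` I" "a * x \<noteq> 0" using a by auto
  then show "(\<lambda>z. a * z) ` I \<noteq> {0}" by blast
  obtain d where d: "d \<in> R" "d \<noteq> 0" "\<forall>x\<in>I. d * x \<in> R" using D(6) by blast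
  obtain p q where pq: "a = p / q" "p \<in> R" "q \<in> R" "q \<noteq> 0" using a(1) unfolding fraction_field_def by blast
  show "\<exists>d\<in>R. d \<noteq> 0 \<and> (\<forall>x\<in>(\<lambda>z. a * z) ` I. d * x \<in> R)"
  proof (intro bexI[OF _ R_mult[OF d(1) pq(3)]] conjI ballI)
    fix x assume "x \<in> (\<lambda>z. a * z) ` I"
    then obtain y where y: "y \<in> I" "x = a * y" by blast
    have "d * q * x = p * (d * y)" using y(2) pq(1,4) by simp
    moreover have "p * (d * y) \<in> R" using R_mult[OF pq(2)] d(3) y(1) by blast
    ultimately show "d * q * x \<in> R" by (simp only:)
  qed (use d(2) pq(4) in simp)
next
  fix x y assume "x \<in> (\<lambda>z. a * z) ` I" "y \<in> (\<lambda>z. a * z) ` I"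
  then obtain x' y' where xy: "x' \<in> I" "y' \<in> I" "x = a * x'" "y = a * y'" by blast
  show "x + y \<in> (\<lambda>z. a * z) ` I"
    by (rule image_eqI[OF _ fractional_idealD(3)[OF I xy(1,2)]]) (simp add: xy(3,4) distrib_left)
next
  fix r x assume r: "r \<in> R" and "x \<in> (\<lambda>z. a * z) ` I"
  then obtain x' where x: "x' \<in> I" "x = a * x'" by blast
  show "r * x \<in> (\<lambda>z. a * z) ` I"
    by (rule image_eqI[OF _ fractional_idealD(4)[OF I r x(1)]]) (simp add: x(2))
qed

text \<open>The square of a common divisor of these three numbers divides the discriminant. Here
  square-freeness enters the invertibility of the ideals.\<close>

lemma bezout_entries:
  assumes B: "B \<in> S"
  shows "\<exists>x y z. x * B$2$1 + y * B$1$2 + z * (B$1$1 - B$2$2) = 1"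
proof -
  define g where "g = gcd (B$2$1) (gcd (B$1$2) (B$1$1 - B$2$2))"
  have g: "g dvd B$2$1" "g dvd B$1$2" "g dvd B$1$1 - B$2$2" by (simp_all add: g_def gcd_dvd2 dvd_trans[OF gcd_dvd2])
  have "g dvd B$2$2 - B$1$1" using g(3) by (simp add: dvd_diff_commute)
  then have "g^2 dvd (B$2$2 - B$1$1)^2 + 4 * B$1$2 * B$2$1"
    using g unfolding power2_eq_square by (intro dvd_add) (simp_all add: mult_dvd_mono mult.assoc)
  then have "is_unit g" using sqf SD(5)[OF B] by (auto simp: squarefree_def)
  moreover have "g \<ge> 0" by (simp add: g_def)
  ultimately have g1: "g = 1" by simp
  obtain u v where uv: "u * B$1$2 + v * (B$1$1 - B$2$2) = gcd (B$1$2) (B$1$1 - B$2$2)" using bezout_int by blast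
  obtain p q where pq: "p * B$2$1 + q * gcd (B$1$2) (B$1$1 - B$2$2) = g" using bezout_int unfolding g_def by blast
  have "p * B$2$1 + (q * u) * B$1$2 + (q * v) * (B$1$1 - B$2$2) = 1"
    using pq[unfolded g1 uv[symmetric]] by (simp add: algebra_simps)
  then show ?thesis by blast
qed

text \<open>Write a, b, c, d for the entries of \<open>B\<close>. The inverse is the conjugate ideal
  divided by c. The product of the two is generated by c, lam - a, lam - d and b, so it contains a -
  d and, by \<open>bezout_entries\<close>, also 1.\<close>

lemma ideal_of_invertible:
  assumes B: "B \<in> S"
  shows "ideal_of B \<in> carrier (invertible_ideals R)"
proof -
  \<comment> \<open>Exchanging the diagonal entries describes the conjugate ideal, since lam - d is
    minus the conjugate of lam - a.\<close>
  define B' where "B' = cols (vector [B$2$2, B$2$1]) (vector [B$1$2, B$1$1])"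
  have B'e: "B'$1$1 = B$2$2" "B'$2$1 = B$2$1" "B'$1$2 = B$1$2" "B'$2$2 = B$1$1"
    by (simp_all add: B'_def cols_def vector_2)
  have B': "B' \<in> S" using B by (simp add: S_def det_2 trace_2 B'e algebra_simps)
  let ?a = "of_int (B$1$1) :: complex" and ?b = "of_int (B$1$2) :: complex"
    and ?c = "of_int (B$2$1) :: complex" and ?d = "of_int (B$2$2) :: complex"
  have c0: "?c \<noteq> 0" using SD(3)[OF B] by simp
  define J where "J = (\<lambda>z. inverse ?c * z) ` ideal_of B'"
  have J: "fractional_ideal R J"
    unfolding J_def using c0 by (intro fractional_ideal_scale fractional_ideal_of B' K_inverse R_K R_int) simp
  define q where "q = (lam - ?d) / ?c"
  have cq: "?c * q = lam - ?d" using c0 by (simp add: q_def)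
  have J_eq: "J = lat 1 q"
    unfolding J_def ideal_of_def lat_scale B'e q_def using c0 by (simp add: field_simps)
  have prod: "(lam - ?a) * q = ?b"
  proof -
    have "(lam - ?a) * (lam - ?d) = ?b * ?c" using root SD_complex[OF B] by algebra
    then show ?thesis using c0 by (simp add: q_def field_simps)
  qed
  have in_R: "u * v \<in> R" if uv: "u \<in> ideal_of B" "v \<in> J" for u v
  proof -
    obtain m n where u: "u = of_int m * ?c + of_int n * (lam - ?a)" using uv(1) unfolding ideal_of_def lat_def by blast
    obtain m' n' where v: "v = of_int m' * 1 + of_int n' * q" using uv(2) unfolding J_eq lat_def by blast
    have "u * v = of_int (m * m') * ?c + of_int (m * n') * (?c * q) + of_int (n * m') * (lam - ?a)
        + of_int (n * n') * ((lam - ?a) * q)"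
      unfolding u v by (simp add: algebra_simps)
    also have "\<dots> = of_int (m * m') * ?c + of_int (m * n') * (lam - ?d) + of_int (n * m') * (lam - ?a) + of_int (n * n') * ?b"
      unfolding prod cq by simp
    also have "\<dots> \<in> R" by (intro R_add R_mult R_int R_lam_diff)
    finally show ?thesis .
  qed
  have "ideal_mult (ideal_of B) J = R"
  proof
    show "ideal_mult (ideal_of B) J \<subseteq> R"
      unfolding ideal_mult_def using in_R by (auto intro!: R_sum)
    show "R \<subseteq> ideal_mult (ideal_of B) J"
    proof
      fix r assume r: "r \<in> R"
      obtain x y z where xyz: "x * B$2$1 + y * B$1$2 + z * (B$1$1 - B$2$2) = 1" using bezout_entries[OF B] by blast
      \<comment> \<open>The coefficients of \<open>g\<close> are arranged so that the two terms with
        \<open>z\<close> combine to z (a - d) and \<open>lam\<close> cancels.\<close>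
      define f where "f k = (if k = 0 then r * ?c else r * (lam - ?a))" for k :: nat
      define g where "g k = (if k = 0 then of_int x * 1 + of_int z * q
          else of_int (- z) * 1 + of_int y * q)" for k :: nat
      have "f k \<in> ideal_of B" for k
        using ideal_of_module[OF B r] lat_gen by (auto simp: f_def ideal_of_def)
      moreover have "g k \<in> J" for k
        unfolding J_eq g_def by (cases "k = 0") (simp_all only: if_True if_False simp_thms latI)
      moreover have "(\<Sum>k<2. f k * g k) = r"
      proof -
        have "(\<Sum>k<2. f k * g k) = r * (of_int x * ?c + of_int z * (?c * q)
            - of_int z * (lam - ?a) + of_int y * ((lam - ?a) * q))"
          by (simp add: numeral_2_eq_2 f_def g_def algebra_simps)
        also have "\<dots> = r * (of_int x * ?c + of_int y * ?b + of_int z * (?a - ?d))"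
          unfolding prod cq by (simp add: algebra_simps)
        also have "of_int x * ?c + of_int y * ?b + of_int z * (?a - ?d) = 1"
          using xyz unfolding of_int_mult[symmetric] of_int_diff[symmetric] of_int_add[symmetric] by simp
        finally show ?thesis by simp
      qed
      ultimately show "r \<in> ideal_mult (ideal_of B) J" unfolding ideal_mult_def by blast
    qed
  qed
  then show ?thesis using fractional_ideal_of[OF B] J by (auto simp: invertible_ideals_def)
qed

lemma lat_independent:
  assumes "c \<noteq> 0" "of_int m * of_int c + of_int n * (lam - of_int a) = of_int m' * of_int c + of_int n' * (lam - of_int a)"
  shows "m = m' \<and> n = n'"
proof -
  have "of_int (m * c - n * a) + of_int n * lam = of_int (m' * c - n' * a) + of_int n' * lam"
    using assms(2) by (simp add: algebra_simps)
  from independent_eq[OF this] show ?thesis using assms(1) by auto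
qed

text \<open>Multiplying the left eigenvector of \<open>B'\<close> by \<open>P\<close> gives a left
  eigenvector of \<open>B\<close>, hence a multiple of the standard one. The factor carries one
  ideal to the other because \<open>P\<close> is invertible over the integers.\<close>

lemma ideal_of_conjugate:
  assumes B: "B \<in> S" and B': "B' \<in> S" and P: "invertible P" "P ** B = B' ** P"
  shows "\<exists>a\<in>K. a \<noteq> 0 \<and> (\<lambda>z. a * z) ` ideal_of B = ideal_of B'"
proof -
  let ?w1 = "of_int (B'$2$1) :: complex" and ?w2 = "lam - of_int (B'$1$1)"
  define z1 where "z1 = ?w1 * of_int (P$1$1) + ?w2 * of_int (P$2$1)"
  define z2 where "z2 = ?w1 * of_int (P$1$2) + ?w2 * of_int (P$2$2)"
  let ?c = "of_int (B$2$1) :: complex"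
  have c0: "?c \<noteq> 0" using SD(3)[OF B] by simp
  obtain Q where Q: "P ** Q = mat 1" "Q ** P = mat 1" using P(1) by (auto simp: invertible_def)
  have PB: "P$1$1 * B$1$1 + P$1$2 * B$2$1 = B'$1$1 * P$1$1 + B'$1$2 * P$2$1"
    "P$2$1 * B$1$1 + P$2$2 * B$2$1 = B'$2$1 * P$1$1 + B'$2$2 * P$2$1"
    using P(2) by (simp_all add: matrix_2_eq mult_2)
  have "z1 * of_int (B$1$1) + z2 * ?c = ?w1 * of_int (P$1$1 * B$1$1 + P$1$2 * B$2$1) + ?w2 * of_int (P$2$1 * B$1$1 + P$2$2 * B$2$1)"
    by (simp add: z1_def z2_def algebra_simps)
  also have "\<dots> = (?w1 * of_int (B'$1$1) + ?w2 * of_int (B'$2$1)) * of_int (P$1$1)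
      + (?w1 * of_int (B'$1$2) + ?w2 * of_int (B'$2$2)) * of_int (P$2$1)"
    unfolding PB by (simp add: algebra_simps)
  also have "\<dots> = lam * z1"
    unfolding eigen_row[OF B', symmetric] z1_def by (simp add: algebra_simps)
  finally have z2: "z2 * ?c = (lam - of_int (B$1$1)) * z1" by (simp add: algebra_simps)
  define a where "a = z1 / ?c"
  have az: "a * ?c = z1" "a * (lam - of_int (B$1$1)) = z2"
    using c0 z2 by (simp_all add: a_def field_simps)
  have "z1 \<in> R" unfolding z1_def by (intro R_add R_mult R_int R_lam_diff)
  then have aK: "a \<in> K" unfolding a_def by (intro K_I R_int c0)
  have "z1 \<noteq> 0"
  proof
    assume "z1 = 0"
    then have "of_int (P$1$1) * ?w1 + of_int (P$2$1) * ?w2 = of_int 0 * ?w1 + of_int 0 * ?w2"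
      by (simp add: z1_def mult.commute)
    from lat_independent[OF SD(3)[OF B'] this] have "(Q ** P)$1$1 = 0" by (simp add: mult_2)
    then show False unfolding Q by (simp add: mat_def)
  qed
  then have a0: "a \<noteq> 0" using c0 by (simp add: a_def)
  have "z1 \<in> lat ?w1 ?w2" "z2 \<in> lat ?w1 ?w2"
    unfolding z1_def z2_def using latI[of "P$1$1" ?w1 "P$2$1" ?w2] latI[of "P$1$2" ?w1 "P$2$2" ?w2] by (simp_all add: mult.commute)
  then have 1: "lat z1 z2 \<subseteq> lat ?w1 ?w2" by (rule lat_subset)
  have e: "P$1$1 * Q$1$1 + P$1$2 * Q$2$1 = 1" "P$2$1 * Q$1$1 + P$2$2 * Q$2$1 = 0"
    "P$1$1 * Q$1$2 + P$1$2 * Q$2$2 = 0" "P$2$1 * Q$1$2 + P$2$2 * Q$2$2 = 1"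
    using Q(1) by (simp_all add: matrix_2_eq mult_2 mat_def)
  have "of_int (Q$1$1) * z1 + of_int (Q$2$1) * z2 = 
      ?w1 * of_int (P$1$1 * Q$1$1 + P$1$2 * Q$2$1) + ?w2 * of_int (P$2$1 * Q$1$1 + P$2$2 * Q$2$1)"
    by (simp add: z1_def z2_def algebra_simps)
  then have w1: "?w1 = of_int (Q$1$1) * z1 + of_int (Q$2$1) * z2" unfolding e by simp
  have "of_int (Q$1$2) * z1 + of_int (Q$2$2) * z2 = 
      ?w1 * of_int (P$1$1 * Q$1$2 + P$1$2 * Q$2$2) + ?w2 * of_int (P$2$1 * Q$1$2 + P$2$2 * Q$2$2)"
    by (simp add: z1_def z2_def algebra_simps)
  then have w2: "?w2 = of_int (Q$1$2) * z1 + of_int (Q$2$2) * z2" unfolding e by simp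
  have "lat ?w1 ?w2 \<subseteq> lat z1 z2"
    by (rule lat_subset) (subst w1, rule latI, subst w2, rule latI)
  with 1 have "lat z1 z2 = ideal_of B'" unfolding ideal_of_def by blast
  then have "(\<lambda>z. a * z) ` ideal_of B = ideal_of B'" unfolding ideal_of_def[of B] lat_scale az .
  then show ?thesis using aK a0 by blast
qed

text \<open>\<open>P\<close> is the change of basis between the two lattices. Both bases are left
  eigenvectors for \<open>lam\<close>, so comparing coefficients of \<open>lam\<close> times a basis
  vector yields the intertwining relation.\<close>

lemma conjugate_if_ideals_equivalent:
  assumes B: "B \<in> S" and B': "B' \<in> S" and a: "a \<noteq> 0" "(\<lambda>z. a * z) ` ideal_of B = ideal_of B'"
  shows "\<exists>P. invertible P \<and> P ** B = B' ** P"
proof -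
  let ?w1 = "of_int (B'$2$1) :: complex" and ?w2 = "lam - of_int (B'$1$1)"
  let ?v1 = "of_int (B$2$1) :: complex" and ?v2 = "lam - of_int (B$1$1)"
  have eq: "lat (a * ?v1) (a * ?v2) = lat ?w1 ?w2" using a(2) unfolding ideal_of_def lat_scale .
  note ind = lat_independent[OF SD(3)[OF B']]
  obtain p11 p21 where p1: "a * ?v1 = of_int p11 * ?w1 + of_int p21 * ?w2"
    using lat_gen(1)[of "a * ?v1" "a * ?v2"] unfolding eq unfolding lat_def by blast
  obtain p12 p22 where p2: "a * ?v2 = of_int p12 * ?w1 + of_int p22 * ?w2"
    using lat_gen(2)[of "a * ?v2" "a * ?v1"] unfolding eq unfolding lat_def by blast
  obtain q11 q21 where q1: "?w1 = of_int q11 * (a * ?v1) + of_int q21 * (a * ?v2)"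
    using lat_gen(1)[of ?w1 ?w2] unfolding eq[symmetric] unfolding lat_def by blast
  obtain q12 q22 where q2: "?w2 = of_int q12 * (a * ?v1) + of_int q22 * (a * ?v2)"
    using lat_gen(2)[of ?w2 ?w1] unfolding eq[symmetric] unfolding lat_def by blast
  define P where "P = cols (vector [p11, p21]) (vector [p12, p22])"
  have Pe: "P$1$1 = p11" "P$2$1 = p21" "P$1$2 = p12" "P$2$2 = p22" by (simp_all add: P_def cols_def vector_2)
  have "of_int 1 * ?w1 + of_int 0 * ?w2 = of_int (p11 * q11 + p12 * q21) * ?w1 + of_int (p21 * q11 + p22 * q21) * ?w2"
    using q1[unfolded p1 p2] by (simp add: algebra_simps)
  from ind[OF this] have e1: "p11 * q11 + p12 * q21 = 1" "p21 * q11 + p22 * q21 = 0" by simp_all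
  have "of_int 0 * ?w1 + of_int 1 * ?w2 = of_int (p11 * q12 + p12 * q22) * ?w1 + of_int (p21 * q12 + p22 * q22) * ?w2"
    using q2[unfolded p1 p2] by (simp add: algebra_simps)
  from ind[OF this] have e2: "p11 * q12 + p12 * q22 = 0" "p21 * q12 + p22 * q22 = 1" by simp_all
  have "det P * (q11 * q22 - q12 * q21) = 1" unfolding det_2 Pe using e1 e2 by algebra
  then have "det P dvd 1" by (metis dvd_triv_left)
  then have "invertible P" by (intro invertible_int_matrixI) simp
  moreover have "P ** B = B' ** P"
  proof -
    have l1: "(a * ?v1) * of_int (B$1$1) + (a * ?v2) * of_int (B$2$1) = lam * (a * ?v1)"
      and l2: "(a * ?v1) * of_int (B$1$2) + (a * ?v2) * of_int (B$2$2) = lam * (a * ?v2)"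
      using arg_cong[OF eigen_row(1)[OF B], of "\<lambda>x. a * x"] arg_cong[OF eigen_row(2)[OF B], of "\<lambda>x. a * x"]
      by (simp_all only: distrib_left mult_ac)
    have r1: "lam * (of_int p * ?w1 + of_int r * ?w2) =
        of_int (p * B'$1$1 + r * B'$1$2) * ?w1 + of_int (p * B'$2$1 + r * B'$2$2) * ?w2" for p r
    proof -
      have "lam * (of_int p * ?w1 + of_int r * ?w2) = of_int p * (lam * ?w1) + of_int r * (lam * ?w2)"
        by (simp only: distrib_left mult_ac)
      then show ?thesis unfolding eigen_row[OF B'] of_int_add of_int_mult by (simp only: distrib_left distrib_right mult_ac add_ac)
    qed
    have "of_int (p11 * B$1$1 + p12 * B$2$1) * ?w1 + of_int (p21 * B$1$1 + p22 * B$2$1) * ?w2 =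
       of_int (p11 * B'$1$1 + p21 * B'$1$2) * ?w1 + of_int (p11 * B'$2$1 + p21 * B'$2$2) * ?w2"
      using l1 unfolding p1 p2 r1 of_int_add of_int_mult by (simp only: distrib_left distrib_right mult_ac add_ac)
    from ind[OF this] have 1: "p11 * B$1$1 + p12 * B$2$1 = p11 * B'$1$1 + p21 * B'$1$2"
      "p21 * B$1$1 + p22 * B$2$1 = p11 * B'$2$1 + p21 * B'$2$2" by simp_all
    have "of_int (p11 * B$1$2 + p12 * B$2$2) * ?w1 + of_int (p21 * B$1$2 + p22 * B$2$2) * ?w2 =
       of_int (p12 * B'$1$1 + p22 * B'$1$2) * ?w1 + of_int (p12 * B'$2$1 + p22 * B'$2$2) * ?w2"
      using l2 unfolding p1 p2 r1 of_int_add of_int_mult by (simp only: distrib_left distrib_right mult_ac add_ac)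
    from ind[OF this] have 2: "p11 * B$1$2 + p12 * B$2$2 = p12 * B'$1$1 + p22 * B'$1$2"
      "p21 * B$1$2 + p22 * B$2$2 = p12 * B'$2$1 + p22 * B'$2$2" by simp_all
    show ?thesis unfolding matrix_2_eq mult_2 Pe using 1 2 by (simp add: mult.commute)
  qed
  ultimately show ?thesis by blast
qed

text \<open>After clearing denominators, \<open>N\<close> has a Hermite normal form: it meets Z in Z
  c, and its \<open>lam\<close>-coefficients form Z g. Stability under \<open>lam\<close> forces g
  to divide everything, so N = g (Z e + Z (lam - a)). Finally e divides the norm of lam - a, and up
  to sign the quotient is the missing matrix entry b.\<close>

lemma fractional_ideal_equivalent:
  assumes J: "fractional_ideal R J"
  shows "\<exists>B\<in>S. \<exists>a\<in>K. a \<noteq> 0 \<and> J = (\<lambda>z. a * z) ` ideal_of B"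
proof -
  note D = fractional_idealD[OF J]
  obtain d where d: "d \<in> R" "d \<noteq> 0" "\<forall>x\<in>J. d * x \<in> R" using D by blast
  define N where "N = (\<lambda>x. d * x) ` J"
  have N_R: "N \<subseteq> R" using d by (auto simp: N_def)
  have N_add: "x + y \<in> N" if xy: "x \<in> N" "y \<in> N" for x y
  proof -
    obtain x' y' where "x' \<in> J" "y' \<in> J" "x = d * x'" "y = d * y'" using xy by (auto simp: N_def)
    then show ?thesis using D unfolding N_def by (intro image_eqI[of _ _ "x' + y'"]) (simp_all add: distrib_left)
  qed
  have N_mult: "r * x \<in> N" if rx: "r \<in> R" "x \<in> N" for r x
  proof -
    obtain x' where "x' \<in> J" "x = d * x'" using rx by (auto simp: N_def)
    then show ?thesis using D rx(1) unfolding N_def by (intro image_eqI[of _ _ "r * x'"]) simp_all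
  qed
  have N_0: "0 \<in> N" using D unfolding N_def by (intro image_eqI[of _ _ 0]) simp_all
  have N_diff: "x - y \<in> N" if "x \<in> N" "y \<in> N" for x y
    using N_add[OF that(1) N_mult[OF R_int[of "-1"] that(2)]] by simp
  obtain x0 where x0: "x0 \<in> N" "x0 \<noteq> 0"
  proof -
    obtain x where "x \<in> J" "x \<noteq> 0" using D by blast
    then show ?thesis using d(2) that[of "d * x"] by (simp add: N_def)
  qed
  define Z where "Z = {m. of_int m \<in> N}"
  have Zd: "i - j \<in> Z" if "i \<in> Z" "j \<in> Z" for i j using N_diff that by (simp add: Z_def)
  obtain c where c: "c \<in> Z" "c \<ge> 0" "\<And>i. i \<in> Z \<Longrightarrow> c dvd i"
    using int_ideal_principal[of Z] Zd N_0 by (auto simp: Z_def)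
  have c0: "c \<noteq> 0"
  proof -
    obtain m n where mn: "x0 = of_int m + of_int n * lam" using x0 N_R unfolding R_eq by blast
    \<comment> \<open>The conjugate of \<open>x0\<close>; the product of the two is the norm, a
      nonzero integer in \<open>N\<close>.\<close>
    define y where "y = of_int (m + n * t) + of_int (- n) * lam"
    have "y * x0 = of_int m * of_int m + of_int m * of_int n * of_int t + of_int n * of_int n * (of_int t * lam - lam * lam)"
      unfolding mn y_def by (simp add: algebra_simps)
    also have "\<dots> = of_int (m * m + m * n * t - n * n)" unfolding root by simp
    finally have yx: "y * x0 = of_int (m * m + m * n * t - n * n)" .
    have "y * x0 \<in> N" unfolding y_def by (rule N_mult[OF RI x0(1)])
    then have "c dvd m * m + m * n * t - n * n" using c(3) unfolding yx by (simp add: Z_def)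
    moreover have "m * m + m * n * t - n * n \<noteq> 0"
    proof
      assume "m * m + m * n * t - n * n = 0"
      then have "y * x0 = 0" unfolding yx by (simp only: of_int_0)
      then have "of_int (m + n * t) + of_int (- n) * lam = 0" using x0(2) unfolding y_def by simp
      from independent[OF this] have "m = 0" "n = 0" by auto
      then show False using x0(2) mn by simp
    qed
    ultimately show ?thesis by auto
  qed
  define Y where "Y = {n. \<exists>m. of_int m + of_int n * lam \<in> N}"
  have Yd: "i - j \<in> Y" if ij: "i \<in> Y" "j \<in> Y" for i j
  proof -
    obtain m m' where "of_int m + of_int i * lam \<in> N" "of_int m' + of_int j * lam \<in> N" using ij by (auto simp: Y_def)
    from N_diff[OF this] have "of_int (m - m') + of_int (i - j) * lam \<in> N" by (simp add: algebra_simps)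
    then show ?thesis unfolding Y_def by blast
  qed
  have Y0: "0 \<in> Y" using N_0 unfolding Y_def by (auto intro!: exI[of _ 0])
  obtain g where g: "g \<in> Y" "g \<ge> 0" "\<And>i. i \<in> Y \<Longrightarrow> g dvd i" using int_ideal_principal[OF Y0 Yd] by blast
  obtain k where k: "of_int k + of_int g * lam \<in> N" using g(1) by (auto simp: Y_def)
  have "lam * of_int c \<in> N" using N_mult[OF R_lam, of "of_int c"] c(1) by (simp add: Z_def)
  then have "of_int 0 + of_int c * lam \<in> N" by (simp add: mult.commute)
  then have gc: "g dvd c" using g(3) unfolding Y_def by blast
  then have g0: "g \<noteq> 0" using c0 by auto
  \<comment> \<open>The new \<open>lam\<close>-coefficient k + g t must be a multiple of g, hence so
    is k.\<close>
  have "lam * (of_int k + of_int g * lam) \<in> N" by (rule N_mult[OF R_lam k])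
  also have "lam * (of_int k + of_int g * lam) = of_int k * lam + of_int g * (lam * lam)" by (simp add: algebra_simps)
  also have "\<dots> = of_int g + of_int (k + g * t) * lam" unfolding root by (simp add: algebra_simps)
  finally have "g dvd k + g * t" using g(3) unfolding Y_def by blast
  then have "g dvd k" by (simp add: dvd_add_left_iff)
  then have "g dvd - k" by simp
  then obtain a where a: "- k = g * a" by (elim dvdE)
  obtain e where e: "c = g * e" using gc by (elim dvdE)
  have xN: "of_int g * (lam - of_int a) \<in> N"
  proof -
    have "k = - (g * a)" using a by simp
    then have "of_int g * (lam - of_int a) = of_int k + of_int g * lam" by (simp add: algebra_simps)
    then show ?thesis using k by simp
  qed
  \<comment> \<open>Up to sign the first factor is the conjugate of lam - a, so the product is an
    integer of \<open>N\<close>.\<close>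
  have "(lam - of_int (t - a)) * (of_int g * (lam - of_int a)) \<in> N" by (rule N_mult[OF R_lam_diff xN])
  also have "(lam - of_int (t - a)) * (of_int g * (lam - of_int a)) = of_int g * (lam * lam - of_int t * lam + of_int (a * (t - a)))"
    by (simp add: algebra_simps)
  also have "\<dots> = of_int (g * (1 + a * (t - a)))" unfolding root by simp
  finally have "c dvd g * (1 + a * (t - a))" using c(3) by (simp add: Z_def)
  then have "e dvd 1 + a * (t - a)" using g0 by (simp add: e)
  then obtain b where b: "1 + a * (t - a) = e * b" by (elim dvdE)
  define B where "B = cols (vector [a, e]) (vector [b, t - a])"
  have Be: "B$1$1 = a" "B$2$1 = e" "B$1$2 = b" "B$2$2 = t - a" by (simp_all add: B_def cols_def vector_2)
  have B: "B \<in> S" using b by (simp add: S_def det_2 trace_2 Be algebra_simps)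
  have "N = lat (of_int g * of_int e) (of_int g * (lam - of_int a))"
  proof
    have "of_int g * of_int e \<in> N" using c(1) by (simp add: Z_def e)
    then show "lat (of_int g * of_int e) (of_int g * (lam - of_int a)) \<subseteq> N"
      unfolding lat_def using xN by (auto intro!: N_add N_mult[OF R_int])
    show "N \<subseteq> lat (of_int g * of_int e) (of_int g * (lam - of_int a))"
    proof
      fix y assume y: "y \<in> N"
      then obtain m n where mn: "y = of_int m + of_int n * lam" using N_R unfolding R_eq by blast
      then have "n \<in> Y" using y unfolding Y_def by blast
      then have "g dvd n" by (rule g(3))
      then obtain q where q: "n = g * q" by (elim dvdE)
      have "y - of_int q * (of_int g * (lam - of_int a)) \<in> N" by (rule N_diff[OF y N_mult[OF R_int xN]])
      also have "y - of_int q * (of_int g * (lam - of_int a)) = of_int (m + q * g * a)"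
        by (simp add: mn q algebra_simps)
      finally have "c dvd m + q * g * a" using c(3) by (simp add: Z_def)
      then obtain p where p: "m + q * g * a = c * p" by (elim dvdE)
      have "y = of_int (m + q * g * a) + of_int q * (of_int g * (lam - of_int a))" by (simp add: mn q algebra_simps)
      also have "\<dots> = of_int p * (of_int g * of_int e) + of_int q * (of_int g * (lam - of_int a))"
        unfolding p e by (simp add: mult_ac)
      finally show "y \<in> lat (of_int g * of_int e) (of_int g * (lam - of_int a))" using latI by metis
    qed
  qed
  then have NB: "N = (\<lambda>z. of_int g * z) ` ideal_of B" unfolding ideal_of_def lat_scale Be .
  have "J = (\<lambda>z. inverse d * z) ` N" unfolding N_def image_image using d(2) by (simp flip: mult.assoc)
  also have "\<dots> = (\<lambda>z. (of_int g / d) * z) ` ideal_of B"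
    unfolding NB image_comp by (rule image_cong) (simp_all add: field_simps)
  finally have "J = (\<lambda>z. (of_int g / d) * z) ` ideal_of B" .
  moreover have "of_int g / d \<in> K" "of_int g / d \<noteq> 0" using K_I[OF R_int d(1,2)] g0 d(2) by simp_all
  ultimately show ?thesis using B by blast
qed

section \<open>Ideal classes and the Picard group\<close>

definition ideal_class :: "complex set \<Rightarrow> complex set set"
  where "ideal_class I = {(\<lambda>z. a * z) ` I | a. a \<in> K \<and> a \<noteq> 0}"

lemma ideal_class_scale:
  assumes a: "a \<in> K" "a \<noteq> 0"
  shows "ideal_class ((\<lambda>z. a * z) ` I) = ideal_class I"
proof
  have comp: "(\<lambda>z. b * z) ` (\<lambda>z. a * z) ` I = (\<lambda>z. (b * a) * z) ` I" for b
    unfolding image_image by (simp only: mult.assoc)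
  show "ideal_class ((\<lambda>z. a * z) ` I) \<subseteq> ideal_class I"
    unfolding ideal_class_def comp using a K_mult[OF _ a(1)] by force
  show "ideal_class I \<subseteq> ideal_class ((\<lambda>z. a * z) ` I)"
  proof
    fix X assume "X \<in> ideal_class I"
    then obtain b where b: "b \<in> K" "b \<noteq> 0" "X = (\<lambda>z. b * z) ` I" unfolding ideal_class_def by blast
    have "b * inverse a * a = b" using a(2) by simp
    then have "X = (\<lambda>z. (b * inverse a) * z) ` (\<lambda>z. a * z) ` I"
      unfolding comp b(3) by (simp only:)
    moreover have "b * inverse a \<in> K" "b * inverse a \<noteq> 0" using K_mult[OF b(1) K_inverse[OF a(1)]] b(2) a(2) by simp_all
    ultimately show "X \<in> ideal_class ((\<lambda>z. a * z) ` I)" unfolding ideal_class_def by blast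
  qed
qed

lemma ideal_mult_principal:
  assumes I: "fractional_ideal R I"
  shows "ideal_mult ((\<lambda>r. a * r) ` R) I = (\<lambda>z. a * z) ` I"
proof
  note D = fractional_idealD[OF I]
  show "ideal_mult ((\<lambda>r. a * r) ` R) I \<subseteq> (\<lambda>z. a * z) ` I"
  proof
    fix x assume "x \<in> ideal_mult ((\<lambda>r. a * r) ` R) I"
    then obtain n :: nat and f g where x: "x = (\<Sum>k<n. f k * g k)" "\<forall>k<n. f k \<in> (\<lambda>r. a * r) ` R \<and> g k \<in> I"
      unfolding ideal_mult_def by blast
    have "(\<Sum>k<m. f k * g k) \<in> (\<lambda>z. a * z) ` I" if "m \<le> n" for m
      using that
    proof (induction m)
      case 0
      then show ?case using D by (auto intro!: image_eqI[of _ _ 0])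
    next
      case (Suc m)
      then obtain y where y: "y \<in> I" "(\<Sum>k<m. f k * g k) = a * y" by auto
      have fm: "f m \<in> (\<lambda>r. a * r) ` R" "g m \<in> I" using x(2) Suc.prems by auto
      then obtain r where r: "r \<in> R" "f m = a * r" "g m \<in> I" by blast
      have "y + r * g m \<in> I" using D y r by blast
      moreover have "(\<Sum>k<Suc m. f k * g k) = a * (y + r * g m)" using y r by (simp add: algebra_simps)
      ultimately show ?case by blast
    qed
    then show "x \<in> (\<lambda>z. a * z) ` I" using x(1) by blast
  qed
  show "(\<lambda>z. a * z) ` I \<subseteq> ideal_mult ((\<lambda>r. a * r) ` R) I"
  proof
    fix x assume "x \<in> (\<lambda>z. a * z) ` I"
    then obtain y where y: "y \<in> I" "x = a * y" by blast
    have "a \<in> (\<lambda>r. a * r) ` R" using R_1 by (intro image_eqI[of _ _ 1]) simp_all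
    then show "x \<in> ideal_mult ((\<lambda>r. a * r) ` R) I"
      unfolding ideal_mult_def
      using y by (intro CollectI exI[of _ "1::nat"] exI[of _ "\<lambda>_. a"] exI[of _ "\<lambda>_. y"]) simp
  qed
qed

text \<open>The coset of a fractional ideal under the principal ideals is the set of its nonzero
  multiples. Every fractional ideal is a multiple of some \<open>ideal_of B\<close>, and all of
  these are invertible, so matrices reach exactly the classes of the Picard group.\<close>

lemma carrier_picard_group: "carrier (picard_group R) = (\<lambda>B. ideal_class (ideal_of B)) ` S"
proof -
  have coset: "principal_ideals R #>\<^bsub>invertible_ideals R\<^esub> I = ideal_class I" if "fractional_ideal R I" for I
    using ideal_mult_principal[OF that]
    by (auto simp: r_coset_def principal_ideals_def ideal_class_def invertible_ideals_def)
  have carr: "carrier (picard_group R) = ideal_class ` carrier (invertible_ideals R)"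
    unfolding picard_group_def carrier_FactGroup
  proof (rule image_cong[OF refl])
    fix I assume "I \<in> carrier (invertible_ideals R)"
    then have "fractional_ideal R I" by (simp add: invertible_ideals_def)
    then show "principal_ideals R #>\<^bsub>invertible_ideals R\<^esub> I = ideal_class I" by (rule coset)
  qed
  show ?thesis
  proof
    show "carrier (picard_group R) \<subseteq> (\<lambda>B. ideal_class (ideal_of B)) ` S"
    proof
      fix X assume "X \<in> carrier (picard_group R)"
      then obtain J where J: "fractional_ideal R J" "X = ideal_class J" unfolding carr by (auto simp: invertible_ideals_def)
      obtain B a where "B \<in> S" and a: "a \<in> K" "a \<noteq> 0" and "J = (\<lambda>z. a * z) ` ideal_of B" using fractional_ideal_equivalent[OF J(1)] by blast
      then have "X = ideal_class (ideal_of B)" unfolding J(2) by (simp only: ideal_class_scale[OF a])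
      then show "X \<in> (\<lambda>B. ideal_class (ideal_of B)) ` S" using \<open>B \<in> S\<close> by (rule image_eqI)
    qed
    show "(\<lambda>B. ideal_class (ideal_of B)) ` S \<subseteq> carrier (picard_group R)"
      unfolding carr using ideal_of_invertible by blast
  qed
qed

lemma ideal_class_eq_iff:
  assumes B: "B \<in> S" and B': "B' \<in> S"
  shows "ideal_class (ideal_of B) = ideal_class (ideal_of B') \<longleftrightarrow> (\<exists>P. invertible P \<and> P ** B = B' ** P)"
proof
  assume eq: "ideal_class (ideal_of B) = ideal_class (ideal_of B')"
  have "ideal_of B' \<in> ideal_class (ideal_of B')"
    unfolding ideal_class_def using R_K[OF R_1] by (intro CollectI exI[of _ 1]) simp
  then have "ideal_of B' \<in> ideal_class (ideal_of B)" by (simp only: eq)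
  then obtain a where a: "a \<noteq> 0" "ideal_of B' = (\<lambda>z. a * z) ` ideal_of B" unfolding ideal_class_def by blast
  show "\<exists>P. invertible P \<and> P ** B = B' ** P" by (rule conjugate_if_ideals_equivalent[OF B B' a(1) a(2)[symmetric]])
next
  assume "\<exists>P. invertible P \<and> P ** B = B' ** P"
  then obtain P where P: "invertible P" "P ** B = B' ** P" by blast
  obtain a where a: "a \<in> K" "a \<noteq> 0" "(\<lambda>z. a * z) ` ideal_of B = ideal_of B'" using ideal_of_conjugate[OF B B' P] by blast
  then show "ideal_class (ideal_of B) = ideal_class (ideal_of B')" using ideal_class_scale[OF a(1,2), of "ideal_of B"] by simp
qed

end

section \<open>Counting classes\<close>

text \<open>Functions with the same fibres have images in bijection. This compares isomorphism
  classes with ideal classes through the matrices that represent both.\<close>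

lemma card_image_same_kernel:
  assumes "\<And>x y. x \<in> S \<Longrightarrow> y \<in> S \<Longrightarrow> f x = f y \<longleftrightarrow> g x = g y" and fin: "finite (g ` S)"
  shows "finite (f ` S) \<and> card (f ` S) = card (g ` S)"
proof -
  define h where "h y = f (inv_into S g y)" for y
  have hg: "h (g x) = f x" if "x \<in> S" for x
    using assms(1)[OF inv_into_into[of "g x" g S] that] f_inv_into_f[of "g x" g S] that by (simp add: h_def)
  have "f ` S = h ` g ` S" unfolding image_image by (rule image_cong) (simp_all add: hg)
  moreover have "inj_on h (g ` S)"
  proof (rule inj_onI)
    fix y z assume "y \<in> g ` S" "z \<in> g ` S" "h y = h z"
    then show "y = z" using hg assms(1) by auto
  qed
  ultimately show ?thesis using fin by (simp add: card_image)
qed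

section \<open>Reduction of matrices and finiteness\<close>

definition matrix2 :: "int \<Rightarrow> int \<Rightarrow> int \<Rightarrow> int \<Rightarrow> int^2^2"
  where "matrix2 a b c d = cols (vector [a, c]) (vector [b, d])"

lemma matrix2_entries [simp]:
  "matrix2 a b c d $ 1 $ 1 = a" "matrix2 a b c d $ 1 $ 2 = b"
  "matrix2 a b c d $ 2 $ 1 = c" "matrix2 a b c d $ 2 $ 2 = d"
  by (simp_all add: matrix2_def cols_def vector_2)

lemma finite_bounded_matrices: "finite {B :: int^2^2. \<forall>i j. \<bar>B$i$j\<bar> \<le> n}"
proof -
  have "{B :: int^2^2. \<forall>i j. \<bar>B$i$j\<bar> \<le> n} \<subseteq>
      (\<lambda>(a, b, c, d). matrix2 a b c d) ` ({-n..n} \<times> {-n..n} \<times> {-n..n} \<times> {-n..n})"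
  proof
    fix B :: "int^2^2" assume "B \<in> {B. \<forall>i j. \<bar>B$i$j\<bar> \<le> n}"
    then have "B$i$j \<in> {-n..n}" for i j by (auto simp: abs_le_iff minus_le_iff)
    moreover have "B = matrix2 (B$1$1) (B$1$2) (B$2$1) (B$2$2)" by (simp add: matrix_2_eq)
    ultimately show "B \<in> (\<lambda>(a, b, c, d). matrix2 a b c d) ` ({-n..n} \<times> {-n..n} \<times> {-n..n} \<times> {-n..n})"
      by (intro image_eqI[of _ _ "(B$1$1, B$1$2, B$2$1, B$2$2)"]) simp_all
  qed
  then show ?thesis by (rule finite_subset) simp
qed

definition conjugate :: "int^2^2 \<Rightarrow> int^2^2 \<Rightarrow> bool"
  where "conjugate B B' \<longleftrightarrow> (\<exists>P. invertible P \<and> P ** B = B' ** P)"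

lemma conjugate_refl: "conjugate B B"
  unfolding conjugate_def by (intro exI[of _ "mat 1"]) (simp add: invertible_int_matrixI)

lemma conjugate_trans:
  assumes "conjugate B C" "conjugate C D"
  shows "conjugate B D"
proof -
  obtain P Q where P: "invertible P" "P ** B = C ** P" and Q: "invertible Q" "Q ** C = D ** Q"
    using assms by (auto simp: conjugate_def)
  have "(Q ** P) ** B = D ** (Q ** P)" by (metis P(2) Q(2) matrix_mul_assoc)
  moreover have "invertible (Q ** P)" using P(1) Q(1) by (rule invertible_mult[rotated])
  ultimately show ?thesis unfolding conjugate_def by blast
qed

text \<open>Conjugation by the upper unipotent matrix with entry n: the lower left entry c stays,
  and the difference of the diagonal entries moves by 2 n c.\<close>

lemma conjugate_translate:
  "conjugate B (matrix2 (B$1$1 + n * B$2$1) (B$1$2 + n * (B$2$2 - B$1$1) - n * n * B$2$1) (B$2$1) (B$2$2 - n * B$2$1))"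
  unfolding conjugate_def
  by (intro exI[of _ "matrix2 1 n 0 1"])
    (simp add: matrix_2_eq mult_2 invertible_int_matrixI det_2 algebra_simps)

lemma conjugate_swap: "conjugate B (matrix2 (B$2$2) (B$2$1) (B$1$2) (B$1$1))"
  unfolding conjugate_def
  by (intro exI[of _ "matrix2 0 1 1 0"]) (simp add: matrix_2_eq mult_2 invertible_int_matrixI det_2)

text \<open>Translations move the diagonal difference in steps of 2 c, so a remainder modulo 2 |c|
  centred at 0 is attainable.\<close>

lemma centered_remainder:
  assumes "(c::int) \<noteq> 0"
  shows "\<exists>n. \<bar>x + 2 * n * c\<bar> \<le> \<bar>c\<bar>"
proof -
  define q where "q = (x + \<bar>c\<bar>) div (2 * \<bar>c\<bar>)"
  have "(x + \<bar>c\<bar>) mod (2 * \<bar>c\<bar>) = x + \<bar>c\<bar> - 2 * \<bar>c\<bar> * q" by (simp add: q_def minus_mult_div_eq_mod)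
  moreover have "0 \<le> (x + \<bar>c\<bar>) mod (2 * \<bar>c\<bar>)" "(x + \<bar>c\<bar>) mod (2 * \<bar>c\<bar>) < 2 * \<bar>c\<bar>" using assms by simp_all
  ultimately have "\<bar>x - 2 * \<bar>c\<bar> * q\<bar> \<le> \<bar>c\<bar>" by linarith
  moreover have "2 * (- sgn c * q) * c = - (2 * \<bar>c\<bar> * q)" by (simp add: abs_sgn mult_ac)
  then have "x + 2 * (- sgn c * q) * c = x - 2 * \<bar>c\<bar> * q" by simp
  ultimately show ?thesis by (intro exI[of _ "- sgn c * q"]) (simp only:)
qed

context quadratic_order
begin

text \<open>
  Choosing the lower left entry minimal in absolute value in its conjugacy class and then
  translating is the reduction of binary quadratic forms.
\<close>
lemma reduced_representative:
  assumes B: "B \<in> S"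
  shows "\<exists>B'\<in>S. (\<forall>i j. \<bar>B'$i$j\<bar> \<le> \<bar>t\<bar> + t^2 + 4) \<and> conjugate B B'"
proof -
  obtain B1 where B1: "B1 \<in> S" "conjugate B B1"
    "\<And>C. C \<in> S \<Longrightarrow> conjugate B C \<Longrightarrow> nat \<bar>B1$2$1\<bar> \<le> nat \<bar>C$2$1\<bar>"
    using ex_has_least_nat[of "\<lambda>C. C \<in> S \<and> conjugate B C" B "\<lambda>C. nat \<bar>C$2$1\<bar>"] B conjugate_refl by blast
  have c0: "B1$2$1 \<noteq> 0" by (rule SD(3)[OF B1(1)])
  obtain n where n: "\<bar>(B1$1$1 - B1$2$2) + 2 * n * B1$2$1\<bar> \<le> \<bar>B1$2$1\<bar>" using centered_remainder[OF c0] by blast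
  define B2 where "B2 = matrix2 (B1$1$1 + n * B1$2$1) (B1$1$2 + n * (B1$2$2 - B1$1$1) - n * n * B1$2$1) (B1$2$1) (B1$2$2 - n * B1$2$1)"
  define a b c d where "a = B2$1$1" and "b = B2$1$2" and "c = B2$2$1" and "d = B2$2$2"
  have cj: "conjugate B B2" unfolding B2_def by (rule conjugate_trans[OF B1(2) conjugate_translate])
  have S2: "B2 \<in> S" using SD(1,2)[OF B1(1)] by (simp add: S_def det_2 trace_2 B2_def algebra_simps)
  have cB1: "c = B1$2$1" by (simp add: c_def B2_def)
  have ad: "\<bar>d - a\<bar> \<le> \<bar>c\<bar>" using n by (simp add: a_def d_def cB1 B2_def algebra_simps)
  \<comment> \<open>Exchanging the basis vectors brings b to the lower left corner, so minimality of
    |c| bounds it by |b|.\<close>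
  have "matrix2 d c b a \<in> S" using SD(1,2)[OF S2] by (simp add: S_def det_2 trace_2 a_def b_def c_def d_def algebra_simps)
  moreover have "conjugate B (matrix2 d c b a)"
    unfolding a_def b_def c_def d_def by (rule conjugate_trans[OF cj conjugate_swap])
  ultimately have "nat \<bar>B1$2$1\<bar> \<le> nat \<bar>matrix2 d c b a $ 2 $ 1\<bar>" by (rule B1(3))
  then have bc: "\<bar>c\<bar> \<le> \<bar>b\<bar>" by (simp add: cB1)
  have D: "t^2 + 4 = (d - a)^2 + 4 * b * c" using SD(5)[OF S2] by (simp add: a_def b_def c_def d_def)
  have sum: "a + d = t" using SD(2)[OF S2] by (simp add: a_def d_def)
  have nz: "c \<noteq> 0" "b \<noteq> 0" using SD(3,4)[OF S2] by (simp_all add: b_def c_def)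
  have sq: "(d - a)^2 \<le> c^2" using ad by (simp add: abs_le_square_iff)
  have cc: "c^2 \<le> \<bar>b * c\<bar>"
  proof -
    have "c^2 = \<bar>c\<bar> * \<bar>c\<bar>" by (simp add: power2_eq_square)
    also have "\<dots> \<le> \<bar>b\<bar> * \<bar>c\<bar>" by (rule mult_right_mono[OF bc abs_ge_zero])
    finally show ?thesis by (simp add: abs_mult)
  qed
  \<comment> \<open>Otherwise the bound of (d - a)^2 by c^2 and of c^2 by |b c| would make t^2 + 4
    at most -3 c^2.\<close>
  have "b * c > 0"
  proof (rule ccontr)
    assume "\<not> b * c > 0"
    then have "b * c = - \<bar>b * c\<bar>" by simp
    then have "t^2 + 4 \<le> c^2 - 4 * c^2" using D sq cc by linarith
    moreover have "0 \<le> t^2" "0 \<le> c^2" by simp_all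
    ultimately show False by linarith
  qed
  then have bcD: "\<bar>b * c\<bar> \<le> t^2 + 4" using D zero_le_power2[of "d - a"] by linarith
  have "1 \<le> \<bar>c\<bar>" "1 \<le> \<bar>b\<bar>" using nz by linarith+
  then have b: "\<bar>b\<bar> \<le> t^2 + 4" "\<bar>c\<bar> \<le> t^2 + 4"
    using bcD mult_left_mono[of 1 "\<bar>c\<bar>" "\<bar>b\<bar>"] mult_right_mono[of 1 "\<bar>b\<bar>" "\<bar>c\<bar>"] by (simp_all add: abs_mult)
  have "\<bar>a\<bar> \<le> \<bar>t\<bar> + t^2 + 4" "\<bar>d\<bar> \<le> \<bar>t\<bar> + t^2 + 4" using ad b sum by linarith+
  moreover have "\<bar>b\<bar> \<le> \<bar>t\<bar> + t^2 + 4" "\<bar>c\<bar> \<le> \<bar>t\<bar> + t^2 + 4" using b by linarith+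
  ultimately have "\<forall>i j. \<bar>B2$i$j\<bar> \<le> \<bar>t\<bar> + t^2 + 4" by (simp add: forall_2 a_def b_def c_def d_def)
  then show ?thesis using S2 cj by blast
qed

text \<open>Every conjugacy class meets a finite set of reduced matrices. This makes the class
  number an honest count, as \<open>card\<close> is 0 on infinite sets.\<close>

lemma finite_ideal_classes: "finite ((\<lambda>B. ideal_class (ideal_of B)) ` S)"
proof (rule finite_subset)
  let ?S = "{B \<in> S. \<forall>i j. \<bar>B$i$j\<bar> \<le> \<bar>t\<bar> + t^2 + 4}"
  have "finite ?S" by (rule finite_subset[OF _ finite_bounded_matrices[of "\<bar>t\<bar> + t^2 + 4"]]) blast
  then show "finite ((\<lambda>B. ideal_class (ideal_of B)) ` ?S)" by (rule finite_imageI)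
  show "(\<lambda>B. ideal_class (ideal_of B)) ` S \<subseteq> (\<lambda>B. ideal_class (ideal_of B)) ` ?S"
  proof
    fix X assume "X \<in> (\<lambda>B. ideal_class (ideal_of B)) ` S"
    then obtain B where B: "B \<in> S" "X = ideal_class (ideal_of B)" by blast
    obtain B' where B': "B' \<in> S" "\<forall>i j. \<bar>B'$i$j\<bar> \<le> \<bar>t\<bar> + t^2 + 4" "conjugate B B'"
      using reduced_representative[OF B(1)] by blast
    then have "X = ideal_class (ideal_of B')"
      using ideal_class_eq_iff[OF B(1) B'(1)] B(2) by (simp add: conjugate_def)
    moreover have "B' \<in> ?S" using B' by simp
    ultimately show "X \<in> (\<lambda>B. ideal_class (ideal_of B)) ` ?S" by (rule image_eqI)
  qed
qed

end

text \<open>Eliminating one coordinate from the two eigenvector equations shows that the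
  characteristic polynomial times the other coordinate vanishes, and one coordinate is
  nonzero.\<close>

lemma eigenvalue_root:
  fixes A :: "int^2^2"
  assumes "det A = -1" "eigenvalue_of A lam"
  shows "lam * lam = of_int (trace A) * lam + 1"
proof -
  obtain v :: "complex^2" where v: "v \<noteq> 0" "map_matrix of_int A *v v = lam *s v"
    using assms(2) by (auto simp: eigenvalue_of_def)
  let ?a = "of_int (A$1$1) :: complex" and ?b = "of_int (A$1$2) :: complex"
    and ?c = "of_int (A$2$1) :: complex" and ?d = "of_int (A$2$2) :: complex"
  have 1: "?a * v$1 + ?b * v$2 = lam * v$1" and 2: "?c * v$1 + ?d * v$2 = lam * v$2"
    using v(2) by (simp_all add: vec2_eq matrix_vector_mult_def sum_2 map_matrix_def)
  have "A$1$1 * A$2$2 - A$1$2 * A$2$1 = -1" using assms(1) by (simp add: det_2)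
  then have "of_int (A$1$1 * A$2$2 - A$1$2 * A$2$1) = (of_int (-1) :: complex)" by (simp only:)
  then have d: "?a * ?d - ?b * ?c = -1" by simp
  have t: "of_int (trace A) = ?a + ?d" by (simp add: trace_2)
  have "v$1 \<noteq> 0 \<or> v$2 \<noteq> 0" using v(1) by (auto simp: vec2_eq)
  moreover have "v$1 * (lam * lam - (?a + ?d) * lam - 1) = 0" using 1 2 d by algebra
  moreover have "v$2 * (lam * lam - (?a + ?d) * lam - 1) = 0" using 1 2 d by algebra
  ultimately have "lam * lam - (?a + ?d) * lam - 1 = 0" by auto
  then show ?thesis unfolding t by (simp add: algebra_simps)
qed

lemma mapping_torus_change_sign:
  assumes B: "det B = -1"
  shows "\<exists>C. det C = -1 \<and> trace C = - trace B \<and> mapping_torus_group C \<cong> mapping_torus_group B"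
proof -
  \<comment> \<open>The inverse of \<open>B\<close>, written out for determinant -1.\<close>
  define C where "C = matrix2 (- B$2$2) (B$1$2) (B$2$1) (- B$1$1)"
  have d: "B$1$1 * B$2$2 - B$1$2 * B$2$1 = -1" using B by (simp add: det_2)
  have C: "det C = -1" "trace C = - trace B" using d by (simp_all add: C_def det_2 trace_2 algebra_simps)
  have "C ** B = mat 1" "B ** C = mat 1"
    using d by (simp_all add: matrix_2_eq mult_2 C_def mat_def algebra_simps)
  then have "mapping_torus_group C \<cong> mapping_torus_group B"
    by (intro mapping_torus_iso_inverse invertible_int_matrixI) (simp_all add: B C)
  then show ?thesis using C by blast
qed

theorem corollary1p3:
  fixes A :: "int ^ 2 ^ 2" and lam :: complex
  assumes "invertible A"
    and "det A = -1"
    and "squarefree ((trace A)^2 - 4 * det A)"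
    and "eigenvalue_of A lam"
  shows "finite (profinite_genus (mapping_torus_group A)) \<and>
    card (profinite_genus (mapping_torus_group A)) = class_number (int_adjoin lam)"
proof -
  have "quadratic_order lam (trace A)"
    using eigenvalue_root[OF assms(2,4)] assms(2,3) by (simp add: quadratic_order_def)
  then interpret quadratic_order lam "trace A" .
  let ?G = "mapping_torus_group A"
  define r where "r = {(H, K). H \<in> genus_groups ?G \<and> K \<in> genus_groups ?G \<and> H \<cong> K}"
  have r: "equiv (genus_groups ?G) r" unfolding r_def by (rule equiv_genus_groups)
  \<comment> \<open>A vanishing trace would make the discriminant equal to 4, a square.\<close>
  have tr: "trace A \<noteq> 0" using disc_not_square[of 2] by auto
  have inv: "invertible B" if "B \<in> S" for B
    using that by (intro invertible_int_matrixI) (simp add: S_def)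
  have grp: "group (mapping_torus_group B)" if "B \<in> S" for B
    by (rule group_mapping_torus_group[OF inv[OF that]])
  \<comment> \<open>The genus consists of groups on natural numbers, so each mapping torus is
    represented by an isomorphic copy of that kind.\<close>
  have "\<exists>K :: nat monoid. group K \<and> mapping_torus_group B \<cong> K" if B: "B \<in> S" for B
  proof (rule polycyclic_by_finite_nat_representative)
    have "(\<lambda>x. x) \<in> iso (mapping_torus_group B) (mapping_torus_group B)"
      by (simp add: iso_def hom_def bij_betw_def)
    then show "polycyclic_by_finite (mapping_torus_group B)"
      by (rule polycyclic_by_finite_if_iso_mapping_torus[OF inv[OF B] grp[OF B]])
  qed
  then obtain \<kappa> :: "int^2^2 \<Rightarrow> nat monoid" where \<kappa>: "\<And>B. B \<in> S \<Longrightarrow> group (\<kappa> B) \<and> mapping_torus_group B \<cong> \<kappa> B"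
    by metis
  have \<kappa>_genus: "\<kappa> B \<in> genus_groups ?G" if B: "B \<in> S" for B
  proof -
    obtain f where f: "f \<in> iso (mapping_torus_group B) (\<kappa> B)" using \<kappa>[OF B] by (auto simp: is_iso_def)
    have "isomorphic_completions (\<kappa> B) (mapping_torus_group B)"
      using isomorphic_completions_if_iso[OF _ grp[OF B] group.iso_set_sym[OF grp[OF B] f]] \<kappa>[OF B] by blast
    moreover have "isomorphic_completions (mapping_torus_group B) ?G"
      using isomorphic_completions_same_trace[OF assms(2,3)] B by (simp add: S_def)
    ultimately show ?thesis
      using polycyclic_by_finite_if_iso_mapping_torus[OF inv[OF B] conjunct1[OF \<kappa>[OF B]] f]
      by (auto simp: genus_groups_def intro: isomorphic_completions_trans)
  qed
  have eq_iff: "r `` {\<kappa> B} = r `` {\<kappa> B'} \<longleftrightarrow> ideal_class (ideal_of B) = ideal_class (ideal_of B')"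
    if B: "B \<in> S" and B': "B' \<in> S" for B B'
  proof -
    have "r `` {\<kappa> B} = r `` {\<kappa> B'} \<longleftrightarrow> \<kappa> B \<cong> \<kappa> B'"
      using eq_equiv_class_iff[OF r \<kappa>_genus[OF B] \<kappa>_genus[OF B']] \<kappa>_genus[OF B] \<kappa>_genus[OF B'] by (simp add: r_def)
    also have "\<dots> \<longleftrightarrow> mapping_torus_group B \<cong> mapping_torus_group B'"
      using \<kappa>[OF B] \<kappa>[OF B'] grp[OF B] grp[OF B'] by (meson iso_trans group.iso_sym)
    also have "\<dots> \<longleftrightarrow> (\<exists>P. invertible P \<and> P ** B = B' ** P)"
    proof
      assume "mapping_torus_group B \<cong> mapping_torus_group B'"
      then show "\<exists>P. invertible P \<and> P ** B = B' ** P"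
        using conjugate_if_mapping_torus_iso[OF inv[OF B] _ inv[OF B']] B B' tr by (simp add: S_def)
    next
      assume "\<exists>P. invertible P \<and> P ** B = B' ** P"
      then show "mapping_torus_group B \<cong> mapping_torus_group B'"
        using mapping_torus_iso_if_conjugate[OF inv[OF B] inv[OF B']] by blast
    qed
    finally show ?thesis using ideal_class_eq_iff[OF B B'] by simp
  qed
  have "profinite_genus ?G = (\<lambda>B. r `` {\<kappa> B}) ` S"
  proof
    show "(\<lambda>B. r `` {\<kappa> B}) ` S \<subseteq> profinite_genus ?G"
      unfolding profinite_genus_def r_def[symmetric] using \<kappa>_genus by (auto intro: quotientI)
    show "profinite_genus ?G \<subseteq> (\<lambda>B. r `` {\<kappa> B}) ` S"
    proof
      fix X assume "X \<in> profinite_genus ?G"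
      then obtain H where H: "H \<in> genus_groups ?G" "X = r `` {H}"
        unfolding profinite_genus_def r_def[symmetric] by (auto elim: quotientE)
      have "polycyclic_by_finite H" "isomorphic_completions H ?G" using H(1) by (simp_all add: genus_groups_def)
      then obtain B f where B: "invertible B" "det B = -1" "\<bar>trace B\<bar> = \<bar>trace A\<bar>" "f \<in> iso (mapping_torus_group B) H"
        using genus_group_is_mapping_torus[OF assms(1,2) tr, of H] by blast
      \<comment> \<open>The trace is known only up to sign; if it is wrong, the inverse matrix has
        an isomorphic mapping torus and the right trace.\<close>
      have "\<exists>C\<in>S. mapping_torus_group C \<cong> H"
      proof (cases "trace B = trace A")
        case True
        then show ?thesis using B by (auto simp: S_def is_iso_def)
      next
        case False
        then have "trace B = - trace A" using B(3) by linarith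
        then obtain C where "C \<in> S" "mapping_torus_group C \<cong> mapping_torus_group B"
          using mapping_torus_change_sign[OF B(2)] by (auto simp: S_def)
        moreover have "mapping_torus_group B \<cong> H" using B(4) by (auto simp: is_iso_def)
        ultimately show ?thesis using iso_trans by blast
      qed
      then obtain C where C: "C \<in> S" "mapping_torus_group C \<cong> H" by blast
      have "\<kappa> C \<cong> H" using \<kappa>[OF C(1)] C grp[OF C(1)] by (meson iso_trans group.iso_sym)
      then have "(\<kappa> C, H) \<in> r" using \<kappa>_genus[OF C(1)] H(1) by (simp add: r_def)
      then have "X = r `` {\<kappa> C}" using equiv_class_eq[OF r] H(2) by simp
      then show "X \<in> (\<lambda>B. r `` {\<kappa> B}) ` S" using C(1) by (rule image_eqI)
    qed
  qed
  moreover have "class_number (int_adjoin lam) = card ((\<lambda>B. ideal_class (ideal_of B)) ` S)"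
    unfolding class_number_def Coset.order_def R_def[symmetric] carrier_picard_group ..
  ultimately show ?thesis
    using card_image_same_kernel[OF eq_iff finite_ideal_classes] by simp
qed

end
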